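(* Let $0\le\alpha<1$, let $(A,B)$ be a subinterval of $(a,b)$ (so $a\le A<B\le b$), and fix $a_0\in\mathbb{R}$. Let $L$ be a function $(t,s,p)\mapsto L(t,s,p)$ on $(a,b)\times\mathbb{R}\times\mathbb{R}$ such that $L\in C^1((a,b)\times\mathbb{R}\times\mathbb{R})$ and $t\mapsto \partial_3L(t,u(t),{}_aD_t^\alpha u)$ belongs to $AC([a,b])$ for every $u\in AC([a,b])$. Let $u^*\in AC([a,b])$ be an extremal (minimizer or maximizer) of the functional $$\mathcal{L}[u]=\int_A^B L(t,u(t),{}_aD_t^\alpha u)\,dt$$ over the admissible set $\{u\in AC([a,b]) : u(a)=a_0\}$. Then $u=u^*$ satisfies the Euler-Lagrange equations $$\frac{\partial L}{\partial u}+{}_t^cD_B^\alpha\Big(\frac{\partial L}{\partial {}_aD_t^\alpha u}\Big)+\frac{\partial L}{\partial {}_aD_t^\alpha u}\Big|_{t=B}\,\frac{1}{\Gamma(1-\alpha)}\frac{1}{(B-t)^\alpha}=0,\qquad t\in(A,B),$$ $${}_tD_B^\alpha\Big(\frac{\partial L}{\partial {}_aD_t^\alpha u}\Big)-{}_tD_A^\alpha\Big(\frac{\partial L}{\partial {}_aD_t^\alpha u}\Big)=0,\qquad t\in(a,A).$$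
   Context: $AC([a,b])$ is the set of absolutely continuous functions on $[a,b]$. For $0\le\alpha<1$ and $u\in AC([a,b])$, the left Riemann-Liouville fractional derivative is $${}_aD_t^\alpha u=\frac{1}{\Gamma(1-\alpha)}\frac{d}{dt}\int_a^t(t-\theta)^{-\alpha}u(\theta)\,d\theta.$$ For an absolutely continuous function $g$ and an endpoint $E$ (here $E=A$ or $E=B$), for $t<E$ the right Riemann-Liouville fractional derivative is $${}_tD_E^\alpha g=\frac{1}{\Gamma(1-\alpha)}\Big(-\frac{d}{dt}\Big)\int_t^E(\theta-t)^{-\alpha}g(\theta)\,d\theta,$$ and the right Caputo fractional derivative is $${}_t^cD_E^\alpha g=-\frac{1}{\Gamma(1-\alpha)}\int_t^E(\theta-t)^{-\alpha}\dot g(\theta)\,d\theta.$$ $\partial_1L,\partial_2L,\partial_3L$ denote the partial derivatives of $L$ with respect to its first, second and third arguments. $\frac{\partial L}{\partial u}$ denotes the function $t\mapsto\partial_2L(t,u(t),{}_aD_t^\alpha u)$, and $\frac{\partial L}{\partial {}_aD_t^\alpha u}$ denotes the function $t\mapsto\partial_3L(t,u(t),{}_aD_t^\alpha u)$ on $[a,b]$. When $A=a$ the second equation is vacuous. *)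

theory Defs
  imports "HOL-Analysis.Analysis"
begin

text \<open>
  Functions on \<open>[a,b]\<close> are total functions on the reals, of which only the values on \<open>{a..b}\<close>
  matter.
\<close>

definition AC :: "real \<Rightarrow> real \<Rightarrow> (real \<Rightarrow> real) set" where
  "AC a b = {u. \<forall>\<epsilon>>0. \<exists>\<delta>>0. \<forall>(n::nat) x y.
     (\<forall>i<n. a \<le> x i \<and> x i \<le> y i \<and> y i \<le> b) \<longrightarrow>
     disjoint_family_on (\<lambda>i. {x i<..<y i}) {..<n} \<longrightarrow>
     (\<Sum>i<n. y i - x i) < \<delta> \<longrightarrow>
     (\<Sum>i<n. \<bar>u (y i) - u (x i)\<bar>) < \<epsilon>}"

text \<open>
  For \<open>u \<in> AC a b\<close> the fractional derivatives below, and the ordinary derivative inside the Caputo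
  derivative, exist almost everywhere on the relevant interval. Where \<open>deriv\<close> has no derivative to
  return, its value is unspecified.
\<close>

definition left_RL :: "real \<Rightarrow> real \<Rightarrow> (real \<Rightarrow> real) \<Rightarrow> real \<Rightarrow> real" where
  "left_RL \<alpha> a u t =
     1 / Gamma (1 - \<alpha>) *
     deriv (\<lambda>x. LINT \<theta>:{a<..<x}|lebesgue. (x - \<theta>) powr (-\<alpha>) * u \<theta>) t"

definition right_RL :: "real \<Rightarrow> real \<Rightarrow> (real \<Rightarrow> real) \<Rightarrow> real \<Rightarrow> real" where
  "right_RL \<alpha> E g t =
     1 / Gamma (1 - \<alpha>) *
     (- deriv (\<lambda>x. LINT \<theta>:{x<..<E}|lebesgue. (\<theta> - x) powr (-\<alpha>) * g \<theta>) t)"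

definition right_Caputo :: "real \<Rightarrow> real \<Rightarrow> (real \<Rightarrow> real) \<Rightarrow> real \<Rightarrow> real" where
  "right_Caputo \<alpha> E g t =
     - (1 / Gamma (1 - \<alpha>)) *
     (LINT \<theta>:{t<..<E}|lebesgue. (\<theta> - t) powr (-\<alpha>) * deriv g \<theta>)"

definition C1_on :: "('a::real_normed_vector \<Rightarrow> 'b::real_normed_vector) \<Rightarrow> 'a set \<Rightarrow> bool" where
  "C1_on f S \<longleftrightarrow> (\<exists>f' :: 'a \<Rightarrow> 'a \<Rightarrow>\<^sub>L 'b.
     (\<forall>z\<in>S. (f has_derivative blinfun_apply (f' z)) (at z)) \<and> continuous_on S f')"

definition partial2 :: "(real \<times> real \<times> real \<Rightarrow> real) \<Rightarrow> real \<times> real \<times> real \<Rightarrow> real" where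
  "partial2 L = (\<lambda>(t, s, p). deriv (\<lambda>x. L (t, x, p)) s)"

definition partial3 :: "(real \<times> real \<times> real \<Rightarrow> real) \<Rightarrow> real \<times> real \<times> real \<Rightarrow> real" where
  "partial3 L = (\<lambda>(t, s, p). deriv (\<lambda>x. L (t, s, x)) p)"

definition jet :: "real \<Rightarrow> real \<Rightarrow> (real \<Rightarrow> real) \<Rightarrow> real \<Rightarrow> real \<times> real \<times> real" where
  "jet \<alpha> a u t = (t, u t, left_RL \<alpha> a u t)"

text \<open>
  The fractional derivative of an absolutely continuous function is defined only almost everywhere
  and the Lagrangian only for \<open>t\<close> in the open interval \<open>(a,b)\<close>. That \<open>t \<mapsto> \<partial>\<^sub>3L(t, u(t), D\<^sup>\<alpha>u(t))\<close>
  is in \<open>AC([a,b])\<close> therefore means that it agrees almost everywhere with an absolutely continuous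
  function \<open>G\<close> on \<open>[a,b]\<close>. The restriction of \<open>G\<close> to \<open>[a,b]\<close> is then unique, and supplies the
  pointwise values, in particular the one at \<open>t = B\<close>.
\<close>

definition AC_version :: "real \<Rightarrow> real \<Rightarrow> (real \<Rightarrow> real) \<Rightarrow> (real \<Rightarrow> real) \<Rightarrow> bool" where
  "AC_version a b f G \<longleftrightarrow> G \<in> AC a b \<and> (AE t\<in>{a<..<b} in lebesgue. G t = f t)"

definition action ::
  "real \<Rightarrow> real \<Rightarrow> real \<Rightarrow> real \<Rightarrow> (real \<times> real \<times> real \<Rightarrow> real) \<Rightarrow> (real \<Rightarrow> real) \<Rightarrow> real" where
  "action \<alpha> a A B L u = (LINT t:{A<..<B}|lebesgue. L (jet \<alpha> a u t))"

text \<open>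
  Competitors on which the action is not defined as a finite Lebesgue integral are left out, since
  Isabelle would assign them the value 0. If the action is finite on all functions \<open>u\<close> in \<open>AC a b\<close>
  with \<open>u a = a0\<close>, this set is exactly the set of those functions.
\<close>

definition admissible ::
  "real \<Rightarrow> real \<Rightarrow> real \<Rightarrow> real \<Rightarrow> real \<Rightarrow> (real \<times> real \<times> real \<Rightarrow> real) \<Rightarrow> real \<Rightarrow>
   (real \<Rightarrow> real) set" where
  "admissible \<alpha> a b A B L a0 =
     {u \<in> AC a b. u a = a0 \<and> set_integrable lebesgue {A<..<B} (\<lambda>t. L (jet \<alpha> a u t))}"

definition extremal :: "('a \<Rightarrow> real) \<Rightarrow> 'a set \<Rightarrow> 'a \<Rightarrow> bool" where
  "extremal F X u \<longleftrightarrow> is_arg_min F (\<lambda>v. v \<in> X) u \<or> is_arg_max F (\<lambda>v. v \<in> X) u"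

end

theory Submission
  imports Defs
begin

text \<open>
  Write \<open>D\<close> for the left Riemann-Liouville derivative of order \<open>\<alpha>\<close> started at \<open>a\<close>, and let \<open>G\<close> be the
  absolutely continuous version of \<open>\<partial>\<^sub>3L\<close> along the extremal \<open>u\<close>. For a test function \<open>\<eta>\<close> that vanishes
  near \<open>a\<close> and \<open>b\<close>, comparing \<open>u\<close> with \<open>u + \<epsilon>\<eta>\<close> and letting \<open>\<epsilon>\<close> tend to \<open>0\<close> should give
  \<open>\<integral>\<^sub>A\<^sup>B (\<partial>\<^sub>2L \<eta> + G D\<eta>) = 0\<close>. This weak equation (\<open>weak_euler_lagrange\<close>) is the heart of the matter. The
  two strong equations are its content for \<open>\<eta>\<close> supported in \<open>(A,B)\<close> and in \<open>(a,A)\<close>: in the second case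
  \<open>\<partial>\<^sub>2L\<close> drops out, but the nonlocal \<open>D\<eta>\<close> is still felt on \<open>(A,B)\<close>.

  The difficulty is to justify the weak equation. The derivative \<open>Du\<close> is merely integrable, \<open>D\<eta>\<close> does not
  vanish to the right of the support of \<open>\<eta>\<close>, and nothing restricts the growth of \<open>L\<close> in its third
  argument or near the endpoints, so that it is not even clear that the action of \<open>u + \<epsilon>\<eta>\<close> is finite. The
  regularity hypothesis on \<open>\<partial>\<^sub>3L\<close> settles this, because for \<open>\<alpha> > 0\<close> it is very strong. There are absolutely
  continuous \<open>v\<close> for which \<open>Dv\<close> jumps at a given point \<open>c\<close> between prescribed values \<open>p\<close> and \<open>q\<close> while
  \<open>v(c)\<close> is prescribed as well; since \<open>\<partial>\<^sub>3L\<close> along \<open>v\<close> has a continuous version, \<open>\<partial>\<^sub>3L(c,v(c),p)\<close> and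
  \<open>\<partial>\<^sub>3L(c,v(c),q)\<close> agree (\<open>partial3_independent\<close>). Thus \<open>L\<close> is affine in its third argument. Off the
  support of \<open>\<eta>\<close> the integrand then changes by exactly \<open>\<epsilon> G D\<eta>\<close>, and on the support, a compact subset of
  \<open>(a,b)\<close>, it changes by at most a multiple of \<open>\<epsilon> (1 + \<bar>Du\<bar>)\<close>. For \<open>\<alpha> = 0\<close> one has \<open>Dv = v\<close>, so that
  everything is local and takes place in a compact set.

  It suffices to take trapezoids for \<open>\<eta>\<close>, equal to \<open>1\<close> between \<open>x\<close> and \<open>y\<close> up to ramps of length \<open>h\<close>.
  Their derivatives \<open>D\<eta>\<close> are explicit, and \<open>h \<rightarrow> 0\<close> turns the weak equation into
  \<open>\<Gamma>(1-\<alpha>) \<integral>\<^sub>x\<^sup>y \<partial>\<^sub>2L + K(x) - K(y) = 0\<close>, where \<open>K(x)\<close> is the integral of \<open>(t-x)\<^sup>-\<^sup>\<alpha> G(t)\<close> over the \<open>t\<close> in \<open>(A,B)\<close>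
  beyond \<open>x\<close>, and the first integral extends over the part of \<open>(x,y)\<close> in \<open>(A,B)\<close>
  (\<open>du_bois_reymond_trapezoid_limit\<close>). For \<open>x < y < A\<close> it says that \<open>K\<close> is constant
  on \<open>(a,A)\<close>. There \<open>K\<close> is the difference of the Abel integrals of \<open>G\<close> up to \<open>B\<close> and up to \<open>A\<close>, whose
  derivatives are \<open>-\<Gamma>(1-\<alpha>)\<close> times the two right Riemann-Liouville derivatives. For \<open>A < x < y < B\<close>, where \<open>K\<close> is the
  Abel integral of \<open>G\<close> up to \<open>B\<close>, it is the first equation integrated from \<open>x\<close> to \<open>y\<close>, because the
  Abel integral of an absolutely continuous function is itself an indefinite integral
  (\<open>abel_integral_right_primitive\<close>), of a function built from the boundary value and the Caputo derivative.

  This rests on two facts about absolutely continuous functions in the \<open>\<epsilon>\<close>-\<open>\<delta>\<close> sense: they are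
  indefinite integrals (\<open>AC_has_density\<close>), and an indefinite integral is differentiable almost everywhere
  (\<open>negligible_indefinite_integral_not_derivative\<close>).
\<close>

section \<open>Absolutely continuous functions\<close>

text \<open>
  The definition of \<open>AC\<close> numbers its intervals by an initial segment of the naturals. Cutting
  intervals in two and merging several families is easier with an arbitrary finite index set.
\<close>

definition interval_family :: "real \<Rightarrow> real \<Rightarrow> 'i set \<Rightarrow> ('i \<Rightarrow> real) \<Rightarrow> ('i \<Rightarrow> real) \<Rightarrow> bool" where
  "interval_family a b I x y \<longleftrightarrow> finite I \<and> (\<forall>i\<in>I. a \<le> x i \<and> x i \<le> y i \<and> y i \<le> b) \<and>
     disjoint_family_on (\<lambda>i. {x i<..<y i}) I"

lemma AC_iff_interval_family:
  "u \<in> AC a b \<longleftrightarrow> (\<forall>\<epsilon>>0. \<exists>\<delta>>0. \<forall>(n::nat) x y. interval_family a b {..<n} x y \<longrightarrow>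
     (\<Sum>i<n. y i - x i) < \<delta> \<longrightarrow> (\<Sum>i<n. \<bar>u (y i) - u (x i)\<bar>) < \<epsilon>)"
  by (simp add: AC_def interval_family_def Ball_def imp_conjL)

lemma AC_imp_small_variation:
  assumes "u \<in> AC a b" "\<epsilon> > 0"
  shows "\<exists>\<delta>>0. \<forall>(I::'i set) x y. interval_family a b I x y \<longrightarrow> (\<Sum>i\<in>I. y i - x i) < \<delta>
       \<longrightarrow> (\<Sum>i\<in>I. \<bar>u (y i) - u (x i)\<bar>) < \<epsilon>"
proof -
  from assms obtain \<delta> where \<delta>: "\<delta> > 0" and D: "\<And>(n::nat) x y. \<lbrakk>interval_family a b {..<n} x y;
       (\<Sum>i<n. y i - x i) < \<delta>\<rbrakk> \<Longrightarrow> (\<Sum>i<n. \<bar>u (y i) - u (x i)\<bar>) < \<epsilon>"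
    unfolding AC_iff_interval_family by blast
  show ?thesis
  proof (intro exI[of _ \<delta>] conjI allI impI \<delta>)
    fix I :: "'i set" and x y :: "'i \<Rightarrow> real"
    assume f: "interval_family a b I x y" and len: "(\<Sum>i\<in>I. y i - x i) < \<delta>"
    have "finite I" using f by (simp add: interval_family_def)
    from ex_bij_betw_nat_finite[OF this] obtain h where h: "bij_betw h {..<card I} I"
      by (auto simp: atLeast0LessThan)
    have re: "(\<Sum>i<card I. F (h i)) = (\<Sum>i\<in>I. F i)" for F :: "'i \<Rightarrow> real"
      by (rule sum.reindex_bij_betw[OF h])
    have hI: "h i \<in> I" if "i < card I" for i using h that by (auto simp: bij_betw_def)
    have "disjoint_family_on (\<lambda>i. {x (h i)<..<y (h i)}) {..<card I}"
      unfolding disjoint_family_on_def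
    proof (intro ballI impI)
      fix i j assume "i \<in> {..<card I}" "j \<in> {..<card I}" "i \<noteq> j"
      then have "h i \<noteq> h j" "h i \<in> I" "h j \<in> I" using h by (auto simp: bij_betw_def inj_on_def)
      then show "{x (h i)<..<y (h i)} \<inter> {x (h j)<..<y (h j)} = {}"
        using f unfolding interval_family_def disjoint_family_on_def by blast
    qed
    then have "interval_family a b {..<card I} (\<lambda>i. x (h i)) (\<lambda>i. y (h i))"
      using f hI by (simp add: interval_family_def)
    from D[OF this] len show "(\<Sum>i\<in>I. \<bar>u (y i) - u (x i)\<bar>) < \<epsilon>"
      by (simp add: re[of "\<lambda>i. y i - x i"] re[of "\<lambda>i. \<bar>u (y i) - u (x i)\<bar>"])
  qed
qed

lemma AC_subinterval:
  assumes "u \<in> AC a b" "a \<le> a'" "b' \<le> b"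
  shows "u \<in> AC a' b'"
proof -
  have "interval_family a b I x y" if "interval_family a' b' I x y" for I :: "nat set" and x y
    using that assms(2,3) by (force simp: interval_family_def)
  then show ?thesis using assms(1) unfolding AC_iff_interval_family by meson
qed

lemma AC_cong:
  assumes u: "u \<in> AC a b" and eq: "\<And>t. \<lbrakk>a \<le> t; t \<le> b\<rbrakk> \<Longrightarrow> v t = u t"
  shows "v \<in> AC a b"
proof -
  have "(\<Sum>i<n. \<bar>v (y i) - v (x i)\<bar>) = (\<Sum>i<n. \<bar>u (y i) - u (x i)\<bar>)"
    if "interval_family a b {..<n} x y" for n :: nat and x y
  proof (rule sum.cong[OF refl])
    fix i assume "i \<in> {..<n}"
    then have "a \<le> x i" "x i \<le> y i" "y i \<le> b" using that by (auto simp: interval_family_def)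
    then have "v (x i) = u (x i)" "v (y i) = u (y i)" by (auto intro: eq)
    then show "\<bar>v (y i) - v (x i)\<bar> = \<bar>u (y i) - u (x i)\<bar>" by simp
  qed
  then show ?thesis using u unfolding AC_iff_interval_family by metis
qed

lemma AC_add_scaled:
  assumes u: "u \<in> AC a b" and v: "v \<in> AC a b"
  shows "(\<lambda>t. u t + c * v t) \<in> AC a b"
  unfolding AC_iff_interval_family
proof (intro allI impI)
  fix \<epsilon> :: real assume "\<epsilon> > 0"
  define e where "e = \<epsilon> / (2 * (\<bar>c\<bar> + 1))"
  have "\<bar>c\<bar> + 1 > 0" by linarith
  then have "e > 0" "\<bar>c\<bar> * e \<le> \<epsilon> / 2" using \<open>\<epsilon> > 0\<close> by (auto simp: e_def field_simps)
  obtain d1 where d1: "d1 > 0" "\<And>(I::nat set) x y. \<lbrakk>interval_family a b I x y; (\<Sum>i\<in>I. y i - x i) < d1\<rbrakk>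
       \<Longrightarrow> (\<Sum>i\<in>I. \<bar>u (y i) - u (x i)\<bar>) < \<epsilon> / 2"
    using AC_imp_small_variation[where 'i=nat, OF u half_gt_zero[OF \<open>\<epsilon> > 0\<close>]] by blast
  obtain d2 where d2: "d2 > 0" "\<And>(I::nat set) x y. \<lbrakk>interval_family a b I x y; (\<Sum>i\<in>I. y i - x i) < d2\<rbrakk>
       \<Longrightarrow> (\<Sum>i\<in>I. \<bar>v (y i) - v (x i)\<bar>) < e"
    using AC_imp_small_variation[where 'i=nat, OF v \<open>e > 0\<close>] by blast
  show "\<exists>\<delta>>0. \<forall>(n::nat) x y. interval_family a b {..<n} x y \<longrightarrow> (\<Sum>i<n. y i - x i) < \<delta> \<longrightarrow>
     (\<Sum>i<n. \<bar>u (y i) + c * v (y i) - (u (x i) + c * v (x i))\<bar>) < \<epsilon>"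
  proof (intro exI[of _ "min d1 d2"] conjI allI impI)
    show "min d1 d2 > 0" using d1 d2 by simp
    fix n :: nat and x y :: "nat \<Rightarrow> real"
    assume A: "interval_family a b {..<n} x y" "(\<Sum>i<n. y i - x i) < min d1 d2"
    have 1: "(\<Sum>i<n. \<bar>u (y i) - u (x i)\<bar>) < \<epsilon> / 2" using A by (intro d1) auto
    have 2: "(\<Sum>i<n. \<bar>v (y i) - v (x i)\<bar>) < e" using A by (intro d2) auto
    have "(\<Sum>i<n. \<bar>u (y i) + c * v (y i) - (u (x i) + c * v (x i))\<bar>)
      \<le> (\<Sum>i<n. \<bar>u (y i) - u (x i)\<bar> + \<bar>c\<bar> * \<bar>v (y i) - v (x i)\<bar>)"
    proof (rule sum_mono)
      fix i
      have "u (y i) + c * v (y i) - (u (x i) + c * v (x i)) = (u (y i) - u (x i)) + c * (v (y i) - v (x i))"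
        by (simp add: algebra_simps)
      then show "\<bar>u (y i) + c * v (y i) - (u (x i) + c * v (x i))\<bar> \<le> \<bar>u (y i) - u (x i)\<bar> + \<bar>c\<bar> * \<bar>v (y i) - v (x i)\<bar>"
        by (metis abs_mult abs_triangle_ineq)
    qed
    also have "\<dots> = (\<Sum>i<n. \<bar>u (y i) - u (x i)\<bar>) + \<bar>c\<bar> * (\<Sum>i<n. \<bar>v (y i) - v (x i)\<bar>)"
      by (simp add: sum.distrib sum_distrib_left)
    also have "\<dots> \<le> (\<Sum>i<n. \<bar>u (y i) - u (x i)\<bar>) + \<bar>c\<bar> * e"
      using 2 by (intro add_left_mono mult_left_mono) auto
    also have "\<dots> < \<epsilon>" using 1 \<open>\<bar>c\<bar> * e \<le> \<epsilon> / 2\<close> by linarith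
    finally show "(\<Sum>i<n. \<bar>u (y i) + c * v (y i) - (u (x i) + c * v (x i))\<bar>) < \<epsilon>" .
  qed
qed

lemma AC_imp_continuous_on:
  assumes u: "u \<in> AC a b"
  shows "continuous_on {a..b} u"
  unfolding continuous_on_iff
proof (intro ballI allI impI)
  fix s e :: real assume s: "s \<in> {a..b}" and "e > 0"
  obtain d where d: "d > 0" "\<And>(I::nat set) x y. \<lbrakk>interval_family a b I x y; (\<Sum>i\<in>I. y i - x i) < d\<rbrakk>
       \<Longrightarrow> (\<Sum>i\<in>I. \<bar>u (y i) - u (x i)\<bar>) < e"
    using AC_imp_small_variation[where 'i=nat, OF u \<open>e > 0\<close>] by blast
  have "dist (u t) (u s) < e" if "t \<in> {a..b}" "dist t s < d" for t
    using d(2)[of "{0}" "\<lambda>_. min s t" "\<lambda>_. max s t"] that s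
    by (auto simp: interval_family_def disjoint_family_on_def dist_real_def min_def max_def abs_real_def split: if_splits)
  with d(1) show "\<exists>d>0. \<forall>t\<in>{a..b}. dist t s < d \<longrightarrow> dist (u t) (u s) < e" by blast
qed

lemma interval_family_length_le_measure:
  fixes x y :: "'i \<Rightarrow> real"
  assumes f: "interval_family a b I x y" and sub: "\<And>i. i \<in> I \<Longrightarrow> {x i<..<y i} \<subseteq> S"
    and S: "S \<in> lmeasurable"
  shows "(\<Sum>i\<in>I. y i - x i) \<le> measure lebesgue S"
proof -
  have fin: "finite I" and le: "\<And>i. i \<in> I \<Longrightarrow> x i \<le> y i" and dis: "disjoint_family_on (\<lambda>i. {x i<..<y i}) I"
    using f by (auto simp: interval_family_def)
  have "(\<Sum>i\<in>I. y i - x i) = (\<Sum>i\<in>I. measure lebesgue {x i<..<y i})"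
    using le by (intro sum.cong) auto
  also have "\<dots> = measure lebesgue (\<Union>i\<in>I. {x i<..<y i})"
    by (rule measure_finite_Union[symmetric]) (use fin dis le in \<open>auto simp: emeasure_lborel_Ioo\<close>)
  also have "\<dots> \<le> measure lebesgue S"
    using sub S fin by (intro measure_mono_fmeasurable) (auto intro!: sets.finite_UN)
  finally show ?thesis .
qed

lemma lborel_set_integral_split:
  fixes g :: "real \<Rightarrow> real"
  assumes "set_integrable lborel {a..b} g" "a \<le> x" "x \<le> b"
  shows "(LINT t:{a..b}|lborel. g t) = (LINT t:{a..x}|lborel. g t) + (LINT t:{x..b}|lborel. g t)"
proof -
  have "{a..b} = {a..x} \<union> {x..b}" using assms by auto
  moreover have "(LINT t:{a..x} \<union> {x..b}|lborel. g t) = (LINT t:{a..x}|lborel. g t) + (LINT t:{x..b}|lborel. g t)"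
  proof (rule set_integral_Un_AE)
    show "AE t in lborel. \<not> (t \<in> {a..x} \<and> t \<in> {x..b})"
      using AE_lborel_singleton[of x] by eventually_elim auto
    show "set_integrable lborel {a..x} g" "set_integrable lborel {x..b} g"
      by (rule set_integrable_subset[OF assms(1)]; use assms in auto)+
  qed auto
  ultimately show ?thesis by simp
qed

lemma set_integrable_whole: "integrable M f \<Longrightarrow> S \<in> sets M \<Longrightarrow> set_integrable M S f"
  for f :: "'a \<Rightarrow> real"
  unfolding set_integrable_def by (rule integrable_mult_indicator)

text \<open>
  An indefinite integral is absolutely continuous because \<open>g\<close> is bounded outside a set on which
  \<open>\<bar>g\<bar>\<close> has small integral: over intervals of small total length the bounded part contributes
  little, and the disjointness of the intervals makes the unbounded part contribute its integral at
  most once.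
\<close>

lemma indefinite_integral_AC:
  fixes g :: "real \<Rightarrow> real"
  assumes g: "integrable lborel g"
  shows "(\<lambda>x. c + (LINT t:{a..x}|lborel. g t)) \<in> AC a b"
  unfolding AC_iff_interval_family
proof (intro allI impI)
  fix \<epsilon> :: real assume "\<epsilon> > 0"
  have [measurable]: "g \<in> borel_measurable borel" using g by (auto dest: borel_measurable_integrable)
  define tail where "tail = (\<lambda>n t. if \<bar>g t\<bar> > real n then \<bar>g t\<bar> else 0)"
  have tail_int: "integrable lborel (tail n)" for n
    by (rule Bochner_Integration.integrable_bound[OF integrable_abs[OF g]]) (auto simp: tail_def)
  have "(\<lambda>n. integral\<^sup>L lborel (tail n)) \<longlonglongrightarrow> integral\<^sup>L lborel (\<lambda>t::real. 0 :: real)"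
  proof (rule integral_dominated_convergence[where w = "\<lambda>t. \<bar>g t\<bar>" and f = "\<lambda>t. 0" and s = tail])
    show "AE t in lborel. (\<lambda>n. tail n t) \<longlonglongrightarrow> 0"
    proof (rule AE_I2)
      fix t
      obtain n :: nat where n: "\<bar>g t\<bar> \<le> real n" using real_arch_simple by blast
      have "\<forall>\<^sub>F m in sequentially. tail m t = 0"
        using eventually_ge_at_top[of n] by eventually_elim (use n in \<open>auto simp: tail_def\<close>)
      then show "(\<lambda>n. tail n t) \<longlonglongrightarrow> 0" by (rule tendsto_eventually)
    qed
  qed (use g in \<open>auto simp: tail_def\<close>)
  then have "\<forall>\<^sub>F n in sequentially. (\<integral>t. tail n t \<partial>lborel) < \<epsilon> / 2"
    using \<open>\<epsilon> > 0\<close> by (intro order_tendstoD) auto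
  then obtain n where n: "(\<integral>t. tail n t \<partial>lborel) < \<epsilon> / 2" by (auto simp: eventually_sequentially)
  define d where "d = \<epsilon> / (2 * (real n + 1))"
  have "d > 0" "real n * d \<le> \<epsilon> / 2" using \<open>\<epsilon> > 0\<close> by (auto simp: d_def field_simps)
  let ?u = "\<lambda>x. c + (LINT t:{a..x}|lborel. g t)"
  show "\<exists>\<delta>>0. \<forall>(n::nat) x y. interval_family a b {..<n} x y \<longrightarrow> (\<Sum>i<n. y i - x i) < \<delta> \<longrightarrow>
     (\<Sum>i<n. \<bar>?u (y i) - ?u (x i)\<bar>) < \<epsilon>"
  proof (intro exI[of _ d] conjI allI impI \<open>d > 0\<close>)
    fix N :: nat and x y :: "nat \<Rightarrow> real"
    assume f: "interval_family a b {..<N} x y" and len: "(\<Sum>i<N. y i - x i) < d"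
    then have bd: "\<forall>i<N. a \<le> x i \<and> x i \<le> y i \<and> y i \<le> b"
      and dis: "disjoint_family_on (\<lambda>i. {x i<..<y i}) {..<N}"
      by (auto simp: interval_family_def)
    have tint: "integrable lborel (\<lambda>t. indicator {x i<..<y i} t * tail n t)" for i
      using integrable_mult_indicator[OF _ tail_int, of "{x i<..<y i}" n] by simp
    have iint: "integrable lborel (\<lambda>t. indicator {x i<..<y i} t * real n)" for i
      by (intro integrable_mult_left) (cases "x i \<le> y i"; simp)
    have "(\<Sum>i<N. \<bar>?u (y i) - ?u (x i)\<bar>) \<le> (\<Sum>i<N. real n * (y i - x i) + (\<integral>t. indicator {x i<..<y i} t * tail n t \<partial>lborel))"
    proof (rule sum_mono)
      fix i assume "i \<in> {..<N}"
      then have i: "a \<le> x i" "x i \<le> y i" using bd by auto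
      have "?u (y i) - ?u (x i) = (LINT t:{x i..y i}|lborel. g t)"
        using lborel_set_integral_split[OF set_integrable_whole[OF g], of a "y i" "x i"] i by simp
      also have "\<dots> = (\<integral>t. indicator {x i<..<y i} t * g t \<partial>lborel)"
        unfolding set_lebesgue_integral_def
      proof (rule integral_cong_AE)
        show "AE t in lborel. indicator {x i..y i} t *\<^sub>R g t = indicator {x i<..<y i} t * g t"
          using AE_lborel_singleton[of "x i"] AE_lborel_singleton[of "y i"]
          by eventually_elim (auto split: split_indicator)
      qed measurable
      finally have "\<bar>?u (y i) - ?u (x i)\<bar> \<le> (\<integral>t. \<bar>indicator {x i<..<y i} t * g t\<bar> \<partial>lborel)"
        by (simp only: integral_abs_bound)
      also have "\<dots> \<le> (\<integral>t. indicator {x i<..<y i} t * real n + indicator {x i<..<y i} t * tail n t \<partial>lborel)"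
        using tint iint integrable_mult_indicator[OF _ g, of "{x i<..<y i}"]
        by (intro integral_mono integrable_abs Bochner_Integration.integrable_add)
           (auto simp: tail_def split: split_indicator)
      also have "\<dots> = real n * (y i - x i) + (\<integral>t. indicator {x i<..<y i} t * tail n t \<partial>lborel)"
        using i by (subst Bochner_Integration.integral_add[OF iint tint]) simp
      finally show "\<bar>?u (y i) - ?u (x i)\<bar> \<le> real n * (y i - x i) + (\<integral>t. indicator {x i<..<y i} t * tail n t \<partial>lborel)" .
    qed
    also have "\<dots> = real n * (\<Sum>i<N. y i - x i) + (\<integral>t. (\<Sum>i<N. indicator {x i<..<y i} t * tail n t) \<partial>lborel)"
      using Bochner_Integration.integral_sum[of "{..<N}" lborel "\<lambda>i t. indicator {x i<..<y i} t * tail n t", OF tint]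
      by (simp only: sum.distrib sum_distrib_left)
    finally have A: "(\<Sum>i<N. \<bar>?u (y i) - ?u (x i)\<bar>) \<le> real n * (\<Sum>i<N. y i - x i)
        + (\<integral>t. (\<Sum>i<N. indicator {x i<..<y i} t * tail n t) \<partial>lborel)" .
    have B: "(\<integral>t. (\<Sum>i<N. indicator {x i<..<y i} t * tail n t) \<partial>lborel) \<le> (\<integral>t. tail n t \<partial>lborel)"
    proof (rule integral_mono)
      fix t
      have "(\<Sum>i<N. indicator {x i<..<y i} t * tail n t) = indicator (\<Union>i<N. {x i<..<y i}) t * tail n t"
        by (subst indicator_UN_disjoint[OF _ dis]) (simp_all only: sum_distrib_right finite_lessThan)
      also have "\<dots> \<le> tail n t" by (auto simp: tail_def split: split_indicator)
      finally show "(\<Sum>i<N. indicator {x i<..<y i} t * tail n t) \<le> tail n t" .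
    qed (rule Bochner_Integration.integrable_sum tint tail_int)+
    have "real n * (\<Sum>i<N. y i - x i) \<le> real n * d" using len by (intro mult_left_mono) auto
    with A B show "(\<Sum>i<N. \<bar>?u (y i) - ?u (x i)\<bar>) < \<epsilon>"
      using n \<open>real n * d \<le> \<epsilon> / 2\<close> by linarith
  qed
qed

section \<open>Absolutely continuous functions are indefinite integrals\<close>

text \<open>
  An open set of small length around the null set contains countably many closed intervals with
  disjoint interiors that cover the null set. The total increment of \<open>F\<close> over finitely many of them
  is small by absolute continuity.
\<close>

lemma null_set_interval_measure_AC:
  fixes F :: "real \<Rightarrow> real"
  assumes mono: "\<And>x y. x \<le> y \<Longrightarrow> F x \<le> F y" and cont: "continuous_on UNIV F"
    and AC: "F \<in> AC a b" and ab: "a < b"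
    and N: "N \<in> null_sets lborel"
  shows "N \<inter> {a..b} \<in> null_sets (interval_measure F)"
proof -
  let ?M = "interval_measure F"
  have Icc: "emeasure ?M {x..y} = F y - F x" if "x \<le> y" for x y
    by (rule emeasure_interval_measure_Icc[OF that mono cont])
  have small: "emeasure ?M (N \<inter> {a..b}) \<le> ennreal e" if "e > 0" for e
  proof -
    obtain d where d: "d > 0" "\<And>(I::(real \<times> real) set) x y. \<lbrakk>interval_family a b I x y; (\<Sum>i\<in>I. y i - x i) < d\<rbrakk>
       \<Longrightarrow> (\<Sum>i\<in>I. \<bar>F (y i) - F (x i)\<bar>) < e"
      using AC_imp_small_variation[where 'i="real \<times> real", OF AC \<open>e > 0\<close>] by blast
    obtain U where U: "open U" "N \<inter> {a..b} \<subseteq> U" "U \<in> lmeasurable" "measure lebesgue U < d"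
    proof -
      have "negligible (N \<inter> {a..b})"
        using N by (meson negligible_Int negligible_iff_null_sets null_sets_completionI)
      then have "N \<inter> {a..b} \<in> sets lebesgue" "measure lebesgue (N \<inter> {a..b}) = 0"
        "N \<inter> {a..b} \<in> lmeasurable"
        by (auto simp: negligible_imp_measure0 negligible_imp_measurable negligible_imp_sets)
      with sets_lebesgue_outer_open[of "N \<inter> {a..b}" d] d(1) obtain T where
        T: "open T" "N \<inter> {a..b} \<subseteq> T" "T - N \<inter> {a..b} \<in> lmeasurable" "emeasure lebesgue (T - N \<inter> {a..b}) < ennreal d"
        by metis
      have TT: "T = (T - N \<inter> {a..b}) \<union> (N \<inter> {a..b})" using T(2) by blast
      have Tm: "T \<in> lmeasurable"
        by (subst TT) (intro fmeasurable.Un T \<open>N \<inter> {a..b} \<in> lmeasurable\<close>)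
      have "measure lebesgue T \<le> measure lebesgue (T - N \<inter> {a..b}) + measure lebesgue (N \<inter> {a..b})"
        by (subst TT, rule measure_Un_le) (use T \<open>N \<inter> {a..b} \<in> sets lebesgue\<close> in auto)
      also have "\<dots> < d"
        using T(3,4) \<open>measure lebesgue (N \<inter> {a..b}) = 0\<close> d(1)
        by (simp add: emeasure_eq_measure2 ennreal_less_iff)
      finally show thesis using T Tm that by blast
    qed
    define g where "g = (\<lambda>x. if x \<in> U then U else UNIV)"
    have "gauge g" using U by (auto simp: gauge_def g_def)
    have "N \<inter> {a..b} \<subseteq> cbox a b" "box a b \<noteq> {}" using ab by auto
    from covering_lemma[OF this \<open>gauge g\<close>] obtain D where D: "countable D" "\<Union>D \<subseteq> cbox a b"
      "\<And>K. K \<in> D \<Longrightarrow> interior K \<noteq> {} \<and> (\<exists>c d. K = cbox c d)"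
      "pairwise (\<lambda>A B. interior A \<inter> interior B = {}) D"
      "\<And>K. K \<in> D \<Longrightarrow> \<exists>x \<in> N \<inter> {a..b} \<inter> K. K \<subseteq> g x" "N \<inter> {a..b} \<subseteq> \<Union>D"
      by metis
    define C where "C = {i :: real \<times> real. fst i < snd i \<and> {fst i..snd i} \<in> D}"
    have C1: "\<exists>i\<in>C. K = {fst i..snd i}" if K: "K \<in> D" for K
    proof -
      obtain x y where xy: "K = {x..y}" "interior K \<noteq> {}" using D(3)[OF K] by auto
      then have "(x, y) \<in> C" using K by (auto simp: C_def)
      with xy show ?thesis by force
    qed
    have inj: "inj_on (\<lambda>i. {fst i..snd i}) C"
      by (rule inj_onI) (auto simp: C_def Icc_eq_Icc prod_eq_iff)
    have "(\<lambda>i. {fst i..snd i}) ` C \<subseteq> D" by (auto simp: C_def)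
    then have "countable C"
      using countable_image_inj_on[OF _ inj] D(1) countable_subset by blast
    have CU: "{fst i..snd i} \<subseteq> U" "{fst i..snd i} \<subseteq> {a..b}" "fst i < snd i" if "i \<in> C" for i
    proof -
      have "{fst i..snd i} \<in> D" using that by (simp add: C_def)
      from D(5)[OF this] obtain x where "x \<in> N \<inter> {a..b}" "{fst i..snd i} \<subseteq> g x" by blast
      moreover from this U(2) have "g x = U" by (auto simp: g_def)
      ultimately show "{fst i..snd i} \<subseteq> U" by simp
      from Union_upper[OF \<open>{fst i..snd i} \<in> D\<close>] D(2) show "{fst i..snd i} \<subseteq> {a..b}"
        unfolding cbox_interval by (rule subset_trans)
      show "fst i < snd i" using that by (simp add: C_def)
    qed
    have fm: "{fst i..snd i} \<in> fmeasurable ?M" if "i \<in> C" for i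
      by (rule fmeasurableI) (use Icc CU(3)[OF that] in \<open>auto simp: less_top[symmetric]\<close>)
    have bound: "measure ?M (\<Union>i\<in>I. {fst i..snd i}) \<le> e" if I: "I \<subseteq> C" "finite I" for I
    proof -
      have dis: "disjoint_family_on (\<lambda>i. {fst i<..<snd i}) I"
        unfolding disjoint_family_on_def
      proof (intro ballI impI)
        fix i j assume ij: "i \<in> I" "j \<in> I" "i \<noteq> j"
        then have "i \<in> C" "j \<in> C" using I by auto
        then have "{fst i..snd i} \<in> D" "{fst j..snd j} \<in> D" "{fst i..snd i} \<noteq> {fst j..snd j}"
          using inj_onD[OF inj, of i j] ij(3) by (auto simp: C_def)
        then have "interior {fst i..snd i} \<inter> interior {fst j..snd j} = {}"
          using D(4) unfolding pairwise_def by blast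
        then show "{fst i<..<snd i} \<inter> {fst j<..<snd j} = {}" by simp
      qed
      have bd: "a \<le> fst i \<and> fst i \<le> snd i \<and> snd i \<le> b" "{fst i<..<snd i} \<subseteq> U" if "i \<in> I" for i
      proof -
        have "i \<in> C" using I that by auto
        from CU[OF this] show "a \<le> fst i \<and> fst i \<le> snd i \<and> snd i \<le> b" "{fst i<..<snd i} \<subseteq> U" by force+
      qed
      have f: "interval_family a b I fst snd" using I(2) bd(1) dis by (simp add: interval_family_def)
      have len: "(\<Sum>i\<in>I. snd i - fst i) < d"
        using interval_family_length_le_measure[OF f bd(2) U(3)] U(4) by linarith
      have "measure ?M (\<Union>i\<in>I. {fst i..snd i}) \<le> (\<Sum>i\<in>I. measure ?M {fst i..snd i})"
        by (rule measure_UNION_le) (use I in auto)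
      also have "\<dots> = (\<Sum>i\<in>I. \<bar>F (snd i) - F (fst i)\<bar>)"
        using bd(1) by (intro sum.cong refl) (auto simp: measure_def Icc mono)
      also have "\<dots> \<le> e" using d(2)[OF f len] by simp
      finally show ?thesis .
    qed
    have U': "(\<Union>i\<in>C. {fst i..snd i}) \<in> fmeasurable ?M" "measure ?M (\<Union>i\<in>C. {fst i..snd i}) \<le> e"
      by (rule fmeasurable_UN_bound[OF \<open>countable C\<close> fm bound] measure_UN_bound[OF \<open>countable C\<close> fm bound]; simp)+
    have "emeasure ?M (N \<inter> {a..b}) \<le> emeasure ?M (\<Union>i\<in>C. {fst i..snd i})"
      using D(6) C1 U'(1) by (intro emeasure_mono) (force simp: fmeasurableD)+
    also have "\<dots> \<le> ennreal e"
      using U' that by (simp add: emeasure_eq_measure2 ennreal_leI)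
    finally show ?thesis .
  qed
  have "emeasure ?M (N \<inter> {a..b}) \<le> 0"
    by (rule ennreal_le_epsilon) (simp only: add_0 small)
  then have "emeasure ?M (N \<inter> {a..b}) = 0" by simp
  moreover have "N \<inter> {a..b} \<in> sets ?M" using N by auto
  ultimately show ?thesis by blast
qed

text \<open>
  The value \<open>c\<close> is that of \<open>v\<close> at \<open>a\<close>. The density is a Borel function that vanishes outside \<open>[a,b]\<close>,
  so that it can be convolved over the whole line.
\<close>

definition has_density :: "real \<Rightarrow> real \<Rightarrow> (real \<Rightarrow> real) \<Rightarrow> real \<Rightarrow> (real \<Rightarrow> real) \<Rightarrow> bool" where
  "has_density a b v c g \<longleftrightarrow> integrable lborel g \<and> (\<forall>x. x \<notin> {a..b} \<longrightarrow> g x = 0) \<and>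
     (\<forall>x\<in>{a..b}. v x = c + (LINT t:{a..x}|lborel. g t))"

lemma has_density_imp_AC:
  assumes "has_density a b v c g"
  shows "v \<in> AC a b"
proof (rule AC_cong)
  show "(\<lambda>x. c + (LINT t:{a..x}|lborel. g t)) \<in> AC a b"
    using assms by (intro indefinite_integral_AC) (simp add: has_density_def)
qed (use assms in \<open>simp add: has_density_def\<close>)

text \<open>
  On \<open>[a,b]\<close> the Stieltjes measure of \<open>F\<close> is absolutely continuous with respect to the Lebesgue
  measure, so that the Radon-Nikodym theorem provides the density.
\<close>

lemma mono_AC_has_density:
  fixes F :: "real \<Rightarrow> real"
  assumes mono: "\<And>x y. \<lbrakk>a \<le> x; x \<le> y; y \<le> b\<rbrakk> \<Longrightarrow> F x \<le> F y" and AC: "F \<in> AC a b" and ab: "a < b"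
  shows "\<exists>g. has_density a b F (F a) g"
proof -
  \<comment> \<open>a Stieltjes measure needs a function on the whole line, hence the constant extension\<close>
  define E where "E = (\<lambda>t. F (max a (min b t)))"
  have E_eq: "E t = F t" if "t \<in> {a..b}" for t using that by (simp add: E_def)
  have monoE: "E x \<le> E y" if "x \<le> y" for x y
    unfolding E_def using that ab by (intro mono) auto
  have contE: "continuous_on UNIV E"
    unfolding E_def
    by (rule continuous_on_compose2[OF AC_imp_continuous_on[OF AC]])
       (use ab in \<open>auto intro!: continuous_intros\<close>)
  have ACE: "E \<in> AC a b"
    by (rule AC_cong[OF AC]) (simp add: E_def)
  let ?M = "interval_measure E"
  have Icc: "emeasure ?M {x..y} = E y - E x" if "x \<le> y" for x y
    by (rule emeasure_interval_measure_Icc[OF that monoE contE])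
  \<comment> \<open>absolute continuity controls the measure of null sets inside \<open>[a,b]\<close> only\<close>
  define M' where "M' = density ?M (indicator {a..b})"
  have eM': "emeasure M' A = emeasure ?M (A \<inter> {a..b})" if "A \<in> sets borel" for A
  proof -
    have "emeasure M' A = (\<integral>\<^sup>+x. indicator {a..b} x * indicator A x \<partial>?M)"
      unfolding M'_def using that by (subst emeasure_density) auto
    also have "\<dots> = (\<integral>\<^sup>+x. indicator (A \<inter> {a..b}) x \<partial>?M)"
      by (intro nn_integral_cong) (auto split: split_indicator)
    also have "\<dots> = emeasure ?M (A \<inter> {a..b})" using that by simp
    finally show ?thesis .
  qed
  have "absolutely_continuous lborel M'"
    unfolding absolutely_continuous_def
  proof
    fix N :: "real set" assume N: "N \<in> null_sets lborel"
    then have "N \<in> sets borel" by auto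
    moreover have "emeasure ?M (N \<inter> {a..b}) = 0"
      using null_set_interval_measure_AC[OF monoE contE ACE ab N] by auto
    ultimately show "N \<in> null_sets M'" by (auto simp: null_sets_def eM') (simp add: M'_def)
  qed
  moreover have "sets M' = sets lborel" by (simp add: M'_def)
  ultimately obtain h where h[measurable]: "h \<in> borel_measurable lborel" and hM: "density lborel h = M'"
    using sigma_finite_measure.Radon_Nikodym[OF sigma_finite_lborel] by blast
  define g where "g = (\<lambda>x. indicator {a..b} x * enn2real (h x))"
  have g[measurable]: "g \<in> borel_measurable lborel" unfolding g_def by measurable
  have hint: "(\<integral>\<^sup>+t. h t * indicator {a..x} t \<partial>lborel) = ennreal (F x - F a)" if x: "x \<in> {a..b}" for x
  proof -
    have "(\<integral>\<^sup>+t. h t * indicator {a..x} t \<partial>lborel) = emeasure M' {a..x}"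
      unfolding hM[symmetric] by (subst emeasure_density) auto
    also have "\<dots> = emeasure ?M {a..x}"
      using x by (subst eM') (auto intro!: arg_cong2[where f=emeasure])
    also have "\<dots> = ennreal (F x - F a)" using x ab by (simp add: Icc E_eq)
    finally show ?thesis .
  qed
  have "(\<integral>\<^sup>+t. h t * indicator {a..b} t \<partial>lborel) \<noteq> \<infinity>"
    using hint[of b] ab by simp
  then have "AE t in lborel. h t * indicator {a..b} t \<noteq> \<infinity>"
    by (intro nn_integral_PInf_AE) auto
  then have AEh: "AE t in lborel. ennreal (g t) = h t * indicator {a..b} t"
    by eventually_elim (auto simp: g_def less_top split: split_indicator)
  have gnn: "g t \<ge> 0" for t by (simp add: g_def)
  have nng: "(\<integral>\<^sup>+t. ennreal (indicator {a..x} t * g t) \<partial>lborel) = ennreal (F x - F a)" if x: "x \<in> {a..b}" for x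
  proof -
    have "(\<integral>\<^sup>+t. ennreal (indicator {a..x} t * g t) \<partial>lborel) = (\<integral>\<^sup>+t. h t * indicator {a..x} t \<partial>lborel)"
    proof (rule nn_integral_cong_AE)
      show "AE t in lborel. ennreal (indicator {a..x} t * g t) = h t * indicator {a..x} t"
        using AEh by eventually_elim (use x in \<open>auto split: split_indicator_asm split_indicator\<close>)
    qed
    then show ?thesis using hint[OF x] by simp
  qed
  have gab: "indicator {a..b} t * g t = g t" for t by (simp add: g_def split: split_indicator)
  have "integrable lborel g"
    by (rule integrableI_nonneg) (use gnn nng[of b] ab gab in auto)
  moreover have "F x = F a + (LINT t:{a..x}|lborel. g t)" if x: "x \<in> {a..b}" for x
  proof -
    have "F x \<ge> F a" using x by (intro mono) auto
    have "(LINT t:{a..x}|lborel. g t) = F x - F a"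
      unfolding set_lebesgue_integral_def real_scaleR_def
      by (subst integral_eq_nn_integral) (use gnn nng[OF x] \<open>F x \<ge> F a\<close> in auto)
    then show ?thesis by simp
  qed
  moreover have "g x = 0" if "x \<notin> {a..b}" for x using that by (simp add: g_def)
  ultimately show ?thesis unfolding has_density_def by blast
qed

text \<open>
  The supremum of these sums is the positive variation of \<open>G\<close>; it is
  increasing, and so is what remains when \<open>G\<close> is subtracted from it.
\<close>

definition increments :: "(real \<Rightarrow> real) \<Rightarrow> real \<Rightarrow> real \<Rightarrow> real set" where
  "increments G a t = {\<Sum>i\<in>I. G (y i) - G (x i) | (I :: nat set) x y. interval_family a t I x y}"

definition positive_variation :: "(real \<Rightarrow> real) \<Rightarrow> real \<Rightarrow> real \<Rightarrow> real" where
  "positive_variation G a t = Sup (increments G a t)"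

lemma interval_family_split:
  assumes f: "interval_family a t I x y" and c: "a \<le> c" "c \<le> t"
  shows "interval_family a c I (\<lambda>i. min (x i) c) (\<lambda>i. min (y i) c)"
    and "interval_family c t I (\<lambda>i. max (x i) c) (\<lambda>i. max (y i) c)"
    and "(\<Sum>i\<in>I. G (y i) - G (x i)) = (\<Sum>i\<in>I. G (min (y i) c) - G (min (x i) c))
          + (\<Sum>i\<in>I. G (max (y i) c) - G (max (x i) c :: real) :: real)"
proof -
  have sub: "{min (x i) c<..<min (y i) c} \<subseteq> {x i<..<y i}" "{max (x i) c<..<max (y i) c} \<subseteq> {x i<..<y i}" for i
    by (auto simp: min_def max_def split: if_splits)
  have dis: "disjoint_family_on (\<lambda>i. {x i<..<y i}) I" using f by (simp add: interval_family_def)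
  have "disjoint_family_on (\<lambda>i. {min (x i) c<..<min (y i) c}) I"
    "disjoint_family_on (\<lambda>i. {max (x i) c<..<max (y i) c}) I"
    using dis sub unfolding disjoint_family_on_def by blast+
  then show "interval_family a c I (\<lambda>i. min (x i) c) (\<lambda>i. min (y i) c)"
    "interval_family c t I (\<lambda>i. max (x i) c) (\<lambda>i. max (y i) c)"
    using f c by (auto simp: interval_family_def min_def max_def)
  have "G (y i) - G (x i) = (G (min (y i) c) - G (min (x i) c)) + (G (max (y i) c) - G (max (x i) c))" for i
    by (auto simp: min_def max_def)
  then show "(\<Sum>i\<in>I. G (y i) - G (x i)) = (\<Sum>i\<in>I. G (min (y i) c) - G (min (x i) c))
          + (\<Sum>i\<in>I. G (max (y i) c) - G (max (x i) c))"
    by (simp add: sum.distrib[symmetric])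
qed

lemma interval_family_length:
  assumes "interval_family a t I x y" "a \<le> t"
  shows "(\<Sum>i\<in>I. y i - x i) \<le> t - a"
proof -
  have "(\<Sum>i\<in>I. y i - x i) \<le> measure lebesgue {a..t}"
    by (rule interval_family_length_le_measure[OF assms(1)])
       (use assms(1) in \<open>auto simp: interval_family_def\<close>)
  then show ?thesis using assms(2) by simp
qed

lemma interval_family_mono:
  "interval_family a s I x y \<Longrightarrow> s \<le> t \<Longrightarrow> interval_family a t I x y"
  by (force simp: interval_family_def)

text \<open>
  Cutting the intervals of a family at the points of a grid finer than the \<open>\<delta>\<close> that belongs to
  \<open>\<epsilon> = 1\<close> bounds its increment by the number of cells.
\<close>

lemma bdd_above_increments:
  assumes AC: "G \<in> AC a b"
  shows "bdd_above (increments G a b)"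
proof -
  obtain d where d: "d > 0" "\<And>(I::nat set) x y. \<lbrakk>interval_family a b I x y; (\<Sum>i\<in>I. y i - x i) < d\<rbrakk>
       \<Longrightarrow> (\<Sum>i\<in>I. \<bar>G (y i) - G (x i)\<bar>) < 1"
    using AC_imp_small_variation[where 'i=nat, OF AC zero_less_one] by blast
  have short: "(\<Sum>i\<in>I. G (y i) - G (x i)) \<le> 1"
    if f: "interval_family s t I x y" "a \<le> s" "s \<le> t" "t \<le> b" "t - s < d" for s t and I :: "nat set" and x y
  proof -
    have "(\<Sum>i\<in>I. y i - x i) < d" using interval_family_length[OF f(1)] f by linarith
    then have "(\<Sum>i\<in>I. \<bar>G (y i) - G (x i)\<bar>) < 1"
      using f by (intro d(2)) (force simp: interval_family_def)+
    moreover have "(\<Sum>i\<in>I. G (y i) - G (x i)) \<le> (\<Sum>i\<in>I. \<bar>G (y i) - G (x i)\<bar>)"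
      by (intro sum_mono) auto
    ultimately show ?thesis by linarith
  qed
  \<comment> \<open>steps of \<open>d/2\<close>, since the bound for short families needs a length strictly below \<open>d\<close>\<close>
  define c where "c = (\<lambda>k. min b (a + real k * (d / 2)))"
  have grid: "(\<Sum>i\<in>I. G (y i) - G (x i)) \<le> real k"
    if "interval_family a (c k) I x y" "a \<le> b" for k and I :: "nat set" and x y
    using that
  proof (induction k arbitrary: x y)
    case 0
    then have "interval_family a a I x y" by (simp add: c_def)
    then have "x i = y i" if "i \<in> I" for i using that by (force simp: interval_family_def)
    then show ?case by simp
  next
    case (Suc k)
    have le: "a \<le> c k" "c k \<le> c (Suc k)" "c (Suc k) \<le> b" "c (Suc k) - c k < d"
      using d(1) Suc.prems(2) by (auto simp: c_def min_def algebra_simps add_divide_distrib)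
    note sp = interval_family_split[OF Suc.prems(1) le(1,2)]
    show ?case
      using Suc.IH[OF sp(1) Suc.prems(2)] short[OF sp(2) le(1,2,3,4)] sp(3)[of G] by simp
  qed
  show ?thesis
  proof (cases "a \<le> b")
    case True
    obtain k :: nat where "(b - a) / (d / 2) < real k" using reals_Archimedean2 by blast
    then have "c k = b" using d(1) by (simp add: c_def field_simps)
    then show ?thesis using grid[of k] True by (auto simp: increments_def intro!: bdd_aboveI[of _ "real k"])
  next
    case False
    have "(\<Sum>i\<in>I. G (y i) - G (x i)) = 0" if "interval_family a b I x y" for I :: "nat set" and x y
      using that False by (intro sum.neutral) (force simp: interval_family_def)
    then show ?thesis by (auto simp: increments_def intro!: bdd_aboveI[of _ 0])
  qed
qed

lemma increments_nonempty: "increments G a t \<noteq> {}"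
proof -
  have "interval_family a t ({} :: nat set) (\<lambda>_. 0) (\<lambda>_. 0)" by (simp add: interval_family_def disjoint_family_on_def)
  then show ?thesis unfolding increments_def by blast
qed

lemma increments_mono: "s \<le> t \<Longrightarrow> increments G a s \<subseteq> increments G a t"
  unfolding increments_def using interval_family_mono by blast

lemma positive_variation_mono:
  assumes "G \<in> AC a b" "s \<le> t" "t \<le> b"
  shows "positive_variation G a s \<le> positive_variation G a t"
  unfolding positive_variation_def
  by (rule cSup_subset_mono[OF increments_nonempty _ increments_mono[OF assms(2)]])
     (rule bdd_above_mono[OF bdd_above_increments[OF assms(1)] increments_mono[OF assms(3)]])

text \<open>
  The interval \<open>[s,t]\<close> can be added to every family in \<open>[a,s]\<close>. Hence the positive variation minus
  \<open>G\<close> is increasing, and \<open>G\<close> is a difference of increasing functions.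
\<close>

lemma positive_variation_ge_increment:
  assumes AC: "G \<in> AC a b" and st: "a \<le> s" "s \<le> t" "t \<le> b"
  shows "positive_variation G a s + (G t - G s) \<le> positive_variation G a t"
proof -
  have bdd: "bdd_above (increments G a t)"
    by (rule bdd_above_mono[OF bdd_above_increments[OF AC] increments_mono[OF st(3)]])
  have "positive_variation G a s \<le> positive_variation G a t - (G t - G s)"
    unfolding positive_variation_def[of G a s]
  proof (rule cSup_least[OF increments_nonempty])
    fix z assume "z \<in> increments G a s"
    then obtain I :: "nat set" and x y where f: "interval_family a s I x y" and z: "z = (\<Sum>i\<in>I. G (y i) - G (x i))"
      by (auto simp: increments_def)
    have fin: "finite I" using f by (simp add: interval_family_def)
    then obtain n where n: "n \<notin> I" by (meson ex_new_if_finite infinite_UNIV_nat)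
    define x' y' where "x' = x(n := s)" and "y' = y(n := t)"
    have "disjoint_family_on (\<lambda>i. {x' i<..<y' i}) (insert n I)"
    proof -
      have "disjoint_family_on (\<lambda>i. {x' i<..<y' i}) I"
        using f n by (auto simp: interval_family_def disjoint_family_on_def x'_def y'_def)
      moreover have "{x' i<..<y' i} \<inter> {x' n<..<y' n} = {}" if "i \<in> I" for i
        using f that n by (force simp: interval_family_def x'_def y'_def)
      ultimately show ?thesis
        unfolding disjoint_family_on_insert[OF n] by blast
    qed
    then have "interval_family a t (insert n I) x' y'"
      using f st n by (force simp: interval_family_def x'_def y'_def)
    then have "(\<Sum>i\<in>insert n I. G (y' i) - G (x' i)) \<in> increments G a t"
      by (auto simp: increments_def)
    then have "(\<Sum>i\<in>insert n I. G (y' i) - G (x' i)) \<le> positive_variation G a t"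
      unfolding positive_variation_def by (rule cSup_upper[OF _ bdd])
    moreover have "(\<Sum>i\<in>insert n I. G (y' i) - G (x' i)) = (G t - G s) + z"
    proof -
      have "(\<Sum>i\<in>I. G (y' i) - G (x' i)) = z"
        unfolding z using n by (intro sum.cong) (auto simp: x'_def y'_def)
      then show ?thesis using fin n by (simp add: x'_def y'_def)
    qed
    ultimately show "z \<le> positive_variation G a t - (G t - G s)" by linarith
  qed
  then show ?thesis by linarith
qed

text \<open>
  A nearly optimal family in \<open>[a,t]\<close>, cut at \<open>s\<close>, does no better on \<open>[a,s]\<close> than the supremum there, so
  that its part in \<open>[s,t]\<close> accounts for the increase.
\<close>

lemma positive_variation_increment_approx:
  assumes AC: "G \<in> AC a b" and st: "a \<le> s" "s \<le> t" "t \<le> b" and e: "e > 0"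
  shows "\<exists>(I :: nat set) x y. interval_family s t I x y \<and>
    positive_variation G a t - positive_variation G a s \<le> (\<Sum>i\<in>I. G (y i) - G (x i)) + e"
proof -
  have bdd: "bdd_above (increments G a t)" if "t \<le> b" for t
    by (rule bdd_above_mono[OF bdd_above_increments[OF AC] increments_mono[OF that]])
  have "\<exists>z\<in>increments G a t. positive_variation G a t - e < z"
    using less_cSup_iff[OF increments_nonempty bdd[OF st(3)], of "positive_variation G a t - e"] e
    by (simp add: positive_variation_def)
  then obtain I :: "nat set" and x y where f: "interval_family a t I x y"
    and z: "positive_variation G a t - e < (\<Sum>i\<in>I. G (y i) - G (x i))"
    by (auto simp: increments_def)
  note sp = interval_family_split[OF f st(1,2)]
  have "(\<Sum>i\<in>I. G (min (y i) s) - G (min (x i) s)) \<le> positive_variation G a s"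
    unfolding positive_variation_def
  proof (rule cSup_upper[OF _ bdd])
    show "(\<Sum>i\<in>I. G (min (y i) s) - G (min (x i) s)) \<in> increments G a s"
      unfolding increments_def by (rule CollectI, intro exI conjI, rule refl, rule sp(1))
  qed (use st in linarith)
  then have "positive_variation G a t - positive_variation G a s
      \<le> (\<Sum>i\<in>I. G (max (y i) s) - G (max (x i) s)) + e"
    using z sp(3)[of G] by linarith
  then show ?thesis using sp(2) by blast
qed

text \<open>
  Nearly optimal families inside the given intervals merge into a single family of at most the same
  total length, to which the absolute continuity of \<open>G\<close> applies.
\<close>

lemma AC_positive_variation:
  assumes AC: "G \<in> AC a b"
  shows "positive_variation G a \<in> AC a b"
  unfolding AC_iff_interval_family
proof (intro allI impI)
  fix \<epsilon> :: real assume "\<epsilon> > 0"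
  obtain d where d: "d > 0" "\<And>(I::(nat \<times> nat) set) x y. \<lbrakk>interval_family a b I x y; (\<Sum>i\<in>I. y i - x i) < d\<rbrakk>
       \<Longrightarrow> (\<Sum>i\<in>I. \<bar>G (y i) - G (x i)\<bar>) < \<epsilon> / 2"
    using AC_imp_small_variation[where 'i="nat \<times> nat", OF AC half_gt_zero[OF \<open>\<epsilon> > 0\<close>]] by blast
  let ?P = "positive_variation G a"
  show "\<exists>\<delta>>0. \<forall>(n::nat) x y. interval_family a b {..<n} x y \<longrightarrow> (\<Sum>i<n. y i - x i) < \<delta> \<longrightarrow>
     (\<Sum>i<n. \<bar>?P (y i) - ?P (x i)\<bar>) < \<epsilon>"
  proof (intro exI[of _ d] conjI allI impI d(1))
    fix n :: nat and x y :: "nat \<Rightarrow> real"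
    assume f: "interval_family a b {..<n} x y" and len: "(\<Sum>i<n. y i - x i) < d"
    then have bd: "\<forall>i<n. a \<le> x i \<and> x i \<le> y i \<and> y i \<le> b"
      and dis: "disjoint_family_on (\<lambda>i. {x i<..<y i}) {..<n}"
      by (auto simp: interval_family_def)
    \<comment> \<open>an error \<open>\<eta>\<close> per interval adds up to at most \<open>\<epsilon>/2\<close>\<close>
    define \<eta> where "\<eta> = \<epsilon> / (2 * real (Suc n))"
    have "\<eta> > 0" using \<open>\<epsilon> > 0\<close> by (simp add: \<eta>_def)
    let ?good = "\<lambda>i T. interval_family (x i) (y i) (fst T) (fst (snd T)) (snd (snd T)) \<and>
        ?P (y i) - ?P (x i) \<le> (\<Sum>j\<in>fst T. G (snd (snd T) j) - G (fst (snd T) j)) + \<eta>"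
    have "\<forall>i\<in>{..<n}. \<exists>T :: nat set \<times> (nat \<Rightarrow> real) \<times> (nat \<Rightarrow> real). ?good i T"
    proof
      fix i assume "i \<in> {..<n}"
      then have "a \<le> x i" "x i \<le> y i" "y i \<le> b" using bd by auto
      from positive_variation_increment_approx[OF AC this \<open>\<eta> > 0\<close>] obtain J X Y where
        "?good i (J :: nat set, X, Y)" by auto
      then show "\<exists>T :: nat set \<times> (nat \<Rightarrow> real) \<times> (nat \<Rightarrow> real). ?good i T" by blast
    qed
    from bchoice[OF this] obtain T :: "nat \<Rightarrow> nat set \<times> (nat \<Rightarrow> real) \<times> (nat \<Rightarrow> real)"
      where T: "\<forall>i\<in>{..<n}. ?good i (T i)" ..
    define J X Y where "J = (\<lambda>i. fst (T i))" and "X = (\<lambda>i. fst (snd (T i)))" and "Y = (\<lambda>i. snd (snd (T i)))"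
    have J: "interval_family (x i) (y i) (J i) (X i) (Y i)"
      and app: "?P (y i) - ?P (x i) \<le> (\<Sum>j\<in>J i. G (Y i j) - G (X i j)) + \<eta>" if "i < n" for i
      using T that by (simp_all add: J_def X_def Y_def)
    define K where "K = Sigma {..<n} J"
    have fJ: "\<forall>i\<in>{..<n}. finite (J i)" using J by (auto simp: interval_family_def)
    have finK: "finite K" unfolding K_def using fJ by auto
    have sumK: "(\<Sum>k\<in>K. h (fst k) (snd k)) = (\<Sum>i<n. \<Sum>j\<in>J i. h i j)" for h :: "nat \<Rightarrow> nat \<Rightarrow> real"
      unfolding K_def by (subst sum.Sigma) (use fJ in \<open>auto simp: split_def\<close>)
    have bdK: "\<forall>k\<in>K. a \<le> X (fst k) (snd k) \<and> X (fst k) (snd k) \<le> Y (fst k) (snd k) \<and> Y (fst k) (snd k) \<le> b"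
    proof
      fix k assume "k \<in> K"
      then have k: "fst k < n" "snd k \<in> J (fst k)" by (auto simp: K_def)
      have "x (fst k) \<le> X (fst k) (snd k) \<and> X (fst k) (snd k) \<le> Y (fst k) (snd k) \<and> Y (fst k) (snd k) \<le> y (fst k)"
        using J[OF k(1)] k(2) by (auto simp: interval_family_def)
      then show "a \<le> X (fst k) (snd k) \<and> X (fst k) (snd k) \<le> Y (fst k) (snd k) \<and> Y (fst k) (snd k) \<le> b"
        using bd k(1) by force
    qed
    have disK: "disjoint_family_on (\<lambda>k. {X (fst k) (snd k)<..<Y (fst k) (snd k)}) K"
      unfolding disjoint_family_on_def
    proof (intro ballI impI)
      fix k l assume kl: "k \<in> K" "l \<in> K" "k \<noteq> l"
      then have 1: "fst k < n" "snd k \<in> J (fst k)" "fst l < n" "snd l \<in> J (fst l)" by (auto simp: K_def)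
      show "{X (fst k) (snd k)<..<Y (fst k) (snd k)} \<inter> {X (fst l) (snd l)<..<Y (fst l) (snd l)} = {}"
      proof (cases "fst k = fst l")
        case True
        then have "snd k \<noteq> snd l" using kl(3) by (simp add: prod_eq_iff)
        then show ?thesis using J[OF 1(1)] 1 True
          unfolding interval_family_def disjoint_family_on_def by metis
      next
        case False
        then have e: "{x (fst k)<..<y (fst k)} \<inter> {x (fst l)<..<y (fst l)} = {}"
          using dis 1 unfolding disjoint_family_on_def by blast
        have "{X i j<..<Y i j} \<subseteq> {x i<..<y i}" if "i < n" "j \<in> J i" for i j
        proof -
          have "x i \<le> X i j" "Y i j \<le> y i" using J[OF that(1)] that(2) by (auto simp: interval_family_def)
          then show ?thesis by auto
        qed
        with 1 e show ?thesis by blast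
      qed
    qed
    have "(\<Sum>k\<in>K. Y (fst k) (snd k) - X (fst k) (snd k)) = (\<Sum>i<n. \<Sum>j\<in>J i. Y i j - X i j)"
      by (rule sumK)
    also have "\<dots> \<le> (\<Sum>i<n. y i - x i)"
      using J bd by (intro sum_mono interval_family_length) auto
    finally have "(\<Sum>k\<in>K. \<bar>G (Y (fst k) (snd k)) - G (X (fst k) (snd k))\<bar>) < \<epsilon> / 2"
      using finK bdK disK len by (intro d(2)) (simp add: interval_family_def, linarith)
    then have small: "(\<Sum>i<n. \<Sum>j\<in>J i. \<bar>G (Y i j) - G (X i j)\<bar>) < \<epsilon> / 2"
      by (simp only: sumK[of "\<lambda>i j. \<bar>G (Y i j) - G (X i j)\<bar>"])
    have "(\<Sum>i<n. \<bar>?P (y i) - ?P (x i)\<bar>) \<le> (\<Sum>i<n. (\<Sum>j\<in>J i. \<bar>G (Y i j) - G (X i j)\<bar>) + \<eta>)"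
    proof (rule sum_mono)
      fix i assume "i \<in> {..<n}"
      then have i: "i < n" by simp
      have "?P (x i) \<le> ?P (y i)" using bd i by (intro positive_variation_mono[OF AC]) auto
      moreover have "(\<Sum>j\<in>J i. G (Y i j) - G (X i j)) \<le> (\<Sum>j\<in>J i. \<bar>G (Y i j) - G (X i j)\<bar>)"
        by (intro sum_mono) auto
      ultimately show "\<bar>?P (y i) - ?P (x i)\<bar> \<le> (\<Sum>j\<in>J i. \<bar>G (Y i j) - G (X i j)\<bar>) + \<eta>"
        using app[OF i] by linarith
    qed
    also have "\<dots> = (\<Sum>i<n. \<Sum>j\<in>J i. \<bar>G (Y i j) - G (X i j)\<bar>) + real n * \<eta>"
      by (simp add: sum.distrib)
    also have "\<dots> < \<epsilon>"
    proof -
      have "real n * \<eta> \<le> \<epsilon> / 2" using \<open>\<epsilon> > 0\<close> by (simp add: \<eta>_def field_simps)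
      then show ?thesis using small by linarith
    qed
    finally show "(\<Sum>i<n. \<bar>?P (y i) - ?P (x i)\<bar>) < \<epsilon>" .
  qed
qed

theorem AC_has_density:
  assumes AC: "G \<in> AC a b" and ab: "a < b"
  shows "\<exists>g. has_density a b G (G a) g"
proof -
  define P where "P = positive_variation G a"
  define Q where "Q = (\<lambda>t. P t + (-1) * G t)"
  have P: "P \<in> AC a b" unfolding P_def by (rule AC_positive_variation[OF AC])
  then have Q: "Q \<in> AC a b" unfolding Q_def by (rule AC_add_scaled[OF _ AC])
  obtain p where "has_density a b P (P a) p"
    using mono_AC_has_density[OF _ P ab] positive_variation_mono[OF AC] unfolding P_def by blast
  then have p: "integrable lborel p" "\<And>x. x \<notin> {a..b} \<Longrightarrow> p x = 0"
      "\<And>x. x \<in> {a..b} \<Longrightarrow> P x = P a + (LINT t:{a..x}|lborel. p t)"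
    unfolding has_density_def by blast+
  have "Q x \<le> Q y" if "a \<le> x" "x \<le> y" "y \<le> b" for x y
    using positive_variation_ge_increment[OF AC that] by (simp add: Q_def P_def)
  then obtain q where "has_density a b Q (Q a) q"
    using mono_AC_has_density[OF _ Q ab] by blast
  then have q: "integrable lborel q" "\<And>x. x \<notin> {a..b} \<Longrightarrow> q x = 0"
      "\<And>x. x \<in> {a..b} \<Longrightarrow> Q x = Q a + (LINT t:{a..x}|lborel. q t)"
    unfolding has_density_def by blast+
  show ?thesis
    unfolding has_density_def
  proof (intro exI[of _ "\<lambda>t. p t - q t"] conjI ballI allI impI)
    show "integrable lborel (\<lambda>t. p t - q t)" using p q by simp
    show "p x - q x = 0" if "x \<notin> {a..b}" for x using p(2) q(2) that by simp
    fix x assume x: "x \<in> {a..b}"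
    have "set_integrable lborel {a..x} p" "set_integrable lborel {a..x} q"
      unfolding set_integrable_def by (rule integrable_mult_indicator; use p q in simp)+
    then have "(LINT t:{a..x}|lborel. p t - q t) = (LINT t:{a..x}|lborel. p t) - (LINT t:{a..x}|lborel. q t)"
      by (rule set_integral_diff)
    then show "G x = G a + (LINT t:{a..x}|lborel. p t - q t)"
      using p(3)[OF x] q(3)[OF x] by (simp add: Q_def)
  qed
qed

section \<open>Differentiating an indefinite integral almost everywhere\<close>

text \<open>
  A Vitali covering argument on top of the Henstock lemma. At a bad point there are arbitrarily short
  intervals over which \<open>f\<close> at that point misrepresents the integral by a fixed fraction of the length;
  Henstock's lemma makes the sum of these errors over disjoint fine intervals as small as desired,
  hence also the total length of a Vitali subcover of the bad points.
\<close>

lemma negligible_indefinite_integral_not_derivative: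
  fixes f :: "real \<Rightarrow> real"
  assumes f: "f integrable_on {a..b}"
  shows "negligible {x \<in> {a<..<b}.
           \<not> ((\<lambda>y. integral {a..y} f) has_real_derivative f x) (at x)}"
proof -
  define F where "F = (\<lambda>y. integral {a..y} f)"
  have int_diff: "integral {x..y} f = F y - F x" if "a \<le> x" "x \<le> y" "y \<le> b" for x y
  proof -
    have "f integrable_on {a..y}"
      by (rule integrable_on_subinterval[OF f]) (use that in auto)
    from Henstock_Kurzweil_Integration.integral_combine[OF that(1,2) this] show ?thesis
      by (simp add: F_def)
  qed
  define bad where "bad = (\<lambda>k x y. \<bar>y - x\<bar> \<le> real (Suc k) * \<bar>F y - F x - f x * (y - x)\<bar>)"
  define E where "E = (\<lambda>k. {x \<in> {a<..<b}. \<forall>d>0. \<exists>y\<in>{a..b}. y \<noteq> x \<and> \<bar>y - x\<bar> < d \<and> bad k x y})"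
  have negE: "negligible (E k)" for k
    unfolding negligible_outer_le
  proof (intro allI impI)
    fix e :: real assume "e > 0"
    \<comment> \<open>at a point of \<open>E k\<close> an error is worth a length that is larger by the factor \<open>Suc k\<close>\<close>
    define e' where "e' = e / real (Suc k)"
    have "e' > 0" using \<open>e > 0\<close> by (simp add: e'_def)
    from Henstock_lemma[of f a b, simplified, OF f this] obtain \<gamma> where "gauge \<gamma>"
      and H: "\<And>p. \<lbrakk>p tagged_partial_division_of {a..b}; \<gamma> fine p\<rbrakk>
             \<Longrightarrow> (\<Sum>(x,K)\<in>p. \<bar>measure lborel K * f x - integral K f\<bar>) < e'"
      by auto
    define I where "I = (\<lambda>(x::real, y). {min x y..max x y})"
    define ctr where "ctr = (\<lambda>(x::real, y). (x + y) / 2)"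
    define rad where "rad = (\<lambda>(x::real, y). \<bar>y - x\<bar> / 2)"
    have cb: "cball (ctr i) (rad i) = I i" for i
    proof -
      obtain x y where [simp]: "i = (x, y)" by (cases i)
      have "cball (ctr i) (rad i) = {ctr i - rad i..ctr i + rad i}"
        by (rule cball_eq_atLeastAtMost)
      moreover have "ctr i - rad i = min x y" "ctr i + rad i = max x y"
        by (auto simp: ctr_def rad_def min_def max_def field_simps)
      ultimately show ?thesis by (simp add: I_def)
    qed
    define J where "J = {(x, y). x \<in> E k \<and> y \<in> {a..b} \<and> y \<noteq> x \<and> I (x, y) \<subseteq> \<gamma> x \<and> bad k x y}"
    have radpos: "0 < rad i" if "i \<in> J" for i
      using that by (auto simp: J_def rad_def)
    have vit: "\<exists>i. i \<in> J \<and> x \<in> cball (ctr i) (rad i) \<and> rad i < d" if "x \<in> E k" "0 < d" for x d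
    proof -
      have "open (\<gamma> x)" "x \<in> \<gamma> x" using \<open>gauge \<gamma>\<close> by (auto simp: gauge_def)
      then obtain r where r: "r > 0" "ball x r \<subseteq> \<gamma> x" by (meson openE)
      from that have "min d r > 0" using r by auto
      then obtain y where y: "y \<in> {a..b}" "y \<noteq> x" "\<bar>y - x\<bar> < min d r" "bad k x y"
        using \<open>x \<in> E k\<close> unfolding E_def by blast
      have "I (x, y) \<subseteq> ball x r"
        using y by (auto simp: I_def dist_real_def abs_real_def min_def max_def split: if_splits)
      then have "(x, y) \<in> J" using r y that by (auto simp: J_def)
      moreover have "x \<in> cball (ctr (x, y)) (rad (x, y))"
        unfolding cb by (auto simp: I_def)
      moreover have "rad (x, y) < d" using y by (auto simp: rad_def)
      ultimately show ?thesis by blast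
    qed
    obtain C where C: "countable C" "C \<subseteq> J"
      "pairwise (\<lambda>i j. disjnt (cball (ctr i) (rad i)) (cball (ctr j) (rad j))) C"
      and neg: "negligible (E k - (\<Union>i\<in>C. cball (ctr i) (rad i)))"
      using Vitali_covering_theorem_cballs[of J rad "E k" ctr] radpos vit by (metis (no_types, lifting))
    have fin: "measure lebesgue (\<Union>i\<in>D. I i) \<le> e" if D: "D \<subseteq> C" "finite D" for D
    proof -
      define p where "p = (\<lambda>i. (fst i, I i)) ` D"
      have dis: "I i \<inter> I j = {}" if "i \<in> D" "j \<in> D" "i \<noteq> j" for i j
        using C(3) D that unfolding pairwise_def cb disjnt_def by blast
      have inI: "fst i \<in> I i" for i by (auto simp: I_def split: prod.splits)
      have inj: "inj_on (\<lambda>i. (fst i, I i)) D"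
        by (rule inj_onI) (metis dis inI prod.inject disjoint_iff)
      have tp: "p tagged_partial_division_of {a..b}"
        unfolding tagged_partial_division_of_def
      proof (intro conjI allI impI)
        show "finite p" using D by (simp add: p_def)
        fix x K assume "(x, K) \<in> p"
        then obtain y where y: "(x, y) \<in> D" "K = I (x, y)" by (auto simp: p_def)
        then have "(x, y) \<in> J" using D C by blast
        then show "x \<in> K" "K \<subseteq> {a..b}" "\<exists>a b. K = cbox a b"
          using y by (auto simp: J_def E_def I_def intro!: exI)
      next
        fix x1 K1 x2 K2 assume "(x1, K1) \<in> p \<and> (x2, K2) \<in> p \<and> (x1, K1) \<noteq> (x2, K2)"
        then obtain i j where "i \<in> D" "j \<in> D" "i \<noteq> j" "K1 = I i" "K2 = I j"
          by (auto simp: p_def)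
        with dis have "K1 \<inter> K2 = {}" by blast
        then show "interior K1 \<inter> interior K2 = {}"
          by (meson interior_subset disjoint_iff subsetD)
      qed
      have "\<gamma> fine p"
      proof (rule fineI)
        fix x K assume "(x, K) \<in> p"
        then obtain y where y: "(x, y) \<in> D" "K = I (x, y)" by (auto simp: p_def)
        then have "(x, y) \<in> J" using D C by blast
        then show "K \<subseteq> \<gamma> x" using y by (simp add: J_def)
      qed
      note H' = H[OF tp this]
      have "measure lebesgue (\<Union>i\<in>D. I i) \<le> (\<Sum>i\<in>D. measure lebesgue (I i))"
        by (rule measure_UNION_le) (use D in \<open>auto simp: I_def split: prod.splits\<close>)
      also have "\<dots> \<le> (\<Sum>i\<in>D. real (Suc k) * \<bar>measure lborel (I i) * f (fst i) - integral (I i) f\<bar>)"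
      proof (rule sum_mono)
        fix i assume "i \<in> D"
        then have iJ: "i \<in> J" using D C by blast
        obtain x y where [simp]: "i = (x, y)" by (cases i)
        have xy: "x \<in> {a<..<b}" "y \<in> {a..b}" "bad k x y" using iJ by (auto simp: J_def E_def)
        have m: "measure lebesgue (I i) = \<bar>y - x\<bar>" "measure lborel (I i) = \<bar>y - x\<bar>"
          by (auto simp: I_def min_def max_def)
        have "\<bar>measure lborel (I i) * f (fst i) - integral (I i) f\<bar> = \<bar>F y - F x - f x * (y - x)\<bar>"
        proof (cases "x \<le> y")
          case True
          then show ?thesis using xy by (auto simp: m I_def int_diff algebra_simps)
        next
          case False
          then show ?thesis using xy by (auto simp: m I_def int_diff algebra_simps)
        qed
        then show "measure lebesgue (I i) \<le> real (Suc k) * \<bar>measure lborel (I i) * f (fst i) - integral (I i) f\<bar>"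
          using xy(3) unfolding bad_def m by simp
      qed
      also have "\<dots> = real (Suc k) * (\<Sum>(x,K)\<in>p. \<bar>measure lborel K * f x - integral K f\<bar>)"
        unfolding p_def by (subst sum.reindex[OF inj]) (simp add: sum_distrib_left)
      also have "\<dots> \<le> real (Suc k) * e'" using H' by (intro mult_left_mono) auto
      also have "\<dots> = e" by (simp add: e'_def)
      finally show ?thesis .
    qed
    define T where "T = (E k - (\<Union>i\<in>C. I i)) \<union> (\<Union>i\<in>C. I i)"
    have lm: "I i \<in> lmeasurable" for i by (auto simp: I_def split: prod.splits)
    have U: "(\<Union>i\<in>C. I i) \<in> lmeasurable" "measure lebesgue (\<Union>i\<in>C. I i) \<le> e"
      by (rule fmeasurable_UN_bound[OF C(1) lm fin] measure_UN_bound[OF C(1) lm fin]; simp)+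
    have N: "negligible (E k - (\<Union>i\<in>C. I i))" using neg unfolding cb .
    show "\<exists>T. E k \<subseteq> T \<and> T \<in> lmeasurable \<and> measure lebesgue T \<le> e"
    proof (intro exI conjI)
      show "E k \<subseteq> T" by (auto simp: T_def)
      show "T \<in> lmeasurable" unfolding T_def
        by (intro fmeasurable.Un U negligible_imp_measurable N)
      have "measure lebesgue T \<le> measure lebesgue (E k - (\<Union>i\<in>C. I i)) + measure lebesgue (\<Union>i\<in>C. I i)"
        unfolding T_def using U N
        by (intro measure_Un_le) (auto intro: fmeasurableD negligible_imp_sets)
      then show "measure lebesgue T \<le> e" using U N by (simp add: negligible_imp_measure0)
    qed
  qed
  have "{x \<in> {a<..<b}. \<not> (F has_real_derivative f x) (at x)} \<subseteq> (\<Union>k. E k)"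
  proof safe
    fix x assume x: "x \<in> {a<..<b}" and nd: "\<not> (F has_real_derivative f x) (at x)"
    show "x \<in> (\<Union>k. E k)"
    proof (rule ccontr)
      assume nE: "x \<notin> (\<Union>k. E k)"
      have "((\<lambda>y. (F y - F x) / (y - x)) \<longlongrightarrow> f x) (at x)"
        unfolding tendsto_iff eventually_at
      proof (intro allI impI)
        fix e :: real assume "e > 0"
        then obtain k where k: "1 / real (Suc k) < e"
          using nat_approx_posE by blast
        from nE have "x \<notin> E k" by blast
        then obtain d where d: "d > 0" "\<And>y. \<lbrakk>y \<in> {a..b}; y \<noteq> x; \<bar>y - x\<bar> < d\<rbrakk> \<Longrightarrow> \<not> bad k x y"
          using x unfolding E_def by blast
        define d' where "d' = min d (min (x - a) (b - x))"
        have "d' > 0" using d x by (auto simp: d'_def)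
        moreover have "dist ((F y - F x) / (y - x)) (f x) < e" if "y \<noteq> x" "dist y x < d'" for y
        proof -
          have "y \<in> {a..b}" "\<bar>y - x\<bar> < d" using that by (auto simp: d'_def dist_real_def abs_real_def split: if_splits)
          with d that have "\<not> bad k x y" by blast
          then have 1: "real (Suc k) * \<bar>F y - F x - f x * (y - x)\<bar> < \<bar>y - x\<bar>" by (simp add: bad_def)
          have "dist ((F y - F x) / (y - x)) (f x) = \<bar>F y - F x - f x * (y - x)\<bar> / \<bar>y - x\<bar>"
            using that by (simp add: dist_real_def abs_divide [symmetric] diff_divide_distrib)
          also have "\<dots> < 1 / real (Suc k)"
            using 1 that by (simp add: field_simps)
          finally show ?thesis using k by linarith
        qed
        ultimately show "\<exists>d>0. \<forall>y\<in>UNIV. y \<noteq> x \<and> dist y x < d \<longrightarrow> dist ((F y - F x) / (y - x)) (f x) < e"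
          by blast
      qed
      then show False using nd by (simp add: has_field_derivative_iff)
    qed
  qed
  moreover have "negligible (\<Union>k. E k)"
    by (rule negligible_countable_Union) (auto simp: negE)
  ultimately show ?thesis
    unfolding F_def[symmetric] using negligible_subset by blast
qed

section \<open>Abel integrals of absolutely continuous functions\<close>

lemma integrable_powr_kernel:
  fixes \<alpha> R :: real
  assumes "\<alpha> < 1"
  shows "integrable lborel (\<lambda>y. indicator {0<..<R} y * y powr (-\<alpha>))"
proof -
  have "((\<lambda>x. x powr (-\<alpha>)) has_integral (max 0 R powr (-\<alpha> + 1) / (-\<alpha> + 1))) {0..max 0 R}"
    by (rule has_integral_powr_from_0) (use assms in auto)
  then have "(\<lambda>x. x powr (-\<alpha>)) absolutely_integrable_on {0..max 0 R}"
    by (intro nonnegative_absolutely_integrable_1) (auto simp: integrable_on_def)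
  then have "set_integrable lborel {0..max 0 R} (\<lambda>x. x powr (-\<alpha>))"
    unfolding set_integrable_def by (subst (asm) integrable_completion) auto
  then have "set_integrable lborel {0<..<R} (\<lambda>x. x powr (-\<alpha>))"
    by (rule set_integrable_subset) auto
  then show ?thesis by (simp add: set_integrable_def)
qed

text \<open>
  Convolution with \<open>k\<close> commutes with indefinite integration, by Fubini's theorem.
\<close>

lemma
  fixes k f :: "real \<Rightarrow> real"
  assumes k: "integrable lborel k" and f: "integrable lborel f"
  shows integrable_convolution: "integrable lborel (\<lambda>s. \<integral>y. k y * f (s - y) \<partial>lborel)"
    and integral_convolution_atMost:
      "(\<integral>y. k y * (\<integral>s. indicator {..x} s * f (s - y) \<partial>lborel) \<partial>lborel)
        = (\<integral>s. indicator {..x} s * (\<integral>y. k y * f (s - y) \<partial>lborel) \<partial>lborel)"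
    and integrable_convolution_atMost:
      "integrable lborel (\<lambda>y. k y * (\<integral>s. indicator {..x} s * f (s - y) \<partial>lborel))"
proof -
  have [measurable]: "k \<in> borel_measurable borel" "f \<in> borel_measurable borel"
    using k f by (auto dest: borel_measurable_integrable)
  have shift: "integrable lborel (\<lambda>s. f (s - y))" for y
    using lborel_integrable_real_affine[OF f, of 1 "-y"] by (simp add: algebra_simps)
  have shiftn: "(\<integral>s. \<bar>f (s - y)\<bar> \<partial>lborel) = (\<integral>s. \<bar>f s\<bar> \<partial>lborel)" for y
    using lborel_integral_real_affine[of 1 "\<lambda>s. \<bar>f s\<bar>" "-y"] by (simp add: algebra_simps)
  have I: "integrable (lborel \<Otimes>\<^sub>M lborel) (\<lambda>(y, s). k y * f (s - y))"
  proof (rule lborel_pair.Fubini_integrable)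
    show "(\<lambda>(y, s). k y * f (s - y)) \<in> borel_measurable (lborel \<Otimes>\<^sub>M lborel)" by measurable
    have "(\<integral>s. norm (case (y, s) of (y, s) \<Rightarrow> k y * f (s - y)) \<partial>lborel) = \<bar>k y\<bar> * (\<integral>s. \<bar>f s\<bar> \<partial>lborel)" for y
      by (simp add: abs_mult shiftn)
    then show "integrable lborel (\<lambda>y. \<integral>s. norm (case (y, s) of (y, s) \<Rightarrow> k y * f (s - y)) \<partial>lborel)"
      using k by simp
    show "AE y in lborel. integrable lborel (\<lambda>s. case (y, s) of (y, s) \<Rightarrow> k y * f (s - y))"
      using shift by simp
  qed
  then show "integrable lborel (\<lambda>s. \<integral>y. k y * f (s - y) \<partial>lborel)"
    using lborel_pair.integrable_snd[of "\<lambda>y s. k y * f (s - y)"] by simp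
  have "integrable (lborel \<Otimes>\<^sub>M lborel) (\<lambda>z. indicator (UNIV \<times> {..x}) z *\<^sub>R (case z of (y, s) \<Rightarrow> k y * f (s - y)))"
    by (rule integrable_mult_indicator[OF _ I]) simp
  also have "(\<lambda>z. indicator (UNIV \<times> {..x}) z *\<^sub>R (case z of (y, s) \<Rightarrow> k y * f (s - y)))
      = (\<lambda>(y, s). k y * (indicator {..x} s * f (s - y)))"
    by (auto simp: fun_eq_iff split: split_indicator)
  finally have J: "integrable (lborel \<Otimes>\<^sub>M lborel) (\<lambda>(y, s). k y * (indicator {..x} s * f (s - y)))" .
  show "integrable lborel (\<lambda>y. k y * (\<integral>s. indicator {..x} s * f (s - y) \<partial>lborel))"
    using lborel_pair.integrable_fst[of "\<lambda>y s. k y * (indicator {..x} s * f (s - y))"] J by simp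
  have "(\<integral>y. k y * (\<integral>s. indicator {..x} s * f (s - y) \<partial>lborel) \<partial>lborel)
      = (\<integral>y. (\<integral>s. k y * (indicator {..x} s * f (s - y)) \<partial>lborel) \<partial>lborel)"
    by simp
  also have "\<dots> = (\<integral>s. (\<integral>y. k y * (indicator {..x} s * f (s - y)) \<partial>lborel) \<partial>lborel)"
    by (rule lborel_pair.Fubini_integral[symmetric]) (rule J)
  also have "\<dots> = (\<integral>s. indicator {..x} s * (\<integral>y. k y * f (s - y) \<partial>lborel) \<partial>lborel)"
    by (intro Bochner_Integration.integral_cong refl) (auto split: split_indicator)
  finally show "(\<integral>y. k y * (\<integral>s. indicator {..x} s * f (s - y) \<partial>lborel) \<partial>lborel)
        = (\<integral>s. indicator {..x} s * (\<integral>y. k y * f (s - y) \<partial>lborel) \<partial>lborel)" .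
qed

text \<open>
  The formal derivative of the Abel integral of a function with value \<open>c\<close> at \<open>a\<close> and density \<open>g\<close>:
  the first summand stems from the constant, and the second is the Abel integral of the density.
\<close>

definition abel_density :: "real \<Rightarrow> real \<Rightarrow> real \<Rightarrow> (real \<Rightarrow> real) \<Rightarrow> real \<Rightarrow> real" where
  "abel_density \<alpha> a c g s =
     c * (s - a) powr (-\<alpha>) + (LINT \<theta>:{a<..<s}|lborel. (s - \<theta>) powr (-\<alpha>) * g \<theta>)"

text \<open>
  Substituting \<open>y = x - \<theta>\<close> turns the Abel integral into a convolution with the kernel \<open>y\<^sup>-\<^sup>\<alpha>\<close>, which commutes
  with the integration that makes \<open>v\<close> out of \<open>c\<close> and \<open>g\<close>. The kernel is cut off at \<open>b - a + 1\<close> to become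
  integrable on the line, which changes nothing for arguments in \<open>[a,b]\<close>.
\<close>

lemma
  fixes \<alpha> a b c :: real
  assumes \<alpha>: "\<alpha> < 1" and ab: "a < b" and d: "has_density a b v c g"
  shows abel_density_integrable: "set_integrable lborel {a..b} (abel_density \<alpha> a c g)"
    and abel_integrand_integrable: "x \<in> {a..b} \<Longrightarrow>
      set_integrable lborel {a<..<x} (\<lambda>\<theta>. (x - \<theta>) powr (-\<alpha>) * v \<theta>)"
    and abel_integral_primitive: "x \<in> {a..b} \<Longrightarrow>
      (LINT \<theta>:{a<..<x}|lborel. (x - \<theta>) powr (-\<alpha>) * v \<theta>) = (LINT s:{a..x}|lborel. abel_density \<alpha> a c g s)"
proof -
  have g: "integrable lborel g" and g0: "\<And>x. x \<notin> {a..b} \<Longrightarrow> g x = 0"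
    and v: "\<And>x. x \<in> {a..b} \<Longrightarrow> v x = c + (LINT t:{a..x}|lborel. g t)"
    using d unfolding has_density_def by blast+
  define R where "R = b - a + 1"
  define k where "k = (\<lambda>y. indicator {0<..<R} y * y powr (-\<alpha>))"
  have k: "integrable lborel k" unfolding k_def by (rule integrable_powr_kernel[OF \<alpha>])
  have [measurable]: "k \<in> borel_measurable borel" "g \<in> borel_measurable borel"
    using k g by (auto dest: borel_measurable_integrable)
  define W where "W = (\<lambda>s. \<integral>y. k y * g (s - y) \<partial>lborel)"
  have W: "integrable lborel W" unfolding W_def by (rule integrable_convolution[OF k g])
  have refl_int: "(\<integral>y. h (s - y) \<partial>lborel) = (\<integral>y. h y \<partial>lborel)" for h :: "real \<Rightarrow> real" and s
    using lborel_integral_real_affine[of "-1" h s] by (simp add: algebra_simps)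
  have shift: "integrable lborel (\<lambda>s. k (s - a))"
    using lborel_integrable_real_affine[OF k, of 1 "-a"] by (simp add: algebra_simps)
  have W_eq: "W s = (LINT \<theta>:{a<..<s}|lborel. (s - \<theta>) powr (-\<alpha>) * g \<theta>)" if "s \<le> b" for s
  proof -
    have "W s = (\<integral>y. k (s - y) * g y \<partial>lborel)"
      unfolding W_def using refl_int[of "\<lambda>y. k y * g (s - y)" s] by simp
    also have "\<dots> = (LINT \<theta>:{a<..<s}|lborel. (s - \<theta>) powr (-\<alpha>) * g \<theta>)"
      unfolding set_lebesgue_integral_def
    proof (rule integral_cong_AE)
      show "AE y in lborel. k (s - y) * g y = indicator {a<..<s} y *\<^sub>R ((s - y) powr (-\<alpha>) * g y)"
        using AE_lborel_singleton[of a]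
      proof eventually_elim
        case (elim y)
        then show ?case
          using g0[of y] that by (cases "y < a") (auto simp: k_def R_def split: split_indicator)
      qed
    qed measurable
    finally show ?thesis .
  qed
  have W0: "W s = 0" if "s < a" for s
  proof -
    have "k y * g (s - y) = 0" for y using that g0[of "s - y"] by (auto simp: k_def split: split_indicator)
    then show ?thesis by (simp only: W_def Bochner_Integration.integral_zero)
  qed
  have dens: "indicator {a..b} s * abel_density \<alpha> a c g s = indicator {a..b} s * (c * k (s - a) + W s)" for s
    by (cases "s = a") (auto simp: abel_density_def W_eq k_def R_def split: split_indicator)
  have int0: "integrable lborel (\<lambda>s. c * k (s - a) + W s)" using shift W by simp
  show "set_integrable lborel {a..b} (abel_density \<alpha> a c g)"
    unfolding set_integrable_def real_scaleR_def dens
    using integrable_mult_indicator[OF _ int0, of "{a..b}"] by simp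
  have key: "set_integrable lborel {a<..<x} (\<lambda>\<theta>. (x - \<theta>) powr (-\<alpha>) * v \<theta>) \<and>
      (LINT \<theta>:{a<..<x}|lborel. (x - \<theta>) powr (-\<alpha>) * v \<theta>) = (LINT s:{a..x}|lborel. abel_density \<alpha> a c g s)"
    if x: "x \<in> {a..b}"
  proof -
    define h where "h = (\<lambda>y. k y * (\<integral>s. indicator {..x} s * g (s - y) \<partial>lborel))"
    have h: "integrable lborel h" unfolding h_def by (rule integrable_convolution_atMost[OF k g])
    have h': "(\<integral>y. h y \<partial>lborel) = (\<integral>s. indicator {..x} s * W s \<partial>lborel)"
      unfolding h_def W_def by (rule integral_convolution_atMost[OF k g])
    have inner: "(\<integral>s. indicator {..x} s * g (s - y) \<partial>lborel) = (LINT t:{a..x - y}|lborel. g t)" for y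
    proof -
      have "(\<integral>s. indicator {..x} s * g (s - y) \<partial>lborel) = (\<integral>t. indicator {..x} (y + t) * g t \<partial>lborel)"
        using lborel_integral_real_affine[of 1 "\<lambda>s. indicator {..x} s * g (s - y)" y] by simp
      also have "\<dots> = (LINT t:{a..x - y}|lborel. g t)"
        unfolding set_lebesgue_integral_def
        by (intro Bochner_Integration.integral_cong refl) (use g0 in \<open>auto split: split_indicator\<close>)
      finally show ?thesis .
    qed
    define q where "q = (\<lambda>y. indicator {0<..<x - a} y * (c * k y) + h y)"
    have c1: "integrable lborel (\<lambda>y. indicator {0<..<x - a} y * (c * k y))"
      using integrable_mult_indicator[of "{0<..<x - a}" lborel "\<lambda>y. c * k y"] k by simp
    have q: "integrable lborel q" unfolding q_def using c1 h by (intro Bochner_Integration.integrable_add)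
    have h0: "h y = 0" if "y \<notin> {0<..<x - a}" for y
    proof (cases "y \<le> 0")
      case False
      then have xy: "x - y \<le> a" using that by auto
      have "AE t in lborel. indicator {a..x - y} t *\<^sub>R g t = 0"
        using AE_lborel_singleton[of a] by eventually_elim (use xy in \<open>auto split: split_indicator\<close>)
      then have "(LINT t:{a..x - y}|lborel. g t) = 0"
        unfolding set_lebesgue_integral_def by (rule integral_eq_zero_AE)
      then show ?thesis by (simp add: h_def inner)
    qed (simp add: h_def k_def)
    have qv: "q y = indicator {a<..<x} (x - y) *\<^sub>R ((x - (x - y)) powr (-\<alpha>) * v (x - y))" for y
    proof (cases "y \<in> {0<..<x - a}")
      case True
      then have "x - y \<in> {a..b}" "y < R" using x by (auto simp: R_def)
      then show ?thesis using True v[of "x - y"]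
        by (simp add: q_def h_def inner k_def algebra_simps)
    next
      case False
      then show ?thesis using h0[OF False] by (auto simp: q_def split: split_indicator)
    qed
    have "integrable lborel (\<lambda>y. q (x - y))"
      using lborel_integrable_real_affine[OF q, of "-1" x] by (simp add: algebra_simps)
    then have 1: "set_integrable lborel {a<..<x} (\<lambda>\<theta>. (x - \<theta>) powr (-\<alpha>) * v \<theta>)"
      unfolding set_integrable_def qv by simp
    have "(LINT \<theta>:{a<..<x}|lborel. (x - \<theta>) powr (-\<alpha>) * v \<theta>) = (\<integral>y. q (x - y) \<partial>lborel)"
      unfolding set_lebesgue_integral_def qv by simp
    also have "\<dots> = (\<integral>y. q y \<partial>lborel)" by (rule refl_int)
    also have "\<dots> = (\<integral>y. indicator {0<..<x - a} y * (c * k y) \<partial>lborel) + (\<integral>s. indicator {..x} s * W s \<partial>lborel)"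
      unfolding q_def using c1 h by (subst Bochner_Integration.integral_add) (simp_all add: h')
    also have "(\<integral>y. indicator {0<..<x - a} y * (c * k y) \<partial>lborel)
        = (\<integral>s. indicator {0<..<x - a} (s - a) * (c * k (s - a)) \<partial>lborel)"
      using lborel_integral_real_affine[of 1 "\<lambda>y. indicator {0<..<x - a} y * (c * k y)" "-a"]
      by (simp add: algebra_simps)
    also have "\<dots> = (\<integral>s. indicator {a..x} s * (c * k (s - a)) \<partial>lborel)"
    proof (rule integral_cong_AE)
      show "AE s in lborel. indicator {0<..<x - a} (s - a) * (c * k (s - a)) = indicator {a..x} s * (c * k (s - a))"
        using AE_lborel_singleton[of a] AE_lborel_singleton[of x]
        by eventually_elim (auto split: split_indicator)
    qed measurable
    also have "(\<integral>s. indicator {..x} s * W s \<partial>lborel) = (\<integral>s. indicator {a..x} s * W s \<partial>lborel)"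
      by (intro Bochner_Integration.integral_cong refl) (use W0 in \<open>auto split: split_indicator\<close>)
    also have "(\<integral>s. indicator {a..x} s * (c * k (s - a)) \<partial>lborel) + (\<integral>s. indicator {a..x} s * W s \<partial>lborel)
        = (\<integral>s. indicator {a..x} s * (c * k (s - a)) + indicator {a..x} s * W s \<partial>lborel)"
      using integrable_mult_indicator[of "{a..x}" lborel "\<lambda>s. c * k (s - a)"] shift
        integrable_mult_indicator[of "{a..x}" lborel W] W
      by (subst Bochner_Integration.integral_add) auto
    also have "\<dots> = (LINT s:{a..x}|lborel. abel_density \<alpha> a c g s)"
      unfolding set_lebesgue_integral_def
    proof (intro Bochner_Integration.integral_cong refl)
      fix s
      have "indicator {a..x} s = indicator {a..x} s * (indicator {a..b} s :: real)"
        using x by (auto split: split_indicator)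
      then show "indicator {a..x} s * (c * k (s - a)) + indicator {a..x} s * W s
          = indicator {a..x} s *\<^sub>R abel_density \<alpha> a c g s"
        using dens[of s] by (simp add: algebra_simps split: split_indicator_asm split_indicator)
    qed
    finally show ?thesis using 1 by simp
  qed
  then show "x \<in> {a..b} \<Longrightarrow> set_integrable lborel {a<..<x} (\<lambda>\<theta>. (x - \<theta>) powr (-\<alpha>) * v \<theta>)"
    "x \<in> {a..b} \<Longrightarrow>
      (LINT \<theta>:{a<..<x}|lborel. (x - \<theta>) powr (-\<alpha>) * v \<theta>) = (LINT s:{a..x}|lborel. abel_density \<alpha> a c g s)"
    by blast+
qed

lemma lborel_integral_reflect: "(\<integral>y. h (- y) \<partial>lborel) = (\<integral>y. h (y::real) \<partial>lborel)" for h :: "real \<Rightarrow> real"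
  using lborel_integral_real_affine[of "-1" h 0] by simp

lemma lborel_integrable_reflect:
  "integrable lborel (\<lambda>y. h (- y)) \<longleftrightarrow> integrable lborel h" for h :: "real \<Rightarrow> real"
proof
  assume "integrable lborel (\<lambda>y. h (- y))"
  from lborel_integrable_real_affine[OF this, of "-1" 0] show "integrable lborel h" by simp
next
  assume "integrable lborel h"
  from lborel_integrable_real_affine[OF this, of "-1" 0] show "integrable lborel (\<lambda>y. h (- y))" by simp
qed

text \<open>
  The mirror image of \<open>abel_density\<close>, for the end point \<open>b\<close> where the function has value \<open>c\<close>. The
  derivative of the right Abel integral is the negative of this function.
\<close>

definition abel_density_right :: "real \<Rightarrow> real \<Rightarrow> real \<Rightarrow> (real \<Rightarrow> real) \<Rightarrow> real \<Rightarrow> real" where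
  "abel_density_right \<alpha> b c g s =
     c * (b - s) powr (-\<alpha>) - (LINT \<theta>:{s<..<b}|lborel. (\<theta> - s) powr (-\<alpha>) * g \<theta>)"

lemma abel_density_reflect:
  "abel_density \<alpha> (- b) c (\<lambda>t. - g (- t)) (- s) = abel_density_right \<alpha> b c g s"
proof -
  have "(LINT \<theta>:{- b<..<- s}|lborel. (- s - \<theta>) powr (-\<alpha>) * - g (- \<theta>))
    = (\<integral>\<theta>. indicator {- b<..<- s} (- \<theta>) *\<^sub>R ((- s - (- \<theta>)) powr (-\<alpha>) * - g (- (- \<theta>))) \<partial>lborel)"
    unfolding set_lebesgue_integral_def by (rule lborel_integral_reflect[symmetric])
  also have "\<dots> = (\<integral>\<theta>. - (indicator {s<..<b} \<theta> *\<^sub>R ((\<theta> - s) powr (-\<alpha>) * g \<theta>)) \<partial>lborel)"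
    by (intro Bochner_Integration.integral_cong refl) (auto split: split_indicator)
  also have "\<dots> = - (LINT \<theta>:{s<..<b}|lborel. (\<theta> - s) powr (-\<alpha>) * g \<theta>)"
    unfolding set_lebesgue_integral_def by simp
  finally show ?thesis by (simp add: abel_density_def abel_density_right_def)
qed

text \<open>
  The reflection \<open>t \<mapsto> -t\<close> reduces right Abel integrals to left ones.
\<close>

lemma
  fixes \<alpha> a b :: real
  assumes \<alpha>: "\<alpha> < 1" and ab: "a < b" and d: "has_density a b v (v a) g"
  shows abel_density_right_integrable: "set_integrable lborel {a..b} (abel_density_right \<alpha> b (v b) g)"
    and abel_integrand_right_integrable: "x \<in> {a..b} \<Longrightarrow>
      set_integrable lborel {x<..<b} (\<lambda>\<theta>. (\<theta> - x) powr (-\<alpha>) * v \<theta>)"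
    and abel_integral_right_primitive: "x \<in> {a..b} \<Longrightarrow>
      (LINT \<theta>:{x<..<b}|lborel. (\<theta> - x) powr (-\<alpha>) * v \<theta>)
        = (LINT s:{x..b}|lborel. abel_density_right \<alpha> b (v b) g s)"
proof -
  have g: "integrable lborel g" and g0: "\<And>x. x \<notin> {a..b} \<Longrightarrow> g x = 0"
    and v: "\<And>x. x \<in> {a..b} \<Longrightarrow> v x = v a + (LINT t:{a..x}|lborel. g t)"
    using d unfolding has_density_def by blast+
  let ?g = "\<lambda>t. - g (- t)" and ?v = "\<lambda>t. v (- t)"
  have g': "integrable lborel ?g" using g lborel_integrable_reflect[of g] by simp
  have g0': "?g x = 0" if "x \<notin> {-b..-a}" for x using that g0[of "-x"] by auto
  have v': "?v x = v b + (LINT t:{-b..x}|lborel. ?g t)" if x: "x \<in> {-b..-a}" for x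
  proof -
    have "(LINT t:{-b..x}|lborel. ?g t) = (\<integral>t. indicator {-b..x} (- t) *\<^sub>R (- g (- (- t))) \<partial>lborel)"
      unfolding set_lebesgue_integral_def by (rule lborel_integral_reflect[symmetric])
    also have "\<dots> = (\<integral>t. - (indicator {-x..b} t *\<^sub>R g t) \<partial>lborel)"
      by (intro Bochner_Integration.integral_cong refl) (auto split: split_indicator)
    also have "\<dots> = - (LINT t:{-x..b}|lborel. g t)"
      unfolding set_lebesgue_integral_def by simp
    finally show ?thesis
      using v[of b] v[of "-x"] x ab lborel_set_integral_split[OF set_integrable_whole[OF g], of a b "-x"]
      by simp
  qed
  have ab': "- b < - a" using ab by simp
  have d': "has_density (- b) (- a) ?v (v b) ?g"
    using g' g0' v' by (simp add: has_density_def)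
  have "set_integrable lborel {-b..-a} (abel_density \<alpha> (- b) (v b) ?g)"
    by (rule abel_density_integrable[OF \<alpha> ab' d'])
  then have "integrable lborel (\<lambda>s. indicator {-b..-a} (- s) *\<^sub>R abel_density \<alpha> (- b) (v b) ?g (- s))"
    unfolding set_integrable_def
    by (rule lborel_integrable_reflect[of "\<lambda>s. indicator {-b..-a} s *\<^sub>R abel_density \<alpha> (- b) (v b) ?g s", THEN iffD2])
  also have "(\<lambda>s. indicator {-b..-a} (- s) *\<^sub>R abel_density \<alpha> (- b) (v b) ?g (- s))
     = (\<lambda>s. indicator {a..b} s *\<^sub>R abel_density_right \<alpha> b (v b) g s)"
    by (auto simp: fun_eq_iff abel_density_reflect split: split_indicator)
  finally show "set_integrable lborel {a..b} (abel_density_right \<alpha> b (v b) g)"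
    by (simp add: set_integrable_def)
  assume x: "x \<in> {a..b}"
  then have x': "- x \<in> {-b..-a}" by simp
  have refl_ind: "(\<lambda>\<theta>. indicator {-b<..<-x} (- \<theta>) *\<^sub>R ((- x - (- \<theta>)) powr (-\<alpha>) * v (- (- \<theta>))))
      = (\<lambda>\<theta>. indicator {x<..<b} \<theta> *\<^sub>R ((\<theta> - x) powr (-\<alpha>) * v \<theta>))"
    by (auto simp: fun_eq_iff split: split_indicator)
  have "integrable lborel (\<lambda>\<theta>. indicator {-b<..<-x} (- \<theta>) *\<^sub>R ((- x - (- \<theta>)) powr (-\<alpha>) * v (- (- \<theta>))))"
    using abel_integrand_integrable[OF \<alpha> ab' d' x']
    unfolding set_integrable_def
    by (rule lborel_integrable_reflect[of "\<lambda>\<theta>. indicator {-b<..<-x} \<theta> *\<^sub>R ((- x - \<theta>) powr (-\<alpha>) * v (- \<theta>))", THEN iffD2])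
  then show "set_integrable lborel {x<..<b} (\<lambda>\<theta>. (\<theta> - x) powr (-\<alpha>) * v \<theta>)"
    unfolding set_integrable_def refl_ind .
  have "(LINT \<theta>:{x<..<b}|lborel. (\<theta> - x) powr (-\<alpha>) * v \<theta>)
     = (\<integral>\<theta>. indicator {-b<..<-x} (- \<theta>) *\<^sub>R ((- x - (- \<theta>)) powr (-\<alpha>) * v (- (- \<theta>))) \<partial>lborel)"
    unfolding set_lebesgue_integral_def refl_ind ..
  also have "\<dots> = (LINT \<theta>:{-b<..<-x}|lborel. (- x - \<theta>) powr (-\<alpha>) * v (- \<theta>))"
    unfolding set_lebesgue_integral_def
    by (rule lborel_integral_reflect[of "\<lambda>\<theta>. indicator {-b<..<-x} \<theta> *\<^sub>R ((- x - \<theta>) powr (-\<alpha>) * v (- \<theta>))"])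
  also have "\<dots> = (LINT s:{-b..-x}|lborel. abel_density \<alpha> (- b) (v b) ?g s)"
    by (rule abel_integral_primitive[OF \<alpha> ab' d' x'])
  also have "\<dots> = (\<integral>s. indicator {-b..-x} (- s) *\<^sub>R abel_density \<alpha> (- b) (v b) ?g (- s) \<partial>lborel)"
    unfolding set_lebesgue_integral_def by (rule lborel_integral_reflect[symmetric])
  also have "\<dots> = (LINT s:{x..b}|lborel. abel_density_right \<alpha> b (v b) g s)"
    unfolding set_lebesgue_integral_def
    by (intro Bochner_Integration.integral_cong refl) (auto simp: abel_density_reflect split: split_indicator)
  finally show "(LINT \<theta>:{x<..<b}|lborel. (\<theta> - x) powr (-\<alpha>) * v \<theta>)
        = (LINT s:{x..b}|lborel. abel_density_right \<alpha> b (v b) g s)" .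
qed

lemma AE_derivative_indefinite_integral:
  fixes f :: "real \<Rightarrow> real"
  assumes f: "set_integrable lborel {a..b} f"
  shows "AE t\<in>{a<..<b} in lebesgue. ((\<lambda>x. LINT s:{a..x}|lborel. f s) has_real_derivative f t) (at t)"
proof -
  have HK: "f integrable_on {a..b}" by (rule set_borel_integral_eq_integral[OF f])
  have eq: "(LINT s:{a..x}|lborel. f s) = integral {a..x} f" if "x \<le> b" for x
    by (rule set_borel_integral_eq_integral) (rule set_integrable_subset[OF f]; use that in auto)
  let ?N = "{x \<in> {a<..<b}. \<not> ((\<lambda>y. integral {a..y} f) has_real_derivative f x) (at x)}"
  have "AE t in lebesgue. t \<notin> ?N"
    using negligible_indefinite_integral_not_derivative[OF HK] negligible_iff_null_sets AE_not_in by blast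
  then show ?thesis
  proof eventually_elim
    case (elim t)
    show ?case
    proof
      assume t: "t \<in> {a<..<b}"
      with elim have "((\<lambda>y. integral {a..y} f) has_real_derivative f t) (at t)" by blast
      then show "((\<lambda>x. LINT s:{a..x}|lborel. f s) has_real_derivative f t) (at t)"
        by (rule has_field_derivative_transform_within_open[of _ _ _ "{a<..<b}"]) (use t eq in auto)
    qed
  qed
qed

section \<open>The left fractional derivative almost everywhere\<close>

lemma set_integral_lebesgue_eq_lborel:
  fixes f :: "real \<Rightarrow> real"
  assumes "set_integrable lborel S f"
  shows "set_integrable lebesgue S f" "(LINT x:S|lebesgue. f x) = (LINT x:S|lborel. f x)"
proof -
  have "(\<lambda>x. indicator S x *\<^sub>R f x) \<in> borel_measurable lborel"
    using assms unfolding set_integrable_def by (rule borel_measurable_integrable)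
  then show "set_integrable lebesgue S f" "(LINT x:S|lebesgue. f x) = (LINT x:S|lborel. f x)"
    using assms unfolding set_integrable_def set_lebesgue_integral_def
    by (simp_all add: integrable_completion integral_completion)
qed

definition left_abel :: "real \<Rightarrow> real \<Rightarrow> (real \<Rightarrow> real) \<Rightarrow> real \<Rightarrow> real" where
  "left_abel \<alpha> a u x = (LINT \<theta>:{a<..<x}|lebesgue. (x - \<theta>) powr (-\<alpha>) * u \<theta>)"

lemma left_RL_eqI:
  assumes "\<alpha> < 1" "(left_abel \<alpha> a u has_real_derivative D) (at t)"
  shows "left_RL \<alpha> a u t = D / Gamma (1 - \<alpha>)"
  using DERIV_imp_deriv[OF assms(2)] unfolding left_RL_def left_abel_def by simp

lemma AE_left_abel_derivative:
  fixes \<alpha> a b c :: real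
  assumes \<alpha>: "\<alpha> < 1" and ab: "a < b" and d: "has_density a b v c g"
  shows "AE t\<in>{a<..<b} in lebesgue. (left_abel \<alpha> a v has_real_derivative abel_density \<alpha> a c g t) (at t)"
proof -
  note L = abel_integrand_integrable[OF \<alpha> ab d] abel_integral_primitive[OF \<alpha> ab d]
  have eq: "left_abel \<alpha> a v x = (LINT s:{a..x}|lborel. abel_density \<alpha> a c g s)" if "x \<in> {a..b}" for x
    unfolding left_abel_def using set_integral_lebesgue_eq_lborel[OF L(1)[OF that]] L(2)[OF that] by simp
  show ?thesis
    using AE_derivative_indefinite_integral[OF abel_density_integrable[OF \<alpha> ab d]]
  proof eventually_elim
    case (elim t)
    show ?case
    proof
      assume t: "t \<in> {a<..<b}"
      with elim show "(left_abel \<alpha> a v has_real_derivative abel_density \<alpha> a c g t) (at t)"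
        by (elim impE, blast, rule_tac has_field_derivative_transform_within_open[of _ _ _ "{a<..<b}"])
           (auto simp: eq)
    qed
  qed
qed

lemma left_abel_add_scaled:
  assumes \<alpha>: "\<alpha> < 1" and ab: "a < b" and u: "u \<in> AC a b" and v: "v \<in> AC a b" and x: "x \<in> {a..b}"
  shows "left_abel \<alpha> a (\<lambda>t. u t + \<epsilon> * v t) x = left_abel \<alpha> a u x + \<epsilon> * left_abel \<alpha> a v x"
proof -
  have I: "set_integrable lebesgue {a<..<x} (\<lambda>\<theta>. (x - \<theta>) powr (-\<alpha>) * w \<theta>)" if w: "w \<in> AC a b" for w
  proof -
    obtain g where g: "has_density a b w (w a) g" using AC_has_density[OF w ab] by blast
    show ?thesis
      by (rule set_integral_lebesgue_eq_lborel(1)[OF abel_integrand_integrable[OF \<alpha> ab g x]])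
  qed
  have "left_abel \<alpha> a (\<lambda>t. u t + \<epsilon> * v t) x
    = (LINT \<theta>:{a<..<x}|lebesgue. (x - \<theta>) powr (-\<alpha>) * u \<theta> + \<epsilon> * ((x - \<theta>) powr (-\<alpha>) * v \<theta>))"
    unfolding left_abel_def by (simp add: algebra_simps)
  also have "\<dots> = left_abel \<alpha> a u x + \<epsilon> * left_abel \<alpha> a v x"
    unfolding left_abel_def using I[OF u] I[OF v] by (subst set_integral_add) auto
  finally show ?thesis .
qed

text \<open>
  The null set has to be the same for all \<open>\<epsilon>\<close>: it consists of the points where the Abel integral of \<open>u\<close> or
  of \<open>v\<close> fails to be differentiable. At such points the fractional derivative is an unspecified value
  and need not be additive.
\<close>

lemma AE_left_RL_variation:
  fixes \<alpha> a b :: real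
  assumes \<alpha>: "\<alpha> < 1" and ab: "a < b" and u: "u \<in> AC a b"
    and d: "has_density a b v c g"
  shows "AE t\<in>{a<..<b} in lebesgue. \<forall>\<epsilon>. left_RL \<alpha> a (\<lambda>t. u t + \<epsilon> * v t) t
           = left_RL \<alpha> a u t + \<epsilon> * (abel_density \<alpha> a c g t / Gamma (1 - \<alpha>))"
proof -
  have vAC: "v \<in> AC a b" by (rule has_density_imp_AC[OF d])
  obtain f where f: "has_density a b u (u a) f" using AC_has_density[OF u ab] by blast
  show ?thesis
    using AE_left_abel_derivative[OF \<alpha> ab f] AE_left_abel_derivative[OF \<alpha> ab d]
  proof eventually_elim
    case (elim t)
    show ?case
    proof (intro impI allI)
      fix \<epsilon> assume t: "t \<in> {a<..<b}"
      have 1: "(left_abel \<alpha> a u has_real_derivative abel_density \<alpha> a (u a) f t) (at t)"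
        and 2: "(left_abel \<alpha> a v has_real_derivative abel_density \<alpha> a c g t) (at t)"
        using elim t by blast+
      have "((\<lambda>x. left_abel \<alpha> a u x + \<epsilon> * left_abel \<alpha> a v x) has_real_derivative
          abel_density \<alpha> a (u a) f t + \<epsilon> * abel_density \<alpha> a c g t) (at t)"
        by (intro DERIV_add DERIV_cmult 1 2)
      then have "(left_abel \<alpha> a (\<lambda>t. u t + \<epsilon> * v t) has_real_derivative
          abel_density \<alpha> a (u a) f t + \<epsilon> * abel_density \<alpha> a c g t) (at t)"
        by (rule has_field_derivative_transform_within_open[of _ _ _ "{a<..<b}"])
           (use t left_abel_add_scaled[OF \<alpha> ab u vAC] in auto)
      from left_RL_eqI[OF \<alpha> this] left_RL_eqI[OF \<alpha> 1]
      show "left_RL \<alpha> a (\<lambda>t. u t + \<epsilon> * v t) t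
           = left_RL \<alpha> a u t + \<epsilon> * (abel_density \<alpha> a c g t / Gamma (1 - \<alpha>))"
        by (simp add: add_divide_distrib)
    qed
  qed
qed

lemma AE_left_RL_integrable:
  fixes \<alpha> a b :: real
  assumes \<alpha>: "\<alpha> < 1" and ab: "a < b" and u: "u \<in> AC a b"
  shows "\<exists>\<phi>. integrable lborel \<phi> \<and> (AE t\<in>{a<..<b} in lebesgue. left_RL \<alpha> a u t = \<phi> t)"
proof -
  obtain f where f: "has_density a b u (u a) f" using AC_has_density[OF u ab] by blast
  let ?\<phi> = "\<lambda>t. (indicator {a..b} t *\<^sub>R abel_density \<alpha> a (u a) f t) / Gamma (1 - \<alpha>)"
  have "integrable lborel ?\<phi>"
    using abel_density_integrable[OF \<alpha> ab f] unfolding set_integrable_def by (rule integrable_divide_zero)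
  moreover have "AE t\<in>{a<..<b} in lebesgue. left_RL \<alpha> a u t = ?\<phi> t"
    using AE_left_abel_derivative[OF \<alpha> ab f] by eventually_elim (auto dest!: left_RL_eqI[OF \<alpha>])
  ultimately show ?thesis by blast
qed

lemma AE_deriv_has_density:
  assumes d: "has_density a b G c g"
  shows "AE t\<in>{a<..<b} in lebesgue. deriv G t = g t"
proof -
  have g: "integrable lborel g" and G: "\<And>x. x \<in> {a..b} \<Longrightarrow> G x = c + (LINT t:{a..x}|lborel. g t)"
    using d by (auto simp: has_density_def)
  have "set_integrable lborel {a..b} g" by (rule set_integrable_whole[OF g]) simp
  from AE_derivative_indefinite_integral[OF this] show ?thesis
  proof eventually_elim
    case (elim t)
    show ?case
    proof
      assume t: "t \<in> {a<..<b}"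
      then have "((\<lambda>x. c + (LINT s:{a..x}|lborel. g s)) has_real_derivative 0 + g t) (at t)"
        using elim by (intro DERIV_add) auto
      then have "(G has_real_derivative 0 + g t) (at t)"
        by (rule has_field_derivative_transform_within_open[of _ _ _ "{a<..<b}"]) (use t in \<open>auto simp: G[symmetric]\<close>)
      then show "deriv G t = g t" by (simp add: DERIV_imp_deriv)
    qed
  qed
qed

section \<open>Abel integrals of two families of test functions\<close>

text \<open>
  The integral of the kernel \<open>(y-s)\<^sup>-\<^sup>\<alpha>\<close> against a unit step at \<open>s = 0\<close>; for \<open>\<alpha> = 0\<close> it is the ramp \<open>max 0 y\<close>.
\<close>

definition powr_ramp :: "real \<Rightarrow> real \<Rightarrow> real" where
  "powr_ramp \<alpha> y = max 0 y powr (1 - \<alpha>) / (1 - \<alpha>)"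

lemma
  fixes \<alpha> p t :: real
  assumes \<alpha>: "\<alpha> < 1"
  shows powr_kernel_integrable: "integrable lborel (\<lambda>\<theta>. indicator {p<..<t} \<theta> * (t - \<theta>) powr (-\<alpha>))"
    and powr_kernel_integral: "(\<integral>\<theta>. indicator {p<..<t} \<theta> * (t - \<theta>) powr (-\<alpha>) \<partial>lborel) = powr_ramp \<alpha> (t - p)"
proof -
  let ?k = "\<lambda>y. indicator {0<..<t - p} y * y powr (-\<alpha>)"
  have k: "integrable lborel ?k" by (rule integrable_powr_kernel[OF \<alpha>])
  have eq: "(\<lambda>\<theta>. ?k (t + (-1) * \<theta>)) = (\<lambda>\<theta>. indicator {p<..<t} \<theta> * (t - \<theta>) powr (-\<alpha>))"
    by (auto simp: fun_eq_iff split: split_indicator)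
  show "integrable lborel (\<lambda>\<theta>. indicator {p<..<t} \<theta> * (t - \<theta>) powr (-\<alpha>))"
    using lborel_integrable_real_affine[OF k, of "-1" t] unfolding eq by simp
  have "(\<integral>\<theta>. indicator {p<..<t} \<theta> * (t - \<theta>) powr (-\<alpha>) \<partial>lborel) = (\<integral>y. ?k y \<partial>lborel)"
    using lborel_integral_real_affine[of "-1" ?k t] unfolding eq by simp
  also have "\<dots> = powr_ramp \<alpha> (t - p)"
  proof (cases "p < t")
    case True
    have "(\<integral>y. ?k y \<partial>lborel) = (LINT y:{0<..<t - p}|lborel. y powr (-\<alpha>))"
      by (simp add: set_lebesgue_integral_def)
    also have "\<dots> = integral {0<..<t - p} (\<lambda>y. y powr (-\<alpha>))"
      by (rule set_borel_integral_eq_integral) (use k in \<open>simp add: set_integrable_def\<close>)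
    also have "\<dots> = integral {0..t - p} (\<lambda>y. y powr (-\<alpha>))"
      by (rule integral_open_interval_real[symmetric])
    also have "\<dots> = (t - p) powr (-\<alpha> + 1) / (-\<alpha> + 1)"
      by (rule integral_unique[OF has_integral_powr_from_0]) (use \<alpha> True in auto)
    also have "\<dots> = powr_ramp \<alpha> (t - p)" using True by (simp add: powr_ramp_def)
    finally show ?thesis .
  qed (simp add: powr_ramp_def)
  finally show "(\<integral>\<theta>. indicator {p<..<t} \<theta> * (t - \<theta>) powr (-\<alpha>) \<partial>lborel) = powr_ramp \<alpha> (t - p)" .
qed

lemma
  fixes \<alpha> a p q t :: real
  assumes \<alpha>: "\<alpha> < 1" and ap: "a \<le> p" and pq: "p \<le> q"
  shows abel_interval_integrable: "set_integrable lborel {a<..<t} (\<lambda>\<theta>. (t - \<theta>) powr (-\<alpha>) * indicator {p<..q} \<theta>)"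
    and abel_interval_integral: "(LINT \<theta>:{a<..<t}|lborel. (t - \<theta>) powr (-\<alpha>) * indicator {p<..q} \<theta>)
      = powr_ramp \<alpha> (t - p) - powr_ramp \<alpha> (t - q)"
proof -
  have eq: "(\<lambda>\<theta>. indicator {a<..<t} \<theta> *\<^sub>R ((t - \<theta>) powr (-\<alpha>) * indicator {p<..q} \<theta>))
    = (\<lambda>\<theta>. indicator {p<..<t} \<theta> * (t - \<theta>) powr (-\<alpha>) - indicator {q<..<t} \<theta> * (t - \<theta>) powr (-\<alpha>))"
    using ap pq by (auto simp: fun_eq_iff split: split_indicator)
  note k = powr_kernel_integrable[OF \<alpha>, of p t] powr_kernel_integrable[OF \<alpha>, of q t]
  show "set_integrable lborel {a<..<t} (\<lambda>\<theta>. (t - \<theta>) powr (-\<alpha>) * indicator {p<..q} \<theta>)"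
    unfolding set_integrable_def eq by (rule Bochner_Integration.integrable_diff[OF k])
  show "(LINT \<theta>:{a<..<t}|lborel. (t - \<theta>) powr (-\<alpha>) * indicator {p<..q} \<theta>)
      = powr_ramp \<alpha> (t - p) - powr_ramp \<alpha> (t - q)"
    unfolding set_lebesgue_integral_def eq Bochner_Integration.integral_diff[OF k] powr_kernel_integral[OF \<alpha>] ..
qed

text \<open>
  The fractional derivative of order \<open>0\<close> is the function itself.
\<close>

lemma abel_density_0:
  assumes d: "has_density a b v c g" and t: "a < t" "t \<le> b"
  shows "abel_density 0 a c g t = v t"
proof -
  have g: "integrable lborel g" using d by (simp add: has_density_def)
  have [measurable]: "g \<in> borel_measurable borel" using g by (auto dest: borel_measurable_integrable)
  have "(LINT \<theta>:{a<..<t}|lborel. (t - \<theta>) powr (-0) * g \<theta>) = (LINT \<theta>:{a..t}|lborel. g \<theta>)"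
    unfolding set_lebesgue_integral_def
  proof (rule integral_cong_AE)
    show "AE \<theta> in lborel. indicator {a<..<t} \<theta> *\<^sub>R ((t - \<theta>) powr (-0) * g \<theta>) = indicator {a..t} \<theta> *\<^sub>R g \<theta>"
      using AE_lborel_singleton[of a] AE_lborel_singleton[of t]
      by eventually_elim (auto split: split_indicator)
  qed measurable
  then show ?thesis using d t by (simp add: abel_density_def has_density_def)
qed

text \<open>
  For \<open>\<alpha> = 0\<close> and \<open>h \<le> y - x\<close> this is the trapezoidal function that rises from \<open>0\<close> to \<open>1\<close> on \<open>[x,x+h]\<close> and falls
  back to \<open>0\<close> on \<open>[y,y+h]\<close>. For other \<open>\<alpha>\<close> it is \<open>\<Gamma>(1-\<alpha>)\<close> times the fractional derivative of order \<open>\<alpha>\<close>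
  of that function.
\<close>

definition trapezoid :: "real \<Rightarrow> real \<Rightarrow> real \<Rightarrow> real \<Rightarrow> real \<Rightarrow> real" where
  "trapezoid \<alpha> x y h t = (powr_ramp \<alpha> (t - x) - powr_ramp \<alpha> (t - (x + h))
     - (powr_ramp \<alpha> (t - y) - powr_ramp \<alpha> (t - (y + h)))) / h"

definition trapezoid_slope :: "real \<Rightarrow> real \<Rightarrow> real \<Rightarrow> real \<Rightarrow> real" where
  "trapezoid_slope x y h \<theta> = (indicator {x<..x + h} \<theta> - indicator {y<..y + h} \<theta>) / h"

lemma abel_density_trapezoid:
  assumes \<alpha>: "\<alpha> < 1" and "a \<le> x" "a \<le> y" "h > 0"
  shows "abel_density \<alpha> a 0 (trapezoid_slope x y h) t = trapezoid \<alpha> x y h t"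
proof -
  have h: "x \<le> x + h" "y \<le> y + h" using assms by auto
  note I = abel_interval_integrable[OF \<alpha> assms(2) h(1), of t] abel_interval_integrable[OF \<alpha> assms(3) h(2), of t]
  note E = abel_interval_integral[OF \<alpha> assms(2) h(1), of t] abel_interval_integral[OF \<alpha> assms(3) h(2), of t]
  have "(LINT \<theta>:{a<..<t}|lborel. (t - \<theta>) powr (-\<alpha>) * trapezoid_slope x y h \<theta>)
    = (LINT \<theta>:{a<..<t}|lborel. (1 / h) * ((t - \<theta>) powr (-\<alpha>) * indicator {x<..x + h} \<theta>
        - (t - \<theta>) powr (-\<alpha>) * indicator {y<..y + h} \<theta>))"
    unfolding trapezoid_slope_def by (simp add: algebra_simps diff_divide_distrib)
  also have "\<dots> = (1 / h) * (LINT \<theta>:{a<..<t}|lborel. (t - \<theta>) powr (-\<alpha>) * indicator {x<..x + h} \<theta>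
        - (t - \<theta>) powr (-\<alpha>) * indicator {y<..y + h} \<theta>)"
    by (rule set_integral_mult_right)
  also have "\<dots> = trapezoid \<alpha> x y h t"
    unfolding set_integral_diff(2)[OF I] E trapezoid_def by simp
  finally show ?thesis by (simp add: abel_density_def)
qed

lemma has_density_trapezoid:
  assumes "a \<le> x" "x < y" "y + h \<le> b" "h > 0"
  shows "has_density a b (trapezoid 0 x y h) 0 (trapezoid_slope x y h)"
proof -
  have g: "integrable lborel (trapezoid_slope x y h)"
    unfolding trapezoid_slope_def using assms
    by (intro integrable_divide_zero Bochner_Integration.integrable_diff) auto
  have g0: "trapezoid_slope x y h \<theta> = 0" if "\<theta> \<notin> {a..b}" for \<theta>
    using that assms by (auto simp: trapezoid_slope_def split: split_indicator)
  define v where "v = (\<lambda>t. 0 + (LINT t:{a..t}|lborel. trapezoid_slope x y h t))"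
  have d: "has_density a b v 0 (trapezoid_slope x y h)"
    using g g0 by (auto simp: has_density_def v_def)
  have "v t = trapezoid 0 x y h t" if t: "t \<in> {a..b}" for t
  proof (cases "t = a")
    case True
    have "AE \<theta> in lborel. indicator {a..a} \<theta> *\<^sub>R trapezoid_slope x y h \<theta> = 0"
      using AE_lborel_singleton[of a] by eventually_elim (auto split: split_indicator)
    then have "v a = 0" unfolding v_def set_lebesgue_integral_def by (simp add: integral_eq_zero_AE)
    moreover have "trapezoid 0 x y h a = 0" using assms by (simp add: trapezoid_def powr_ramp_def)
    ultimately show ?thesis using True by simp
  next
    case False
    then show ?thesis
      using abel_density_0[OF d, of t] t assms abel_density_trapezoid[of 0 a x y h t] by auto
  qed
  with d show ?thesis by (auto simp: has_density_def)
qed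

text \<open>
  The indefinite integral of \<open>(\<theta>-c)\<^sup>\<alpha>\<^sup>-\<^sup>1\<close> is, up to a factor, \<open>(t-c)\<^sup>\<alpha>\<close>, an absolutely continuous function
  whose derivative of order \<open>\<alpha>\<close> is constant to the right of \<open>c\<close> and jumps there. The substitution
  \<open>\<theta> = c + (t-c)y\<close> makes the integral independent of \<open>t\<close>, namely a Beta integral.
\<close>

lemma
  fixes \<alpha> a c t b :: real
  assumes \<alpha>: "0 < \<alpha>" "\<alpha> < 1" and ac: "a \<le> c" and tb: "t \<le> b"
  shows abel_jump_integrable: "set_integrable lborel {a<..<t}
      (\<lambda>\<theta>. (t - \<theta>) powr (-\<alpha>) * (indicator {c<..b} \<theta> * (\<theta> - c) powr (\<alpha> - 1)))"
    and abel_jump_integral: "(LINT \<theta>:{a<..<t}|lborel. (t - \<theta>) powr (-\<alpha>) * (indicator {c<..b} \<theta> * (\<theta> - c) powr (\<alpha> - 1)))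
      = (if c < t then Beta \<alpha> (1 - \<alpha>) else 0)"
proof -
  let ?f = "\<lambda>y :: real. y powr (\<alpha> - 1) * (1 - y) powr (-\<alpha>)"
  have B: "(?f has_integral Beta \<alpha> (1 - \<alpha>)) {0..1}"
    using has_integral_Beta_real[of \<alpha> "1 - \<alpha>"] \<alpha> by simp
  then have "?f absolutely_integrable_on {0..1}"
    by (intro nonnegative_absolutely_integrable_1) (auto simp: integrable_on_def)
  then have "set_integrable lborel {0..1} ?f"
    unfolding set_integrable_def by (subst (asm) integrable_completion) auto
  then have f01: "set_integrable lborel {0<..<1} ?f" by (rule set_integrable_subset) auto
  have "(LINT y:{0<..<1}|lborel. ?f y) = integral {0<..<1} ?f"
    by (rule set_borel_integral_eq_integral[OF f01])
  also have "\<dots> = Beta \<alpha> (1 - \<alpha>)"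
    using B by (simp add: integral_open_interval_real[symmetric] integral_unique)
  finally have E: "(\<integral>y. indicator {0<..<1} y *\<^sub>R ?f y \<partial>lborel) = Beta \<alpha> (1 - \<alpha>)"
    by (simp add: set_lebesgue_integral_def)
  have I: "integrable lborel (\<lambda>y. indicator {0<..<1} y *\<^sub>R ?f y)"
    using f01 by (simp add: set_integrable_def)
  let ?F = "\<lambda>\<theta>. indicator {a<..<t} \<theta> *\<^sub>R ((t - \<theta>) powr (-\<alpha>) * (indicator {c<..b} \<theta> * (\<theta> - c) powr (\<alpha> - 1)))"
  have "integrable lborel ?F \<and> integral\<^sup>L lborel ?F = (if c < t then Beta \<alpha> (1 - \<alpha>) else 0)"
  proof (cases "c < t")
    case True
    define r where "r = t - c"
    have r: "r > 0" using True by (simp add: r_def)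
    have eq: "?F (c + r * y) = (1 / r) * (indicator {0<..<1} y *\<^sub>R ?f y)" for y
    proof (cases "y \<in> {0<..<1}")
      case True
      then have y: "0 < y" "y < 1" by auto
      have 1: "c + r * y < t"
      proof -
        have "r * y < r" using y r by simp
        moreover have "c + r = t" by (simp add: r_def)
        ultimately show ?thesis by linarith
      qed
      have 2: "t - (c + r * y) = r * (1 - y)" by (simp add: r_def algebra_simps)
      have 3: "a < c + r * y" "c < c + r * y" "c + r * y \<le> b"
        using mult_pos_pos[OF r y(1)] ac 1 tb by linarith+
      have "?F (c + r * y) = (r * (1 - y)) powr (-\<alpha>) * (r * y) powr (\<alpha> - 1)"
        using 1 3 by (simp add: 2)
      also have "\<dots> = (r powr (-\<alpha>) * r powr (\<alpha> - 1)) * ?f y"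
        using r y by (simp add: powr_mult)
      also have "r powr (-\<alpha>) * r powr (\<alpha> - 1) = 1 / r"
      proof -
        have "r powr (-\<alpha>) * r powr (\<alpha> - 1) = r powr (-\<alpha> + (\<alpha> - 1))" by (rule powr_add[symmetric])
        also have "-\<alpha> + (\<alpha> - 1) = -1" by simp
        also have "r powr -1 = 1 / r" using r by (simp add: powr_neg_one)
        finally show ?thesis .
      qed
      finally show ?thesis using True by simp
    next
      case False
      then have "\<not> (c < c + r * y \<and> c + r * y < t)"
      proof -
        have "c + r = t" by (simp add: r_def)
        moreover have "r * y \<le> 0 \<or> r \<le> r * y"
          using False r by (auto simp: mult_le_0_iff)
        ultimately show ?thesis by linarith
      qed
      then show ?thesis using False by (auto split: split_indicator)
    qed
    have 1: "integrable lborel (\<lambda>y. ?F (c + r * y))" unfolding eq using I by simp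
    have "integrable lborel ?F"
      using lborel_integrable_real_affine_iff[of r ?F c] 1 r by simp
    moreover have "integral\<^sup>L lborel ?F = \<bar>r\<bar> *\<^sub>R (\<integral>y. ?F (c + r * y) \<partial>lborel)"
      using r by (intro lborel_integral_real_affine) auto
    then have "integral\<^sup>L lborel ?F = Beta \<alpha> (1 - \<alpha>)"
      unfolding eq using E r by simp
    ultimately show ?thesis using True by simp
  next
    case False
    then have "?F = (\<lambda>\<theta>. 0)" by (auto simp: fun_eq_iff split: split_indicator)
    then show ?thesis using False by simp
  qed
  then show "set_integrable lborel {a<..<t}
      (\<lambda>\<theta>. (t - \<theta>) powr (-\<alpha>) * (indicator {c<..b} \<theta> * (\<theta> - c) powr (\<alpha> - 1)))"
    "(LINT \<theta>:{a<..<t}|lborel. (t - \<theta>) powr (-\<alpha>) * (indicator {c<..b} \<theta> * (\<theta> - c) powr (\<alpha> - 1)))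
      = (if c < t then Beta \<alpha> (1 - \<alpha>) else 0)"
    by (simp_all add: set_integrable_def set_lebesgue_integral_def)
qed

section \<open>Partial derivatives of the Lagrangian\<close>

lemma C1_on_curve_derivative:
  assumes "C1_on L S"
  shows "\<exists>f' :: real \<times> real \<times> real \<Rightarrow> ((real \<times> real \<times> real) \<Rightarrow>\<^sub>L real). continuous_on S f' \<and>
    (\<forall>t s p h k x. (t, s + x * h, p + x * k) \<in> S \<longrightarrow>
      ((\<lambda>x. L (t, s + x * h, p + x * k)) has_real_derivative
        (blinfun_apply (f' (t, s + x * h, p + x * k)) (0, 1, 0) * h
         + blinfun_apply (f' (t, s + x * h, p + x * k)) (0, 0, 1) * k)) (at x))"
proof -
  from assms obtain f' where D: "\<And>z. z \<in> S \<Longrightarrow> (L has_derivative blinfun_apply (f' z)) (at z)"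
    and C: "continuous_on S f'" unfolding C1_on_def by blast
  have "((\<lambda>x. L (t, s + x * h, p + x * k)) has_real_derivative
        (blinfun_apply (f' (t, s + x * h, p + x * k)) (0, 1, 0) * h
         + blinfun_apply (f' (t, s + x * h, p + x * k)) (0, 0, 1) * k)) (at x)"
    if z: "(t, s + x * h, p + x * k) \<in> S" for t s p h k x
  proof -
    let ?c = "\<lambda>x. (t, s + x * h, p + x * k)"
    have c: "(?c has_derivative (\<lambda>e. (0, e * h, e * k))) (at x)"
      by (auto intro!: derivative_eq_intros)
    have "(L has_derivative blinfun_apply (f' (?c x))) (at (?c x))" by (rule D[OF z])
    from has_derivative_compose[OF c this]
    have H: "((\<lambda>x. L (?c x)) has_derivative (\<lambda>e. blinfun_apply (f' (?c x)) (0, e * h, e * k))) (at x)" .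
    have eq: "blinfun_apply (f' (?c x)) (0, e * h, e * k)
      = (blinfun_apply (f' (?c x)) (0, 1, 0) * h + blinfun_apply (f' (?c x)) (0, 0, 1) * k) * e" for e
    proof -
      have "(0, e * h, e * k) = (e * h) *\<^sub>R (0, 1, 0) + (e * k) *\<^sub>R (0 :: real, 0 :: real, 1 :: real)" by simp
      then show ?thesis
        by (simp only: blinfun.add_right blinfun.scaleR_right) (simp add: algebra_simps)
    qed
    show ?thesis using H unfolding has_field_derivative_def eq .
  qed
  with C show ?thesis by blast
qed

lemma
  fixes L :: "real \<times> real \<times> real \<Rightarrow> real"
  assumes C1: "C1_on L ({a<..<b} \<times> UNIV \<times> UNIV)"
  shows continuous_on_partial2: "continuous_on ({a<..<b} \<times> UNIV \<times> UNIV) (partial2 L)"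
    and continuous_on_partial3: "continuous_on ({a<..<b} \<times> UNIV \<times> UNIV) (partial3 L)"
    and DERIV_partial2: "t \<in> {a<..<b} \<Longrightarrow> ((\<lambda>s. L (t, s, p)) has_real_derivative partial2 L (t, s, p)) (at s)"
    and DERIV_partial3: "t \<in> {a<..<b} \<Longrightarrow> ((\<lambda>p. L (t, s, p)) has_real_derivative partial3 L (t, s, p)) (at p)"
    and DERIV_partial23: "t \<in> {a<..<b} \<Longrightarrow> ((\<lambda>x. L (t, s + x * h, p + x * k)) has_real_derivative
       partial2 L (t, s, p) * h + partial3 L (t, s, p) * k) (at 0)"
proof -
  let ?S = "{a<..<b} \<times> (UNIV :: real set) \<times> (UNIV :: real set)"
  obtain f' :: "real \<times> real \<times> real \<Rightarrow> ((real \<times> real \<times> real) \<Rightarrow>\<^sub>L real)"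
    where C: "continuous_on ?S f'" and D': "\<forall>t s p h k x. (t, s + x * h, p + x * k) \<in> ?S \<longrightarrow>
      ((\<lambda>x. L (t, s + x * h, p + x * k)) has_real_derivative
        (blinfun_apply (f' (t, s + x * h, p + x * k)) (0, 1, 0) * h
         + blinfun_apply (f' (t, s + x * h, p + x * k)) (0, 0, 1) * k)) (at x)"
    using C1_on_curve_derivative[OF C1] by blast
  note D = D'[rule_format]
  have D2: "((\<lambda>s. L (t, s, p)) has_real_derivative blinfun_apply (f' (t, s, p)) (0, 1, 0)) (at s)"
    if "t \<in> {a<..<b}" for t s p using D[of t 0 s 1 p 0] that by simp
  have D3: "((\<lambda>p. L (t, s, p)) has_real_derivative blinfun_apply (f' (t, s, p)) (0, 0, 1)) (at p)"
    if "t \<in> {a<..<b}" for t s p using D[of t s p 0 0 1] that by simp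
  have p2: "partial2 L z = blinfun_apply (f' z) (0, 1, 0)" if "z \<in> ?S" for z
    using DERIV_imp_deriv[OF D2] that by (auto simp: partial2_def)
  have p3: "partial3 L z = blinfun_apply (f' z) (0, 0, 1)" if "z \<in> ?S" for z
    using DERIV_imp_deriv[OF D3] that by (auto simp: partial3_def)
  have "continuous_on ?S (\<lambda>z. blinfun_apply (f' z) (0, 1, 0))"
    by (intro continuous_intros C)
  then show "continuous_on ?S (partial2 L)"
    by (rule continuous_on_eq) (simp only: p2)
  have "continuous_on ?S (\<lambda>z. blinfun_apply (f' z) (0, 0, 1))"
    by (intro continuous_intros C)
  then show "continuous_on ?S (partial3 L)"
    by (rule continuous_on_eq) (simp only: p3)
  show "((\<lambda>s. L (t, s, p)) has_real_derivative partial2 L (t, s, p)) (at s)"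
    if "t \<in> {a<..<b}" using D2[OF that] p2 that by simp
  show "((\<lambda>p. L (t, s, p)) has_real_derivative partial3 L (t, s, p)) (at p)"
    if "t \<in> {a<..<b}" using D3[OF that] p3 that by simp
  show "((\<lambda>x. L (t, s + x * h, p + x * k)) has_real_derivative
       partial2 L (t, s, p) * h + partial3 L (t, s, p) * k) (at 0)"
    if "t \<in> {a<..<b}" using D[of t s 0 h p k] p2 p3 that by simp
qed

lemma C1_on_imp_continuous_on: "C1_on L S \<Longrightarrow> continuous_on S L"
  unfolding C1_on_def by (meson has_derivative_continuous continuous_at_imp_continuous_on)

lemma AE_eq_0_continuous_on:
  fixes f :: "real \<Rightarrow> real"
  assumes f: "continuous_on {p..q} f" and pq: "p < q" and ae: "AE t\<in>{p<..<q} in lebesgue. f t = 0"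
    and t: "t \<in> {p..q}"
  shows "f t = 0"
proof -
  define U where "U = {t \<in> {p<..<q}. f t \<noteq> 0}"
  have "continuous_on {p<..<q} f" by (rule continuous_on_subset[OF f]) auto
  then have "open ({p<..<q} \<inter> f -` (- {0}))" by (intro continuous_open_preimage) auto
  also have "{p<..<q} \<inter> f -` (- {0}) = U" by (auto simp: U_def)
  finally have "open U" .
  have "AE t in lebesgue. t \<notin> U" using ae by eventually_elim (auto simp: U_def)
  then have "negligible U"
    by (simp add: negligible_iff_null_sets completion.null_sets_iff_AE)
  then have "U = {}" using \<open>open U\<close> open_not_negligible by blast
  then have "f s = 0" if "s \<in> {p<..<q}" for s using that by (auto simp: U_def)
  moreover have "closure {p<..<q} = {p..q}" using pq by (rule closure_greaterThanLessThan)
  ultimately show ?thesis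
    using continuous_constant_on_closure[of "{p<..<q}" f 0 t] f t by auto
qed

section \<open>The Lagrangian is affine in the fractional derivative of positive order\<close>

lemma abel_density_jump_function:
  fixes \<alpha> a b c x0 y z t :: real
  assumes \<alpha>: "0 < \<alpha>" "\<alpha> < 1" and ac: "a < c" and t: "a < t" "t \<le> b"
  shows "abel_density \<alpha> a x0 (\<lambda>\<theta>. y * indicator {a<..b} \<theta> + z * (indicator {c<..b} \<theta> * (\<theta> - c) powr (\<alpha> - 1))) t
    = (x0 * (t - a) powr (-\<alpha>) + y * ((t - a) powr (1 - \<alpha>) / (1 - \<alpha>)))
      + (if c < t then z * Beta \<alpha> (1 - \<alpha>) else 0)"
proof -
  let ?p = "\<lambda>\<theta>. (t - \<theta>) powr (-\<alpha>)" and ?j = "\<lambda>\<theta>. indicator {c<..b} \<theta> * (\<theta> - c) powr (\<alpha> - 1)"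
  have ab: "a \<le> b" "a \<le> c" using t ac by auto
  note I1 = abel_interval_integrable[OF \<alpha>(2) order_refl ab(1), of t]
  note E1 = abel_interval_integral[OF \<alpha>(2) order_refl ab(1), of t]
  note I2 = abel_jump_integrable[OF \<alpha> ab(2) t(2)] and E2 = abel_jump_integral[OF \<alpha> ab(2) t(2)]
  have "(LINT \<theta>:{a<..<t}|lborel. ?p \<theta> * (y * indicator {a<..b} \<theta> + z * ?j \<theta>))
    = (LINT \<theta>:{a<..<t}|lborel. y * (?p \<theta> * indicator {a<..b} \<theta>) + z * (?p \<theta> * ?j \<theta>))"
    by (simp only: algebra_simps)
  also have "\<dots> = (LINT \<theta>:{a<..<t}|lborel. y * (?p \<theta> * indicator {a<..b} \<theta>)) + (LINT \<theta>:{a<..<t}|lborel. z * (?p \<theta> * ?j \<theta>))"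
    by (rule set_integral_add(2)) (use I1 I2 in auto)
  also have "\<dots> = y * (powr_ramp \<alpha> (t - a) - powr_ramp \<alpha> (t - b)) + z * (if c < t then Beta \<alpha> (1 - \<alpha>) else 0)"
    by (simp only: set_integral_mult_right E1 E2)
  finally show ?thesis using t by (simp add: abel_density_def powr_ramp_def)
qed

lemma integrable_jump_function:
  fixes \<alpha> a b c y z :: real
  assumes \<alpha>: "0 < \<alpha>"
  shows "integrable lborel (\<lambda>\<theta>. y * indicator {a<..b} \<theta> + z * (indicator {c<..b} \<theta> * (\<theta> - c) powr (\<alpha> - 1)))"
proof -
  have "integrable lborel (\<lambda>y. indicator {0<..<b - c + 1} y * y powr (- (1 - \<alpha>)))"
    by (rule integrable_powr_kernel) (use \<alpha> in simp)
  from lborel_integrable_real_affine[OF this, of 1 "- c"]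
  have "integrable lborel (\<lambda>\<theta>. indicator {0<..<b - c + 1} (\<theta> - c) * (\<theta> - c) powr (\<alpha> - 1))"
    by (simp add: algebra_simps)
  from integrable_mult_indicator[OF _ this, of "{c<..b}"]
  have "integrable lborel (\<lambda>\<theta>. indicator {c<..b} \<theta> *\<^sub>R (indicator {0<..<b - c + 1} (\<theta> - c) * (\<theta> - c) powr (\<alpha> - 1)))"
    by simp
  also have "(\<lambda>\<theta>. indicator {c<..b} \<theta> *\<^sub>R (indicator {0<..<b - c + 1} (\<theta> - c) * (\<theta> - c) powr (\<alpha> - 1)))
    = (\<lambda>\<theta>. indicator {c<..b} \<theta> * (\<theta> - c) powr (\<alpha> - 1))"
    by (auto simp: fun_eq_iff split: split_indicator)
  finally have 1: "integrable lborel (\<lambda>\<theta>. indicator {c<..b} \<theta> * (\<theta> - c) powr (\<alpha> - 1))" .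
  have 2: "integrable lborel (\<lambda>\<theta>. indicator {a<..b} \<theta> :: real)"
    by (cases "a \<le> b") auto
  show ?thesis
    by (intro Bochner_Integration.integrable_add integrable_mult_right 1 2)
qed

text \<open>
  The test function \<open>v\<close> is a combination of \<open>1\<close>, \<open>t - a\<close> and \<open>(t-c)\<^sup>\<alpha>\<close> for \<open>t > c\<close>. The first two, whose
  derivatives of order \<open>\<alpha>\<close> are continuous at \<open>c\<close>, prescribe \<open>v(c) = s\<close> and the limit \<open>p\<close> of the derivative
  from the left; these two linear conditions are independent because \<open>\<alpha> \<noteq> 0\<close>. The third does not change
  \<open>v(c)\<close> and lifts the limit from the right to \<open>q\<close>. A continuous version of \<open>\<partial>\<^sub>3L\<close> along \<open>v\<close> must
  match both limits at \<open>c\<close>.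
\<close>

lemma partial3_independent:
  fixes L :: "real \<times> real \<times> real \<Rightarrow> real"
  assumes \<alpha>: "0 < \<alpha>" "\<alpha> < 1" and C1: "C1_on L ({a<..<b} \<times> UNIV \<times> UNIV)"
    and reg: "\<forall>v\<in>AC a b. \<exists>H. AC_version a b (\<lambda>t. partial3 L (jet \<alpha> a v t)) H"
    and c: "c \<in> {a<..<b}"
  shows "partial3 L (c, s, p) = partial3 L (c, s, q)"
proof -
  have ab: "a < b" and ac: "a < c" and cb: "c < b" using c by auto
  define \<Gamma> where "\<Gamma> = Gamma (1 - \<alpha>)"
  define \<beta> where "\<beta> = Beta \<alpha> (1 - \<alpha>)"
  have \<Gamma>: "\<Gamma> > 0" and \<beta>: "\<beta> > 0"
    unfolding \<Gamma>_def \<beta>_def Beta_def using \<alpha> by (simp_all add: Gamma_real_pos)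
  define r where "r = c - a"
  have r: "r > 0" using ac by (simp add: r_def)
  \<comment> \<open>\<open>x0\<close> and \<open>y\<close> solve \<open>x0 + y r = s\<close> and \<open>x0 + y r / (1 - \<alpha>) = p \<Gamma> r\<^sup>\<alpha>\<close>\<close>
  define y where "y = (p * \<Gamma> * r powr \<alpha> - s) * (1 - \<alpha>) / (\<alpha> * r)"
  define x0 where "x0 = s - y * r"
  define z where "z = (q - p) * \<Gamma> / \<beta>"
  define g where "g = (\<lambda>\<theta>. y * indicator {a<..b} \<theta> + z * (indicator {c<..b} \<theta> * (\<theta> - c) powr (\<alpha> - 1)))"
  define v where "v = (\<lambda>t. x0 + (LINT \<theta>:{a..t}|lborel. g \<theta>))"
  define E where "E = (\<lambda>t. x0 * (t - a) powr (-\<alpha>) + y * ((t - a) powr (1 - \<alpha>) / (1 - \<alpha>)))"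
  have gint: "integrable lborel g" unfolding g_def by (rule integrable_jump_function[OF \<alpha>(1)])
  have d: "has_density a b v x0 g"
    using gint ac unfolding has_density_def by (auto simp: v_def g_def split: split_indicator)
  have vAC: "v \<in> AC a b" by (rule has_density_imp_AC[OF d])
  have vcont: "continuous_on {a..b} v" by (rule AC_imp_continuous_on[OF vAC])
  have vc: "v c = s"
  proof -
    have "(LINT \<theta>:{a..c}|lborel. g \<theta>) = (\<integral>\<theta>. y * indicator {a<..c} \<theta> \<partial>lborel)"
      unfolding set_lebesgue_integral_def
      by (intro Bochner_Integration.integral_cong refl) (use cb in \<open>auto simp: g_def split: split_indicator\<close>)
    also have "\<dots> = y * r" using ac by (simp add: r_def)
    finally show ?thesis by (simp add: v_def x0_def)
  qed
  have Ec: "E c = p * \<Gamma>"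
  proof -
    have "y * r * \<alpha> / (1 - \<alpha>) = p * \<Gamma> * r powr \<alpha> - s"
      using \<alpha> r by (simp add: y_def)
    then have "x0 + y * r / (1 - \<alpha>) = p * \<Gamma> * r powr \<alpha>"
      using \<alpha> by (simp add: x0_def field_simps)
    moreover have "E c = (x0 + y * r / (1 - \<alpha>)) * r powr (-\<alpha>)"
    proof -
      have "r powr (1 - \<alpha>) = r powr 1 * r powr (-\<alpha>)" by (simp only: powr_add[symmetric]) simp
      then show ?thesis using r by (simp add: E_def r_def[symmetric] algebra_simps)
    qed
    moreover have "r powr \<alpha> * r powr (-\<alpha>) = 1" using r by (simp add: powr_add[symmetric])
    ultimately show ?thesis by (simp add: mult.assoc)
  qed
  have Econt: "continuous_on {a<..<b} E"
    unfolding E_def using \<alpha> by (auto intro!: continuous_intros)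
  have dens: "abel_density \<alpha> a x0 g t = E t + (if c < t then z * \<beta> else 0)" if "t \<in> {a<..<b}" for t
    using abel_density_jump_function[OF \<alpha> ac, of t b x0 y z] that unfolding g_def E_def \<beta>_def by simp
  have RL: "AE t\<in>{a<..<b} in lebesgue. left_RL \<alpha> a v t = (E t + (if c < t then z * \<beta> else 0)) / \<Gamma>"
    using AE_left_abel_derivative[OF \<alpha>(2) ab d]
  proof eventually_elim
    case (elim t)
    then show ?case using left_RL_eqI[OF \<alpha>(2)] dens[of t] unfolding \<Gamma>_def by auto
  qed
  obtain H where H: "H \<in> AC a b" and HA: "AE t\<in>{a<..<b} in lebesgue. H t = partial3 L (jet \<alpha> a v t)"
    using reg vAC unfolding AC_version_def by blast
  have lim: "H c = partial3 L (c, s, (E c + k) / \<Gamma>)"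
    if lu: "a < l" "l < u" "u < b" "c \<in> {l..u}"
      and k: "\<And>t. t \<in> {l<..<u} \<Longrightarrow> (if c < t then z * \<beta> else 0) = k" for l u k
  proof -
    let ?f = "\<lambda>t. H t - partial3 L (t, v t, (E t + k) / \<Gamma>)"
    have sub: "{l..u} \<subseteq> {a<..<b}" using lu by auto
    have 1: "continuous_on {l..u} (\<lambda>t. (t, v t, (E t + k) / \<Gamma>))"
      using \<Gamma> sub by (intro continuous_intros continuous_on_subset[OF vcont] continuous_on_subset[OF Econt]) auto
    have 2: "(\<lambda>t. (t, v t, (E t + k) / \<Gamma>)) ` {l..u} \<subseteq> {a<..<b} \<times> UNIV \<times> UNIV"
      using sub by auto
    have "continuous_on {l..u} (\<lambda>t. partial3 L (t, v t, (E t + k) / \<Gamma>))"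
      by (rule continuous_on_compose2[OF continuous_on_partial3[OF C1] 1 2])
    then have fc: "continuous_on {l..u} ?f"
      using sub by (intro continuous_on_diff continuous_on_subset[OF AC_imp_continuous_on[OF H]]) auto
    have "AE t\<in>{l<..<u} in lebesgue. ?f t = 0"
      using HA RL
    proof eventually_elim
      case (elim t)
      show ?case
      proof
        assume t: "t \<in> {l<..<u}"
        then have "t \<in> {a<..<b}" using lu by auto
        with elim k[OF t] show "?f t = 0" by (simp add: jet_def)
      qed
    qed
    from AE_eq_0_continuous_on[OF fc lu(2) this lu(4)] show ?thesis by (simp add: vc)
  qed
  have "H c = partial3 L (c, s, (E c + 0) / \<Gamma>)"
    by (rule lim[of "(a + c) / 2" c]) (use ac cb in auto)
  moreover have "H c = partial3 L (c, s, (E c + z * \<beta>) / \<Gamma>)"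
    by (rule lim[of c "(c + b) / 2"]) (use ac cb in auto)
  ultimately have "partial3 L (c, s, (E c + 0) / \<Gamma>) = partial3 L (c, s, (E c + z * \<beta>) / \<Gamma>)" by simp
  moreover have "(E c + 0) / \<Gamma> = p" using \<Gamma> Ec by simp
  moreover have "(E c + z * \<beta>) / \<Gamma> = q" using \<Gamma> \<beta> Ec by (simp add: z_def field_simps)
  ultimately show ?thesis by simp
qed

lemma affine_if_partial3_independent:
  fixes L :: "real \<times> real \<times> real \<Rightarrow> real"
  assumes C1: "C1_on L ({a<..<b} \<times> UNIV \<times> UNIV)"
    and ind: "\<And>s p q. partial3 L (t, s, p) = partial3 L (t, s, q)" and t: "t \<in> {a<..<b}"
  shows "L (t, s, p + k) = L (t, s, p) + k * partial3 L (t, s, p)"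
proof -
  have "((\<lambda>x. L (t, s, x) - partial3 L (t, s, p) * x) has_real_derivative 0) (at x)" for x
  proof -
    have "((\<lambda>x. L (t, s, x)) has_real_derivative partial3 L (t, s, x)) (at x)"
      by (rule DERIV_partial3[OF C1 t])
    then have "((\<lambda>x. L (t, s, x) - partial3 L (t, s, p) * x) has_real_derivative
        partial3 L (t, s, x) - partial3 L (t, s, p) * 1) (at x)"
      by (intro DERIV_diff DERIV_cmult DERIV_ident)
    then show ?thesis using ind[of s x p] by simp
  qed
  then have "L (t, s, p + k) - partial3 L (t, s, p) * (p + k) = L (t, s, p) - partial3 L (t, s, p) * p"
    by (intro DERIV_isconst_all) auto
  then show ?thesis by (simp add: algebra_simps)
qed

section \<open>The weak Euler-Lagrange equation\<close>

lemma continuous_on_Icc_bounded: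
  fixes f :: "real \<Rightarrow> real"
  assumes "continuous_on {a..b} f"
  shows "\<exists>M\<ge>0. \<forall>t\<in>{a..b}. \<bar>f t\<bar> \<le> M"
proof -
  have "bounded (f ` {a..b})"
    using compact_continuous_image[OF assms] compact_imp_bounded by blast
  then obtain M where "\<forall>t\<in>{a..b}. \<bar>f t\<bar> \<le> M" by (auto simp: bounded_iff)
  then show ?thesis by (intro exI[of _ "\<bar>M\<bar>"]) force
qed

lemma borel_measurable_lebesgue_AE_cong:
  fixes f g :: "real \<Rightarrow> real"
  assumes f: "f \<in> borel_measurable lebesgue" and ae: "AE x in lebesgue. f x = g x"
  shows "g \<in> borel_measurable lebesgue"
proof (rule measurableI)
  fix A :: "real set" assume "A \<in> sets borel"
  then have A: "f -` A \<inter> space lebesgue \<in> sets lebesgue" using f by (rule measurable_sets[rotated])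
  have ae': "AE x in lebesgue. x \<in> f -` A \<inter> space lebesgue \<longleftrightarrow> x \<in> g -` A \<inter> space lebesgue"
    using ae by eventually_elim auto
  show "g -` A \<inter> space lebesgue \<in> sets lebesgue"
    by (rule completion.in_sets_AE[OF ae' A]) simp
qed simp

text \<open>
  The jet agrees almost everywhere with a Borel function, and the Lebesgue measure is complete.
\<close>

lemma borel_measurable_jet:
  fixes \<Phi> :: "real \<times> real \<times> real \<Rightarrow> real"
  assumes \<alpha>: "\<alpha> < 1" and \<Phi>: "continuous_on ({a<..<b} \<times> UNIV \<times> UNIV) \<Phi>" and v: "v \<in> AC a b"
    and AB: "a \<le> A" "A < B" "B \<le> b"
  shows "(\<lambda>t. indicator {A<..<B} t * \<Phi> (jet \<alpha> a v t)) \<in> borel_measurable lebesgue"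
proof -
  let ?S = "{a<..<b} \<times> (UNIV :: real set) \<times> (UNIV :: real set)"
  have ab: "a < b" using AB by simp
  obtain \<phi> where \<phi>: "integrable lborel \<phi>" and ae: "AE t\<in>{a<..<b} in lebesgue. left_RL \<alpha> a v t = \<phi> t"
    using AE_left_RL_integrable[OF \<alpha> ab v] by blast
  have [measurable]: "\<phi> \<in> borel_measurable borel" using \<phi> by (auto dest: borel_measurable_integrable)
  define v' where "v' = (\<lambda>t. indicator {a..b} t *\<^sub>R v t)"
  have [measurable]: "v' \<in> borel_measurable borel"
    unfolding v'_def by (rule borel_measurable_continuous_on_indicator[OF _ AC_imp_continuous_on[OF v]]) simp
  define \<Psi> where "\<Psi> = (\<lambda>z. indicator ?S z *\<^sub>R \<Phi> z)"
  have "open ?S" by (intro open_Times) auto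
  then have [measurable]: "\<Psi> \<in> borel_measurable borel"
    unfolding \<Psi>_def by (intro borel_measurable_continuous_on_indicator \<Phi>) auto
  have [measurable]: "(\<lambda>t. (t, v' t, \<phi> t)) \<in> borel_measurable borel"
    by (intro borel_measurable_Pair) measurable
  have "(\<lambda>t. \<Psi> (t, v' t, \<phi> t)) \<in> borel_measurable borel"
    by (rule measurable_compose[of "\<lambda>t. (t, v' t, \<phi> t)" _ borel]) measurable
  then have "(\<lambda>t. indicator {A<..<B} t * \<Psi> (t, v' t, \<phi> t)) \<in> borel_measurable borel"
    by measurable
  then have "(\<lambda>t. indicator {A<..<B} t * \<Psi> (t, v' t, \<phi> t)) \<in> borel_measurable lebesgue"
    by (intro measurable_completion) simp
  then show ?thesis
  proof (rule borel_measurable_lebesgue_AE_cong)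
    show "AE t in lebesgue. indicator {A<..<B} t * \<Psi> (t, v' t, \<phi> t) = indicator {A<..<B} t * \<Phi> (jet \<alpha> a v t)"
      using ae by eventually_elim (use AB in \<open>auto simp: \<Psi>_def v'_def jet_def split: split_indicator\<close>)
  qed
qed

lemma C1_difference_bound_box:
  fixes L :: "real \<times> real \<times> real \<Rightarrow> real"
  assumes C1: "C1_on L ({a<..<b} \<times> UNIV \<times> UNIV)" and cd: "a < c" "d < b"
  shows "\<exists>C\<ge>0. \<forall>t\<in>{c..d}. \<forall>s0\<in>{-R..R}. \<forall>s1\<in>{-R..R}. \<forall>p0\<in>{-R..R}. \<forall>p1\<in>{-R..R}.
           \<bar>L (t, s1, p1) - L (t, s0, p0)\<bar> \<le> C * (\<bar>p1 - p0\<bar> + \<bar>s1 - s0\<bar>)"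
proof -
  let ?K = "{c..d} \<times> {-R..R} \<times> {-R..R}"
  have sub: "?K \<subseteq> {a<..<b} \<times> UNIV \<times> UNIV" using cd by auto
  have "compact ?K" by (intro compact_Times) auto
  then have "bounded (partial2 L ` ?K)" "bounded (partial3 L ` ?K)"
    using continuous_on_subset[OF continuous_on_partial2[OF C1] sub]
      continuous_on_subset[OF continuous_on_partial3[OF C1] sub]
    by (auto intro: compact_imp_bounded compact_continuous_image)
  then obtain C2 C3 where C2: "\<And>z. z \<in> ?K \<Longrightarrow> \<bar>partial2 L z\<bar> \<le> C2" and C3: "\<And>z. z \<in> ?K \<Longrightarrow> \<bar>partial3 L z\<bar> \<le> C3"
    unfolding bounded_iff by (metis image_eqI real_norm_def)
  define C where "C = max 0 (max C2 C3)"
  have CK: "\<bar>partial2 L z\<bar> \<le> C" "\<bar>partial3 L z\<bar> \<le> C" if "z \<in> ?K" for z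
    using C2[OF that] C3[OF that] by (auto simp: C_def)
  have "\<bar>L (t, s1, p1) - L (t, s0, p0)\<bar> \<le> C * (\<bar>p1 - p0\<bar> + \<bar>s1 - s0\<bar>)"
    if t: "t \<in> {c..d}" and s: "s0 \<in> {-R..R}" "s1 \<in> {-R..R}" and p: "p0 \<in> {-R..R}" "p1 \<in> {-R..R}"
    for t s0 s1 p0 p1
  proof -
    have tab: "t \<in> {a<..<b}" using t cd by auto
    have 1: "norm (L (t, s1, p1) - L (t, s0, p1)) \<le> C * norm (s1 - s0)"
      by (rule field_differentiable_bound[of "{-R..R}" "\<lambda>s. L (t, s, p1)" "\<lambda>s. partial2 L (t, s, p1)"])
         (use s p t CK in \<open>auto intro!: has_field_derivative_at_within[OF DERIV_partial2[OF C1 tab]]\<close>)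
    have 2: "norm (L (t, s0, p1) - L (t, s0, p0)) \<le> C * norm (p1 - p0)"
      by (rule field_differentiable_bound[of "{-R..R}" "\<lambda>p. L (t, s0, p)" "\<lambda>p. partial3 L (t, s0, p)"])
         (use s p t CK in \<open>auto intro!: has_field_derivative_at_within[OF DERIV_partial3[OF C1 tab]]\<close>)
    show ?thesis using 1 2 by (simp add: distrib_left)
  qed
  then show ?thesis by (intro exI[of _ C]) (auto simp: C_def)
qed

text \<open>
  The slope of an affine function in \<open>p\<close> is the difference of its values at \<open>p = 1\<close> and \<open>p = 0\<close>, so that the
  bounds on a box that contains both values of \<open>p\<close> control all \<open>p\<close>.
\<close>

lemma C1_difference_bound_affine:
  fixes L :: "real \<times> real \<times> real \<Rightarrow> real"
  assumes C1: "C1_on L ({a<..<b} \<times> UNIV \<times> UNIV)" and cd: "a < c" "d < b"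
    and aff: "\<And>t s p k. t \<in> {a<..<b} \<Longrightarrow> L (t, s, p + k) = L (t, s, p) + k * partial3 L (t, s, p)"
  shows "\<exists>C\<ge>0. \<forall>t\<in>{c..d}. \<forall>s0\<in>{-R..R}. \<forall>s1\<in>{-R..R}. \<forall>p0 p1.
           \<bar>L (t, s1, p1) - L (t, s0, p0)\<bar> \<le> C * (\<bar>p1 - p0\<bar> + (1 + 2 * \<bar>p0\<bar>) * \<bar>s1 - s0\<bar>)"
proof -
  define R' where "R' = max 1 R"
  obtain C where C: "C \<ge> 0" and bd: "\<And>t s0 s1 p0 p1. \<lbrakk>t \<in> {c..d}; s0 \<in> {-R'..R'}; s1 \<in> {-R'..R'};
      p0 \<in> {-R'..R'}; p1 \<in> {-R'..R'}\<rbrakk> \<Longrightarrow> \<bar>L (t, s1, p1) - L (t, s0, p0)\<bar> \<le> C * (\<bar>p1 - p0\<bar> + \<bar>s1 - s0\<bar>)"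
    using C1_difference_bound_box[OF C1 cd, of R'] by blast
  have "\<bar>L (t, s1, p1) - L (t, s0, p0)\<bar> \<le> C * (\<bar>p1 - p0\<bar> + (1 + 2 * \<bar>p0\<bar>) * \<bar>s1 - s0\<bar>)"
    if t: "t \<in> {c..d}" and s: "s0 \<in> {-R..R}" "s1 \<in> {-R..R}" for t s0 s1 p0 p1
  proof -
    have tab: "t \<in> {a<..<b}" using t cd by auto
    have R: "0 \<in> {-R'..R'}" "1 \<in> {-R'..R'}" "s0 \<in> {-R'..R'}" "s1 \<in> {-R'..R'}"
      using s by (auto simp: R'_def)
    define N where "N = (\<lambda>s. partial3 L (t, s, 0))"
    have LN: "L (t, s, p) = L (t, s, 0) + p * N s" for s p
      using aff[OF tab, of s 0 p] by (simp add: N_def)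
    have N1: "N s = L (t, s, 1) - L (t, s, 0)" for s using LN[of s 1] by simp
    have a: "\<bar>L (t, s1, 0) - L (t, s0, 0)\<bar> \<le> C * \<bar>s1 - s0\<bar>"
      using bd[OF t R(3,4,1,1)] by simp
    have b: "\<bar>L (t, s1, 1) - L (t, s0, 1)\<bar> \<le> C * \<bar>s1 - s0\<bar>"
      using bd[OF t R(3,4,2,2)] by simp
    have n: "\<bar>N s1\<bar> \<le> C" using bd[OF t R(4,4,1,2)] by (simp add: N1)
    have dN: "\<bar>N s1 - N s0\<bar> \<le> 2 * (C * \<bar>s1 - s0\<bar>)" using a b by (simp add: N1)
    have "L (t, s1, p1) - L (t, s0, p0)
        = (L (t, s1, 0) - L (t, s0, 0)) + (p1 - p0) * N s1 + p0 * (N s1 - N s0)"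
      unfolding LN[of s1 p1] LN[of s0 p0] by (simp add: algebra_simps)
    also have "\<bar>\<dots>\<bar> \<le> \<bar>L (t, s1, 0) - L (t, s0, 0)\<bar> + \<bar>p1 - p0\<bar> * \<bar>N s1\<bar> + \<bar>p0\<bar> * \<bar>N s1 - N s0\<bar>"
      unfolding abs_mult[symmetric] by (intro order.trans[OF abs_triangle_ineq] add_mono order.refl abs_triangle_ineq)
    also have "\<dots> \<le> C * \<bar>s1 - s0\<bar> + \<bar>p1 - p0\<bar> * C + \<bar>p0\<bar> * (2 * (C * \<bar>s1 - s0\<bar>))"
      by (intro add_mono mult_left_mono a n dN) auto
    also have "\<dots> = C * (\<bar>p1 - p0\<bar> + (1 + 2 * \<bar>p0\<bar>) * \<bar>s1 - s0\<bar>)" by (simp add: algebra_simps)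
    finally show ?thesis .
  qed
  with C show ?thesis by blast
qed

text \<open>
  The quotients of the increments of the integrand converge almost everywhere and are dominated by a
  multiple of \<open>1 + \<bar>\<phi>\<bar>\<close>, where \<open>\<phi>\<close> is the fractional derivative of \<open>u\<close>. The domination shows both that
  the varied functions are admissible and that the limit passes under the integral. Increments of the
  action have one sign at an extremal, so that approaching \<open>0\<close> from both sides leaves only the value \<open>0\<close>.
\<close>

lemma weak_euler_lagrange:
  fixes L :: "real \<times> real \<times> real \<Rightarrow> real" and u G \<eta> g w :: "real \<Rightarrow> real"
  assumes \<alpha>: "0 \<le> \<alpha>" "\<alpha> < 1" and AB: "a \<le> A" "A < B" "B \<le> b"
    and C1: "C1_on L ({a<..<b} \<times> UNIV \<times> UNIV)"
    and reg: "\<forall>v\<in>AC a b. \<exists>H. AC_version a b (\<lambda>t. partial3 L (jet \<alpha> a v t)) H"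
    and ext: "extremal (action \<alpha> a A B L) (admissible \<alpha> a b A B L a0) u"
    and G: "AC_version a b (\<lambda>t. partial3 L (jet \<alpha> a u t)) G"
    and d\<eta>: "has_density a b \<eta> 0 g"
    and supp: "a < c" "d < b" "\<And>t. \<lbrakk>t \<in> {a..b}; t \<notin> {c..d}\<rbrakk> \<Longrightarrow> \<eta> t = 0"
    and w: "\<And>t. t \<in> {a<..<b} \<Longrightarrow> w t = abel_density \<alpha> a 0 g t / Gamma (1 - \<alpha>)"
    and wcont: "continuous_on {a..b} w"
  shows "(LINT t:{A<..<B}|lebesgue. partial2 L (jet \<alpha> a u t) * \<eta> t + G t * w t) = 0"
    and "set_integrable lebesgue {A<..<B} (\<lambda>t. partial2 L (jet \<alpha> a u t) * \<eta> t + G t * w t)"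
proof -
  have ab: "a < b" using AB by simp
  have sub: "t \<in> {a<..<b}" "t \<in> {a..b}" if "t \<in> {A<..<B}" for t using that AB by auto
  have uadm: "u \<in> admissible \<alpha> a b A B L a0"
    using ext by (auto simp: extremal_def is_arg_min_def is_arg_max_def)
  then have uAC: "u \<in> AC a b" and ua: "u a = a0"
    and uint: "set_integrable lebesgue {A<..<B} (\<lambda>t. L (jet \<alpha> a u t))"
    by (auto simp: admissible_def)
  have \<eta>AC: "\<eta> \<in> AC a b" by (rule has_density_imp_AC[OF d\<eta>])
  have \<eta>a: "\<eta> a = 0" using supp ab by auto
  have GAC: "G \<in> AC a b" and E3: "AE t\<in>{a<..<b} in lebesgue. G t = partial3 L (jet \<alpha> a u t)"
    using G by (auto simp: AC_version_def)
  obtain Mu where Mu: "\<And>t. t \<in> {a..b} \<Longrightarrow> \<bar>u t\<bar> \<le> Mu"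
    using continuous_on_Icc_bounded[OF AC_imp_continuous_on[OF uAC]] by blast
  obtain M\<eta> where M\<eta>: "\<And>t. t \<in> {a..b} \<Longrightarrow> \<bar>\<eta> t\<bar> \<le> M\<eta>" "M\<eta> \<ge> 0"
    using continuous_on_Icc_bounded[OF AC_imp_continuous_on[OF \<eta>AC]] by blast
  obtain MG where MG: "\<And>t. t \<in> {a..b} \<Longrightarrow> \<bar>G t\<bar> \<le> MG" "MG \<ge> 0"
    using continuous_on_Icc_bounded[OF AC_imp_continuous_on[OF GAC]] by blast
  obtain Mw where Mw: "\<And>t. t \<in> {a..b} \<Longrightarrow> \<bar>w t\<bar> \<le> Mw" "Mw \<ge> 0"
    using continuous_on_Icc_bounded[OF wcont] by blast
  obtain \<phi> where \<phi>: "integrable lborel \<phi>" and E1: "AE t\<in>{a<..<b} in lebesgue. left_RL \<alpha> a u t = \<phi> t"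
    using AE_left_RL_integrable[OF \<alpha>(2) ab uAC] by blast
  define V where "V = (\<lambda>\<epsilon> t. u t + \<epsilon> * \<eta> t)"
  have VAC: "V \<epsilon> \<in> AC a b" for \<epsilon> unfolding V_def by (rule AC_add_scaled[OF uAC \<eta>AC])
  have E2: "AE t\<in>{a<..<b} in lebesgue. \<forall>\<epsilon>. left_RL \<alpha> a (V \<epsilon>) t = left_RL \<alpha> a u t + \<epsilon> * w t"
    using AE_left_RL_variation[OF \<alpha>(2) ab uAC d\<eta>]
    by eventually_elim (auto simp: V_def w)
  \<comment> \<open>for \<open>\<alpha> = 0\<close> the third component of the jet is \<open>u\<close> itself and hence bounded\<close>
  have E4: "AE t\<in>{a<..<b} in lebesgue. \<alpha> = 0 \<longrightarrow> left_RL \<alpha> a u t = u t \<and> w t = \<eta> t"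
  proof (cases "\<alpha> = 0")
    case True
    obtain f where f: "has_density a b u (u a) f" using AC_has_density[OF uAC ab] by blast
    have z: "(0::real) < 1" by simp
    show ?thesis
      using AE_left_abel_derivative[OF z ab f]
    proof eventually_elim
      case (elim t)
      show ?case
      proof (intro impI)
        assume t: "t \<in> {a<..<b}"
        with elim have "(left_abel 0 a u has_real_derivative abel_density 0 a (u a) f t) (at t)" by blast
        from left_RL_eqI[OF z this] have "left_RL 0 a u t = u t"
          using abel_density_0[OF f] t by simp
        moreover have "w t = \<eta> t" using w[OF t] abel_density_0[OF d\<eta>] t True by simp
        ultimately show "left_RL \<alpha> a u t = u t \<and> w t = \<eta> t" using True by simp
      qed
    qed
  qed simp
  define R where "R = Mu + M\<eta>"
  \<comment> \<open>for \<open>\<alpha> > 0\<close> the regularity hypothesis forces \<open>L\<close> to be affine in \<open>p\<close>\<close>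
  have aff: "L (t, s, p + k) = L (t, s, p) + k * partial3 L (t, s, p)"
    if "\<alpha> \<noteq> 0" "t \<in> {a<..<b}" for t s p k
  proof (rule affine_if_partial3_independent[OF C1 _ that(2)])
    show "partial3 L (t, s, p) = partial3 L (t, s, q)" for s p q
      by (rule partial3_independent[OF _ \<alpha>(2) C1 reg that(2)]) (use \<alpha>(1) that(1) in simp)
  qed
  have "\<exists>C\<ge>0. \<forall>t\<in>{c..d}. \<forall>s0\<in>{-R..R}. \<forall>s1\<in>{-R..R}. \<forall>p0 p1.
      (\<alpha> \<noteq> 0 \<or> p0 \<in> {-R..R} \<and> p1 \<in> {-R..R}) \<longrightarrow>
      \<bar>L (t, s1, p1) - L (t, s0, p0)\<bar> \<le> C * (\<bar>p1 - p0\<bar> + (1 + 2 * \<bar>p0\<bar>) * \<bar>s1 - s0\<bar>)"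
  proof (cases "\<alpha> = 0")
    case True
    obtain C where C: "C \<ge> 0" "\<And>t s0 s1 p0 p1. \<lbrakk>t \<in> {c..d}; s0 \<in> {-R..R}; s1 \<in> {-R..R};
      p0 \<in> {-R..R}; p1 \<in> {-R..R}\<rbrakk> \<Longrightarrow> \<bar>L (t, s1, p1) - L (t, s0, p0)\<bar> \<le> C * (\<bar>p1 - p0\<bar> + \<bar>s1 - s0\<bar>)"
      using C1_difference_bound_box[OF C1 supp(1,2), of R] by blast
    have mono: "C * (\<bar>p1 - p0\<bar> + \<bar>s1 - s0\<bar>) \<le> C * (\<bar>p1 - p0\<bar> + (1 + 2 * \<bar>p0\<bar>) * \<bar>s1 - s0\<bar>)" for p0 p1 s0 s1
      by (intro mult_left_mono add_left_mono C(1)) (simp add: algebra_simps)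
    show ?thesis
      using C True by (intro exI[of _ C] conjI ballI allI impI) (blast intro: order.trans[OF _ mono])+
  next
    case False
    then show ?thesis using C1_difference_bound_affine[OF C1 supp(1,2) aff, of R] by blast
  qed
  then obtain C where C: "C \<ge> 0" and bd: "\<And>t s0 s1 p0 p1. \<lbrakk>t \<in> {c..d}; s0 \<in> {-R..R}; s1 \<in> {-R..R};
      \<alpha> \<noteq> 0 \<or> p0 \<in> {-R..R} \<and> p1 \<in> {-R..R}\<rbrakk> \<Longrightarrow>
      \<bar>L (t, s1, p1) - L (t, s0, p0)\<bar> \<le> C * (\<bar>p1 - p0\<bar> + (1 + 2 * \<bar>p0\<bar>) * \<bar>s1 - s0\<bar>)"
    by blast
  define K where "K = C * (Mw + 2 * M\<eta>) + Mw * MG"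
  have K: "K \<ge> 0" unfolding K_def using C M\<eta> Mw MG by simp
  define D where "D = (\<lambda>\<epsilon> t. L (jet \<alpha> a (V \<epsilon>) t) - L (jet \<alpha> a u t))"
  define h where "h = (\<lambda>t. K * (1 + \<bar>\<phi> t\<bar>))"
  \<comment> \<open>on the support of \<open>\<eta>\<close> by the local bound on \<open>L\<close>; off it the increment is \<open>\<epsilon> w G\<close> exactly\<close>
  have Dbound: "AE t\<in>{A<..<B} in lebesgue. \<forall>\<epsilon>. \<bar>\<epsilon>\<bar> \<le> 1 \<longrightarrow> \<bar>D \<epsilon> t\<bar> \<le> \<bar>\<epsilon>\<bar> * h t"
    using E1 E2 E3 E4
  proof eventually_elim
    case (elim t)
    show ?case
    proof (intro impI allI)
      fix \<epsilon> :: real assume t: "t \<in> {A<..<B}" and \<epsilon>: "\<bar>\<epsilon>\<bar> \<le> 1"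
      note tab = sub[OF t]
      have e1: "left_RL \<alpha> a u t = \<phi> t" and e2: "left_RL \<alpha> a (V \<epsilon>) t = \<phi> t + \<epsilon> * w t"
        and e3: "G t = partial3 L (t, u t, \<phi> t)"
        and e4: "\<alpha> = 0 \<Longrightarrow> \<phi> t = u t \<and> w t = \<eta> t"
        using elim tab(1) by (auto simp: jet_def)
      have D: "D \<epsilon> t = L (t, V \<epsilon> t, \<phi> t + \<epsilon> * w t) - L (t, u t, \<phi> t)"
        by (simp add: D_def jet_def e1 e2)
      show "\<bar>D \<epsilon> t\<bar> \<le> \<bar>\<epsilon>\<bar> * h t"
      proof (cases "t \<in> {c..d}")
        case True
        have \<epsilon>\<eta>: "\<bar>\<epsilon> * \<eta> t\<bar> \<le> \<bar>\<epsilon>\<bar> * M\<eta>" and \<epsilon>w: "\<bar>\<epsilon> * w t\<bar> \<le> \<bar>\<epsilon>\<bar> * Mw"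
          unfolding abs_mult using M\<eta>(1)[OF tab(2)] Mw(1)[OF tab(2)] by (auto intro: mult_left_mono)
        have "\<bar>\<epsilon>\<bar> * M\<eta> \<le> M\<eta>" using \<epsilon> M\<eta>(2) by (rule mult_left_le_one_le[rotated 2]) simp
        then have r: "u t \<in> {-R..R}" "V \<epsilon> t \<in> {-R..R}"
          using Mu[OF tab(2)] \<epsilon>\<eta> M\<eta>(2) by (auto simp: R_def V_def abs_le_iff)
        have "\<alpha> \<noteq> 0 \<or> \<phi> t \<in> {-R..R} \<and> \<phi> t + \<epsilon> * w t \<in> {-R..R}"
        proof (cases "\<alpha> = 0")
          case True
          then show ?thesis using e4 r by (simp add: V_def)
        qed simp
        from bd[OF True r this]
        have "\<bar>D \<epsilon> t\<bar> \<le> C * (\<bar>\<epsilon> * w t\<bar> + (1 + 2 * \<bar>\<phi> t\<bar>) * \<bar>\<epsilon> * \<eta> t\<bar>)"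
          by (simp add: D V_def)
        also have "\<dots> \<le> C * (\<bar>\<epsilon>\<bar> * Mw + (1 + 2 * \<bar>\<phi> t\<bar>) * (\<bar>\<epsilon>\<bar> * M\<eta>))"
          using C \<epsilon>\<eta> \<epsilon>w by (intro mult_left_mono add_mono) auto
        also have "\<dots> \<le> C * (\<bar>\<epsilon>\<bar> * (Mw * (1 + \<bar>\<phi> t\<bar>)) + (2 * (1 + \<bar>\<phi> t\<bar>)) * (\<bar>\<epsilon>\<bar> * M\<eta>))"
          using Mw(2) M\<eta>(2)
          by (intro mult_left_mono C add_mono mult_right_mono) (auto simp: algebra_simps)
        also have "\<dots> = \<bar>\<epsilon>\<bar> * (C * (Mw + 2 * M\<eta>) * (1 + \<bar>\<phi> t\<bar>))" by (simp add: algebra_simps)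
        also have "\<dots> \<le> \<bar>\<epsilon>\<bar> * h t"
          unfolding h_def K_def using Mw(2) MG(2) by (intro mult_left_mono mult_right_mono) auto
        finally show ?thesis .
      next
        case False
        then have \<eta>0: "\<eta> t = 0" using supp(3) tab(2) by blast
        have "D \<epsilon> t = \<epsilon> * w t * G t"
        proof (cases "\<alpha> = 0")
          case True
          then show ?thesis using e4 \<eta>0 by (simp add: D V_def)
        next
          case False
          then show ?thesis using aff[OF False tab(1), of "u t" "\<phi> t" "\<epsilon> * w t"] \<eta>0
            by (simp add: D V_def e3)
        qed
        then have "\<bar>D \<epsilon> t\<bar> = \<bar>\<epsilon>\<bar> * (\<bar>w t\<bar> * \<bar>G t\<bar>)" by (simp add: abs_mult)
        also have "\<dots> \<le> \<bar>\<epsilon>\<bar> * (Mw * MG)"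
          using Mw(1)[OF tab(2)] MG(1)[OF tab(2)] Mw(2) by (intro mult_left_mono mult_mono) auto
        also have "\<dots> \<le> \<bar>\<epsilon>\<bar> * (K * 1)"
          unfolding K_def using C Mw(2) M\<eta>(2) by (intro mult_left_mono) auto
        also have "\<dots> \<le> \<bar>\<epsilon>\<bar> * h t"
          unfolding h_def using K by (intro mult_left_mono) auto
        finally show ?thesis .
      qed
    qed
  qed
  have hint: "set_integrable lebesgue {A<..<B} h"
  proof -
    have "integrable lborel (\<lambda>t. indicator {A<..<B} t *\<^sub>R h t)"
    proof -
      have "integrable lborel (\<lambda>t. indicator {A<..<B} t * K)"
        using AB by (intro integrable_mult_left) auto
      moreover have "integrable lborel (\<lambda>t. indicator {A<..<B} t *\<^sub>R (K * \<bar>\<phi> t\<bar>))"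
        using \<phi> by (intro integrable_mult_indicator integrable_mult_right integrable_abs) auto
      ultimately have "integrable lborel (\<lambda>t. indicator {A<..<B} t * K + indicator {A<..<B} t *\<^sub>R (K * \<bar>\<phi> t\<bar>))"
        by (rule Bochner_Integration.integrable_add)
      then show ?thesis by (simp add: h_def algebra_simps)
    qed
    then show ?thesis
      by (intro set_integral_lebesgue_eq_lborel(1)) (simp add: set_integrable_def)
  qed
  have Lmeas: "(\<lambda>t. indicator {A<..<B} t * L (jet \<alpha> a v t)) \<in> borel_measurable lebesgue" if "v \<in> AC a b" for v
    by (rule borel_measurable_jet[OF \<alpha>(2) C1_on_imp_continuous_on[OF C1] that AB])
  have Dmeas: "(\<lambda>t. indicator {A<..<B} t * D \<epsilon> t) \<in> borel_measurable lebesgue" for \<epsilon>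
    using borel_measurable_diff[OF Lmeas[OF VAC] Lmeas[OF uAC]] by (simp add: D_def algebra_simps)
  have Dint: "set_integrable lebesgue {A<..<B} (D \<epsilon>)" if \<epsilon>: "\<bar>\<epsilon>\<bar> \<le> 1" for \<epsilon>
    unfolding set_integrable_def
  proof (rule Bochner_Integration.integrable_bound)
    show "integrable lebesgue (\<lambda>t. indicator {A<..<B} t *\<^sub>R h t)" using hint by (simp add: set_integrable_def)
    show "(\<lambda>t. indicator {A<..<B} t *\<^sub>R D \<epsilon> t) \<in> borel_measurable lebesgue" using Dmeas by simp
    show "AE t in lebesgue. norm (indicator {A<..<B} t *\<^sub>R D \<epsilon> t) \<le> norm (indicator {A<..<B} t *\<^sub>R h t)"
      using Dbound
    proof eventually_elim
      case (elim t)
      have "h t \<ge> 0" using K by (simp add: h_def)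
      then have "\<bar>\<epsilon>\<bar> * h t \<le> h t" using \<epsilon> by (intro mult_left_le_one_le) auto
      then show ?case using elim \<epsilon> \<open>h t \<ge> 0\<close> by (auto split: split_indicator)
    qed
  qed
  have Vadm: "V \<epsilon> \<in> admissible \<alpha> a b A B L a0"
    and actD: "action \<alpha> a A B L (V \<epsilon>) - action \<alpha> a A B L u = (LINT t:{A<..<B}|lebesgue. D \<epsilon> t)"
    if \<epsilon>: "\<bar>\<epsilon>\<bar> \<le> 1" for \<epsilon>
  proof -
    have "set_integrable lebesgue {A<..<B} (\<lambda>t. D \<epsilon> t + L (jet \<alpha> a u t))"
      by (rule set_integral_add(1)[OF Dint[OF \<epsilon>] uint])
    then have vint: "set_integrable lebesgue {A<..<B} (\<lambda>t. L (jet \<alpha> a (V \<epsilon>) t))" by (simp add: D_def)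
    then show "V \<epsilon> \<in> admissible \<alpha> a b A B L a0"
      using VAC by (simp add: admissible_def V_def \<eta>a ua)
    show "action \<alpha> a A B L (V \<epsilon>) - action \<alpha> a A B L u = (LINT t:{A<..<B}|lebesgue. D \<epsilon> t)"
      unfolding action_def D_def by (rule set_integral_diff(2)[OF vint uint, symmetric])
  qed
  have sign: "(\<forall>\<epsilon>. \<bar>\<epsilon>\<bar> \<le> 1 \<longrightarrow> 0 \<le> (LINT t:{A<..<B}|lebesgue. D \<epsilon> t))
      \<or> (\<forall>\<epsilon>. \<bar>\<epsilon>\<bar> \<le> 1 \<longrightarrow> (LINT t:{A<..<B}|lebesgue. D \<epsilon> t) \<le> 0)"
    using ext Vadm unfolding extremal_def is_arg_min_def is_arg_max_def
    by (auto simp: actD[symmetric] not_less)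
  define Q where "Q = (\<lambda>t. partial2 L (jet \<alpha> a u t) * \<eta> t + G t * w t)"
  have Qlim: "AE t\<in>{A<..<B} in lebesgue. ((\<lambda>x. D x t / x) \<longlongrightarrow> Q t) (at 0)"
    using E1 E2 E3
  proof eventually_elim
    case (elim t)
    show ?case
    proof
      assume t: "t \<in> {A<..<B}"
      note tab = sub[OF t]
      have e1: "left_RL \<alpha> a u t = \<phi> t" and e2: "\<And>\<epsilon>. left_RL \<alpha> a (V \<epsilon>) t = \<phi> t + \<epsilon> * w t"
        and e3: "G t = partial3 L (t, u t, \<phi> t)"
        using elim tab(1) by (auto simp: jet_def)
      have Dt: "D x t = L (t, u t + x * \<eta> t, \<phi> t + x * w t) - L (t, u t, \<phi> t)" for x
        by (simp add: D_def jet_def e1 e2) (simp add: V_def)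
      have "((\<lambda>x. L (t, u t + x * \<eta> t, \<phi> t + x * w t)) has_real_derivative
         partial2 L (t, u t, \<phi> t) * \<eta> t + partial3 L (t, u t, \<phi> t) * w t) (at 0)"
        by (rule DERIV_partial23[OF C1 tab(1)])
      then show "((\<lambda>x. D x t / x) \<longlongrightarrow> Q t) (at 0)"
        unfolding has_field_derivative_iff by (simp add: Dt Q_def jet_def e1 e3)
    qed
  qed
  have Qmeas: "(\<lambda>t. indicator {A<..<B} t *\<^sub>R Q t) \<in> borel_measurable lebesgue"
  proof -
    have 1: "(\<lambda>t. indicator {A<..<B} t * partial2 L (jet \<alpha> a u t)) \<in> borel_measurable lebesgue"
      by (rule borel_measurable_jet[OF \<alpha>(2) continuous_on_partial2[OF C1] uAC AB])
    have 2: "(\<lambda>t. indicator {a..b} t *\<^sub>R f t) \<in> borel_measurable lebesgue"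
      if "continuous_on {a..b} f" for f :: "real \<Rightarrow> real"
      using borel_measurable_continuous_on_indicator[OF _ that] by (intro measurable_completion) simp
    have "(\<lambda>t. (indicator {A<..<B} t * partial2 L (jet \<alpha> a u t)) * (indicator {a..b} t *\<^sub>R \<eta> t)
        + indicator {A<..<B} t * ((indicator {a..b} t *\<^sub>R G t) * (indicator {a..b} t *\<^sub>R w t)))
        \<in> borel_measurable lebesgue"
      by (intro borel_measurable_add borel_measurable_times 1 2 AC_imp_continuous_on \<eta>AC GAC wcont
          borel_measurable_indicator) auto
    also have "(\<lambda>t. (indicator {A<..<B} t * partial2 L (jet \<alpha> a u t)) * (indicator {a..b} t *\<^sub>R \<eta> t)
        + indicator {A<..<B} t * ((indicator {a..b} t *\<^sub>R G t) * (indicator {a..b} t *\<^sub>R w t)))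
        = (\<lambda>t. indicator {A<..<B} t *\<^sub>R Q t)"
      using AB by (auto simp: fun_eq_iff Q_def split: split_indicator)
    finally show ?thesis .
  qed
  \<comment> \<open>\<open>\<sigma>\<close> is the side from which \<open>\<epsilon>\<close> tends to \<open>0\<close>\<close>
  have main: "set_integrable lebesgue {A<..<B} Q \<and>
      (\<lambda>n. (LINT t:{A<..<B}|lebesgue. D (\<sigma> / real (Suc n)) t) / (\<sigma> / real (Suc n)))
        \<longlonglongrightarrow> (LINT t:{A<..<B}|lebesgue. Q t)" if \<sigma>: "\<bar>\<sigma>\<bar> = 1" for \<sigma> :: real
  proof -
    define e where "e = (\<lambda>n. \<sigma> / real (Suc n))"
    have e: "\<bar>e n\<bar> \<le> 1" "e n \<noteq> 0" for n using \<sigma> by (auto simp: e_def abs_divide)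
    have e0: "e \<longlonglongrightarrow> 0"
      unfolding e_def by (rule LIMSEQ_Suc) (rule lim_const_over_n)
    define s where "s = (\<lambda>n t. indicator {A<..<B} t *\<^sub>R (D (e n) t / e n))"
    have smeas: "s n \<in> borel_measurable lebesgue" for n
      using borel_measurable_divide[OF Dmeas[of "e n"] borel_measurable_const[of "e n"]]
      by (simp add: s_def algebra_simps)
    have slim: "AE t in lebesgue. (\<lambda>n. s n t) \<longlonglongrightarrow> indicator {A<..<B} t *\<^sub>R Q t"
      using Qlim
    proof eventually_elim
      case (elim t)
      show ?case
      proof (cases "t \<in> {A<..<B}")
        case True
        with elim have l: "((\<lambda>x. D x t / x) \<longlongrightarrow> Q t) (at 0)" by blast
        have "filterlim e (at 0) sequentially"
          using e0 e(2) by (intro filterlim_atI) auto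
        from filterlim_compose[OF l this] show ?thesis using True by (simp add: s_def)
      qed (simp add: s_def)
    qed
    have sbound: "AE t in lebesgue. norm (s n t) \<le> indicator {A<..<B} t *\<^sub>R h t" for n
      using Dbound
    proof eventually_elim
      case (elim t)
      show ?case
      proof (cases "t \<in> {A<..<B}")
        case True
        then have "\<bar>D (e n) t\<bar> \<le> \<bar>e n\<bar> * h t" using elim e(1) by blast
        then show ?thesis using True e(2)[of n] by (simp add: s_def abs_divide field_simps)
      qed (simp add: s_def)
    qed
    have hint': "integrable lebesgue (\<lambda>t. indicator {A<..<B} t *\<^sub>R h t)" using hint by (simp add: set_integrable_def)
    note DC = Qmeas smeas hint' slim sbound
    have "integrable lebesgue (\<lambda>t. indicator {A<..<B} t *\<^sub>R Q t)"
      by (rule integrable_dominated_convergence[OF DC])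
    moreover have "(\<lambda>n. integral\<^sup>L lebesgue (s n)) \<longlonglongrightarrow> integral\<^sup>L lebesgue (\<lambda>t. indicator {A<..<B} t *\<^sub>R Q t)"
      by (rule integral_dominated_convergence[OF DC])
    moreover have "integral\<^sup>L lebesgue (s n) = (LINT t:{A<..<B}|lebesgue. D (e n) t) / e n" for n
      unfolding s_def set_lebesgue_integral_def by simp
    ultimately show ?thesis unfolding set_integrable_def set_lebesgue_integral_def e_def by simp
  qed
  let ?I = "LINT t:{A<..<B}|lebesgue. Q t"
  show "set_integrable lebesgue {A<..<B} (\<lambda>t. partial2 L (jet \<alpha> a u t) * \<eta> t + G t * w t)"
    using main[of 1] by (simp add: Q_def)
  have small: "\<bar>\<sigma> / real (Suc n)\<bar> \<le> 1" if "\<bar>\<sigma>\<bar> = 1" for \<sigma> :: real and n using that by (simp add: abs_divide)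
  have lim: "(\<lambda>n. (LINT t:{A<..<B}|lebesgue. D (1 / real (Suc n)) t) / (1 / real (Suc n))) \<longlonglongrightarrow> ?I"
    "(\<lambda>n. (LINT t:{A<..<B}|lebesgue. D (-1 / real (Suc n)) t) / (-1 / real (Suc n))) \<longlonglongrightarrow> ?I"
    using main[of 1] main[of "-1"] by (simp_all only: abs_one abs_minus)
  have q: "0 < 1 / real (Suc n)" "-1 / real (Suc n) < 0" for n by simp_all
  have "?I = 0"
    using sign
  proof
    assume pos: "\<forall>\<epsilon>. \<bar>\<epsilon>\<bar> \<le> 1 \<longrightarrow> 0 \<le> (LINT t:{A<..<B}|lebesgue. D \<epsilon> t)"
    have "0 \<le> ?I"
      by (rule LIMSEQ_le_const[OF lim(1)])
         (intro exI allI impI divide_nonneg_pos pos[rule_format] q small abs_one)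
    moreover have "?I \<le> 0"
      by (rule LIMSEQ_le_const2[OF lim(2)])
         (intro exI allI impI divide_nonneg_neg pos[rule_format] q small, simp)
    ultimately show ?thesis by simp
  next
    assume neg: "\<forall>\<epsilon>. \<bar>\<epsilon>\<bar> \<le> 1 \<longrightarrow> (LINT t:{A<..<B}|lebesgue. D \<epsilon> t) \<le> 0"
    have "?I \<le> 0"
      by (rule LIMSEQ_le_const2[OF lim(1)])
         (intro exI allI impI divide_nonpos_pos neg[rule_format] q small abs_one)
    moreover have "0 \<le> ?I"
      by (rule LIMSEQ_le_const[OF lim(2)])
         (intro exI allI impI divide_nonpos_neg neg[rule_format] q small, simp)
    ultimately show ?thesis by simp
  qed
  then show "(LINT t:{A<..<B}|lebesgue. partial2 L (jet \<alpha> a u t) * \<eta> t + G t * w t) = 0"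
    by (simp add: Q_def)
qed

section \<open>The limit of steep trapezoids\<close>

definition right_kernel :: "real \<Rightarrow> real \<Rightarrow> real \<Rightarrow> real" where
  "right_kernel \<alpha> x t = indicator {x<..} t * (t - x) powr (-\<alpha>)"

text \<open>
  The bound is uniform in \<open>h\<close>. With \<open>y = t - x > 0\<close> and \<open>z = y - h > 0\<close> it comes from
  \<open>z\<^sup>1\<^sup>-\<^sup>\<alpha> = z z\<^sup>-\<^sup>\<alpha> \<ge> z y\<^sup>-\<^sup>\<alpha>\<close>.
\<close>

lemma ramp_quotient_bounds:
  assumes \<alpha>: "0 \<le> \<alpha>" "\<alpha> < 1" and h: "h > 0"
  shows "0 \<le> (powr_ramp \<alpha> (t - x) - powr_ramp \<alpha> (t - (x + h))) / h"
    and "(powr_ramp \<alpha> (t - x) - powr_ramp \<alpha> (t - (x + h))) / h \<le> right_kernel \<alpha> x t / (1 - \<alpha>)"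
proof -
  let ?y = "max 0 (t - x)" and ?z = "max 0 (t - (x + h))"
  have "?z powr (1 - \<alpha>) \<le> ?y powr (1 - \<alpha>)" using \<alpha> h by (intro powr_mono2) auto
  then show "0 \<le> (powr_ramp \<alpha> (t - x) - powr_ramp \<alpha> (t - (x + h))) / h"
    using \<alpha> h by (simp add: powr_ramp_def diff_divide_distrib[symmetric])
  have "?y powr (1 - \<alpha>) - ?z powr (1 - \<alpha>) \<le> h * right_kernel \<alpha> x t"
  proof (cases "t > x")
    case True
    have y: "?y powr (1 - \<alpha>) = ?y * ?y powr (-\<alpha>)"
      using True powr_add[of ?y 1 "-\<alpha>"] by simp
    have z: "?z powr (1 - \<alpha>) \<ge> ?z * ?y powr (-\<alpha>)"
    proof (cases "?z = 0")
      case False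
      then have z0: "?z > 0" by simp
      have "?y powr (-\<alpha>) \<le> ?z powr (-\<alpha>)"
        using z0 h \<alpha> by (intro powr_mono2') auto
      then have "?z * ?y powr (-\<alpha>) \<le> ?z * ?z powr (-\<alpha>)" using z0 by (intro mult_left_mono) auto
      also have "\<dots> = ?z powr (1 - \<alpha>)" using z0 powr_add[of ?z 1 "-\<alpha>"] by simp
      finally show ?thesis .
    qed simp
    have "?y powr (1 - \<alpha>) - ?z powr (1 - \<alpha>) \<le> (?y - ?z) * ?y powr (-\<alpha>)"
      using y z by (simp add: algebra_simps)
    also have "\<dots> \<le> h * ?y powr (-\<alpha>)" using h by (intro mult_right_mono) auto
    finally show ?thesis using True by (simp add: right_kernel_def)
  next
    case False
    then show ?thesis using h by (simp add: right_kernel_def)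
  qed
  then have "(?y powr (1 - \<alpha>) - ?z powr (1 - \<alpha>)) / (1 - \<alpha>) / h \<le> h * right_kernel \<alpha> x t / (1 - \<alpha>) / h"
    using \<alpha> h by (intro divide_right_mono) auto
  moreover have "(powr_ramp \<alpha> (t - x) - powr_ramp \<alpha> (t - (x + h))) / h
      = (?y powr (1 - \<alpha>) - ?z powr (1 - \<alpha>)) / (1 - \<alpha>) / h"
    by (simp add: powr_ramp_def diff_divide_distrib)
  ultimately show "(powr_ramp \<alpha> (t - x) - powr_ramp \<alpha> (t - (x + h))) / h \<le> right_kernel \<alpha> x t / (1 - \<alpha>)"
    using h by simp
qed

lemma ramp_quotient_tendsto:
  assumes \<alpha>: "\<alpha> < 1" and t: "t \<noteq> x" and e: "e \<longlonglongrightarrow> 0" "\<And>n. e n > 0"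
  shows "(\<lambda>n. (powr_ramp \<alpha> (t - x) - powr_ramp \<alpha> (t - (x + e n))) / e n) \<longlonglongrightarrow> right_kernel \<alpha> x t"
proof (cases "t < x")
  case True
  then have z: "(powr_ramp \<alpha> (t - x) - powr_ramp \<alpha> (t - (x + e n))) / e n = 0" for n
    using e(2)[of n] by (simp add: powr_ramp_def)
  show ?thesis unfolding z using True by (simp add: right_kernel_def)
next
  case False
  define s where "s = t - x"
  have s: "s > 0" using False t by (simp add: s_def)
  have "((\<lambda>y. y powr (1 - \<alpha>) / (1 - \<alpha>)) has_real_derivative (1 - \<alpha>) * s powr (1 - \<alpha> - 1) / (1 - \<alpha>)) (at s)"
    using s by (intro DERIV_cdivide has_real_derivative_powr)
  moreover have "(1 - \<alpha>) * s powr (1 - \<alpha> - 1) / (1 - \<alpha>) = s powr (-\<alpha>)" using \<alpha> by simp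
  ultimately have "((\<lambda>y. y powr (1 - \<alpha>) / (1 - \<alpha>)) has_real_derivative s powr (-\<alpha>)) (at s)" by metis
  then have "(powr_ramp \<alpha> has_real_derivative s powr (-\<alpha>)) (at s)"
    by (rule has_field_derivative_transform_within_open[of _ _ _ "{0<..}"])
       (use s in \<open>auto simp: powr_ramp_def\<close>)
  then have l: "((\<lambda>y. (powr_ramp \<alpha> y - powr_ramp \<alpha> s) / (y - s)) \<longlongrightarrow> s powr (-\<alpha>)) (at s)"
    by (simp add: has_field_derivative_iff)
  have "(\<lambda>n. s - e n) \<longlonglongrightarrow> s - 0" by (intro tendsto_diff tendsto_const e(1))
  then have "filterlim (\<lambda>n. s - e n) (at s) sequentially"
    using e(2) by (intro filterlim_atI) (auto simp: less_imp_neq[symmetric])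
  from filterlim_compose[OF l this]
  have "(\<lambda>n. (powr_ramp \<alpha> (s - e n) - powr_ramp \<alpha> s) / (s - e n - s)) \<longlonglongrightarrow> s powr (-\<alpha>)" .
  moreover have "(powr_ramp \<alpha> (s - e n) - powr_ramp \<alpha> s) / (s - e n - s)
     = (powr_ramp \<alpha> (t - x) - powr_ramp \<alpha> (t - (x + e n))) / e n" for n
    using e(2)[of n] by (simp add: s_def field_simps)
  ultimately show ?thesis using s by (simp add: right_kernel_def s_def)
qed

lemma trapezoid_bound:
  assumes \<alpha>: "0 \<le> \<alpha>" "\<alpha> < 1" and h: "h > 0"
  shows "\<bar>trapezoid \<alpha> x y h t\<bar> \<le> right_kernel \<alpha> x t / (1 - \<alpha>) + right_kernel \<alpha> y t / (1 - \<alpha>)"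
  using ramp_quotient_bounds[OF \<alpha> h, of t x] ramp_quotient_bounds[OF \<alpha> h, of t y]
  unfolding trapezoid_def diff_divide_distrib[of _ "powr_ramp \<alpha> (t - y) - powr_ramp \<alpha> (t - (y + h))"]
  by linarith

lemma trapezoid_tendsto:
  assumes "\<alpha> < 1" "t \<noteq> x" "t \<noteq> y" "e \<longlonglongrightarrow> 0" "\<And>n. e n > 0"
  shows "(\<lambda>n. trapezoid \<alpha> x y (e n) t) \<longlonglongrightarrow> right_kernel \<alpha> x t - right_kernel \<alpha> y t"
  unfolding trapezoid_def diff_divide_distrib[of _ "powr_ramp \<alpha> (t - y) - powr_ramp \<alpha> (t - (y + _))"]
  using assms by (intro tendsto_diff ramp_quotient_tendsto)

lemma continuous_on_trapezoid:
  assumes "\<alpha> < 1"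
  shows "continuous_on S (trapezoid \<alpha> x y h)"
proof -
  have "continuous_on UNIV (powr_ramp \<alpha>)"
    unfolding powr_ramp_def using assms
    by (intro continuous_on_divide continuous_on_powr' continuous_intros) auto
  then have c: "continuous_on S (\<lambda>t. powr_ramp \<alpha> (t - z))" for z
    by (rule continuous_on_compose2) (auto intro!: continuous_intros)
  have "continuous_on S (\<lambda>t. (powr_ramp \<alpha> (t - x) - powr_ramp \<alpha> (t - (x + h))
     - (powr_ramp \<alpha> (t - y) - powr_ramp \<alpha> (t - (y + h)))) * (1 / h))"
    by (intro continuous_on_mult continuous_on_diff c continuous_on_const)
  then show ?thesis by (simp add: trapezoid_def[abs_def])
qed

lemma trapezoid_0_support:
  assumes "x < y" "h > 0" "t \<notin> {x..y + h}"
  shows "trapezoid 0 x y h t = 0"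
  using assms by (auto simp: trapezoid_def powr_ramp_def max_def)

lemma trapezoid_0_plateau:
  assumes "x < y" "h > 0" "x + h \<le> t" "t \<le> y"
  shows "trapezoid 0 x y h t = 1"
  using assms by (auto simp: trapezoid_def powr_ramp_def max_def)

lemma right_kernel_integrable:
  assumes "\<alpha> < 1"
  shows "integrable lborel (\<lambda>t. indicator {A<..<B} t * right_kernel \<alpha> x t)"
proof -
  from lborel_integrable_real_affine[OF integrable_powr_kernel[OF assms, of "B - x"], of 1 "- x"]
  have "integrable lborel (\<lambda>t. indicator {0<..<B - x} (t - x) * (t - x) powr (-\<alpha>))"
    by (simp add: algebra_simps)
  from integrable_mult_indicator[OF _ this, of "{A<..<B}"]
  have "integrable lborel (\<lambda>t. indicator {A<..<B} t *\<^sub>R (indicator {0<..<B - x} (t - x) * (t - x) powr (-\<alpha>)))"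
    by simp
  also have "(\<lambda>t. indicator {A<..<B} t *\<^sub>R (indicator {0<..<B - x} (t - x) * (t - x) powr (-\<alpha>)))
      = (\<lambda>t. indicator {A<..<B} t * right_kernel \<alpha> x t)"
    by (auto simp: fun_eq_iff right_kernel_def split: split_indicator)
  finally show ?thesis .
qed

text \<open>
  As the ramps of the trapezoid become steep, it tends to the indicator function of \<open>(x,y]\<close> and its
  fractional derivative to a difference of two kernels, in each case with an integrable majorant.
\<close>

lemma du_bois_reymond_trapezoid_limit:
  fixes P G :: "real \<Rightarrow> real"
  assumes \<alpha>: "0 \<le> \<alpha>" "\<alpha> < 1" and xy: "x < y" and \<delta>: "\<delta> > 0" and \<Gamma>: "\<Gamma> > 0"
    and P: "set_integrable lebesgue ({A<..<B} \<inter> {x..y + \<delta>}) P"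
    and Pm: "(\<lambda>t. indicator {A<..<B} t * P t) \<in> borel_measurable lebesgue"
    and G: "continuous_on {A..B} G"
    and weak: "\<And>h. \<lbrakk>0 < h; h \<le> \<delta>\<rbrakk> \<Longrightarrow>
        (LINT t:{A<..<B}|lebesgue. P t * trapezoid 0 x y h t + G t * (trapezoid \<alpha> x y h t / \<Gamma>)) = 0"
  shows "(LINT t:{A<..<B}|lebesgue. P t * indicator {x<..y} t
            + G t * ((right_kernel \<alpha> x t - right_kernel \<alpha> y t) / \<Gamma>)) = 0"
proof -
  obtain MG where MG: "\<And>t. t \<in> {A..B} \<Longrightarrow> \<bar>G t\<bar> \<le> MG" "MG \<ge> 0"
    using continuous_on_Icc_bounded[OF G] by blast
  define e where "e = (\<lambda>n. \<delta> / real (Suc n))"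
  have e: "e n > 0" "e n \<le> \<delta>" for n using \<delta> by (auto simp: e_def field_simps)
  have e0: "e \<longlonglongrightarrow> 0" unfolding e_def by (rule LIMSEQ_Suc) (rule lim_const_over_n)
  let ?I = "\<lambda>t. indicator {A<..<B} t :: real"
  define s where "s = (\<lambda>n t. ?I t *\<^sub>R (P t * trapezoid 0 x y (e n) t + G t * (trapezoid \<alpha> x y (e n) t / \<Gamma>)))"
  define f where "f = (\<lambda>t. ?I t *\<^sub>R (P t * indicator {x<..y} t + G t * ((right_kernel \<alpha> x t - right_kernel \<alpha> y t) / \<Gamma>)))"
  define dom where "dom = (\<lambda>t. 2 * (indicator ({A<..<B} \<inter> {x..y + \<delta>}) t *\<^sub>R \<bar>P t\<bar>)
      + (MG / ((1 - \<alpha>) * \<Gamma>)) * (?I t * right_kernel \<alpha> x t + ?I t * right_kernel \<alpha> y t))"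
  have Gm: "(\<lambda>t. ?I t * G t) \<in> borel_measurable lebesgue"
  proof -
    have "(\<lambda>t. indicator {A..B} t *\<^sub>R G t) \<in> borel_measurable borel"
      by (rule borel_measurable_continuous_on_indicator[OF _ G]) simp
    then have "(\<lambda>t. ?I t * (indicator {A..B} t *\<^sub>R G t)) \<in> borel_measurable borel" by measurable
    also have "(\<lambda>t. ?I t * (indicator {A..B} t *\<^sub>R G t)) = (\<lambda>t. ?I t * G t)"
      by (auto simp: fun_eq_iff split: split_indicator)
    finally show ?thesis by (intro measurable_completion) simp
  qed
  have tm: "trapezoid \<beta> x y h \<in> borel_measurable lebesgue" if "\<beta> < 1" for \<beta> h
    using borel_measurable_continuous_onI[OF continuous_on_trapezoid[OF that]]
    by (intro measurable_completion) simp
  have km: "right_kernel \<alpha> z \<in> borel_measurable lebesgue" for z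
    unfolding right_kernel_def by (intro measurable_completion) measurable
  have kint: "integrable lebesgue (\<lambda>t. ?I t * right_kernel \<alpha> z t)" for z
  proof -
    have "integrable lborel (\<lambda>t. ?I t * right_kernel \<alpha> z t)" by (rule right_kernel_integrable[OF \<alpha>(2)])
    then show ?thesis by (subst integrable_completion) (auto dest: borel_measurable_integrable)
  qed
  have "s n = (\<lambda>t. (?I t * P t) * trapezoid 0 x y (e n) t + (?I t * G t) * (trapezoid \<alpha> x y (e n) t / \<Gamma>))" for n
    by (simp add: s_def algebra_simps)
  then have smeas: "s n \<in> borel_measurable lebesgue" for n
    using \<alpha> by (simp only:) (intro borel_measurable_add borel_measurable_times borel_measurable_divide Pm Gm tm
      borel_measurable_const; simp)
  have "f = (\<lambda>t. (?I t * P t) * indicator {x<..y} t + (?I t * G t) * ((right_kernel \<alpha> x t - right_kernel \<alpha> y t) / \<Gamma>))"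
    by (simp add: f_def algebra_simps)
  then have fmeas: "f \<in> borel_measurable lebesgue"
    by (simp only:) (intro borel_measurable_add borel_measurable_times borel_measurable_divide
      borel_measurable_diff Pm Gm km borel_measurable_const borel_measurable_indicator; simp)
  have domint: "integrable lebesgue dom"
    unfolding dom_def
  proof (intro Bochner_Integration.integrable_add integrable_mult_right kint)
    show "integrable lebesgue (\<lambda>t. indicator ({A<..<B} \<inter> {x..y + \<delta>}) t *\<^sub>R \<bar>P t\<bar>)"
      using set_integrable_abs[OF P] by (simp add: set_integrable_def)
  qed
  have slim: "AE t in lebesgue. (\<lambda>n. s n t) \<longlonglongrightarrow> f t"
  proof -
    have "AE t in lborel. t \<noteq> x \<and> t \<noteq> y"
      using AE_lborel_singleton[of x] AE_lborel_singleton[of y] by eventually_elim simp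
    then have "AE t in lebesgue. t \<noteq> x \<and> t \<noteq> y" by (rule AE_completion)
    then show ?thesis
    proof eventually_elim
      case (elim t)
      have 1: "(\<lambda>n. trapezoid 0 x y (e n) t) \<longlonglongrightarrow> right_kernel 0 x t - right_kernel 0 y t"
        by (rule trapezoid_tendsto) (use elim e0 e in auto)
      have 2: "right_kernel 0 x t - right_kernel 0 y t = indicator {x<..y} t"
        using xy elim by (auto simp: right_kernel_def split: split_indicator)
      have 3: "(\<lambda>n. trapezoid \<alpha> x y (e n) t) \<longlonglongrightarrow> right_kernel \<alpha> x t - right_kernel \<alpha> y t"
        by (rule trapezoid_tendsto) (use elim e0 e \<alpha> in auto)
      show ?case
        unfolding s_def f_def
        by (intro tendsto_scaleR tendsto_add tendsto_mult tendsto_divide tendsto_const 1[unfolded 2] 3)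
           (use \<Gamma> in simp)
    qed
  qed
  have sbound: "AE t in lebesgue. norm (s n t) \<le> dom t" for n
  proof (rule AE_I2)
    fix t
    have rk: "right_kernel \<alpha> z t \<ge> 0" for z by (simp add: right_kernel_def)
    show "norm (s n t) \<le> dom t"
    proof (cases "t \<in> {A<..<B}")
      case True
      have p: "\<bar>P t * trapezoid 0 x y (e n) t\<bar> \<le> 2 * (indicator ({A<..<B} \<inter> {x..y + \<delta>}) t *\<^sub>R \<bar>P t\<bar>)"
      proof (cases "t \<in> {x..y + \<delta>}")
        case t: True
        have "right_kernel 0 z t \<le> 1" for z by (simp add: right_kernel_def split: split_indicator)
        then have "\<bar>trapezoid 0 x y (e n) t\<bar> \<le> 2"
          using trapezoid_bound[of 0 "e n" x y t] e(1)[of n] by (smt (verit) div_by_1)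
        then have "\<bar>P t\<bar> * \<bar>trapezoid 0 x y (e n) t\<bar> \<le> \<bar>P t\<bar> * 2" by (intro mult_left_mono) auto
        then show ?thesis using t True by (simp add: abs_mult)
      next
        case False
        then have "t \<notin> {x..y + e n}" using e(2)[of n] by auto
        then show ?thesis using trapezoid_0_support[OF xy e(1)] by simp
      qed
      have "\<bar>trapezoid \<alpha> x y (e n) t\<bar> \<le> (right_kernel \<alpha> x t + right_kernel \<alpha> y t) / (1 - \<alpha>)"
        using trapezoid_bound[OF \<alpha> e(1), of x y n t] by (simp add: add_divide_distrib)
      then have "\<bar>G t\<bar> * (\<bar>trapezoid \<alpha> x y (e n) t\<bar> / \<Gamma>)
          \<le> MG * ((right_kernel \<alpha> x t + right_kernel \<alpha> y t) / (1 - \<alpha>) / \<Gamma>)"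
        using MG True \<Gamma> by (intro mult_mono divide_right_mono) auto
      then have q: "\<bar>G t * (trapezoid \<alpha> x y (e n) t / \<Gamma>)\<bar>
          \<le> (MG / ((1 - \<alpha>) * \<Gamma>)) * (right_kernel \<alpha> x t + right_kernel \<alpha> y t)"
        using \<Gamma> by (simp add: abs_mult abs_divide)
      have "s n t = P t * trapezoid 0 x y (e n) t + G t * (trapezoid \<alpha> x y (e n) t / \<Gamma>)"
        using True by (simp add: s_def)
      moreover have "dom t = 2 * (indicator ({A<..<B} \<inter> {x..y + \<delta>}) t *\<^sub>R \<bar>P t\<bar>)
          + (MG / ((1 - \<alpha>) * \<Gamma>)) * (right_kernel \<alpha> x t + right_kernel \<alpha> y t)"
        using True by (simp add: dom_def)
      ultimately show ?thesis
        using p q abs_triangle_ineq[of "P t * trapezoid 0 x y (e n) t" "G t * (trapezoid \<alpha> x y (e n) t / \<Gamma>)"]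
        unfolding real_norm_def by linarith
    next
      case False
      then show ?thesis by (simp add: s_def dom_def)
    qed
  qed
  have "(\<lambda>n. integral\<^sup>L lebesgue (s n)) \<longlonglongrightarrow> integral\<^sup>L lebesgue f"
    by (rule integral_dominated_convergence[OF fmeas smeas domint slim sbound])
  moreover have "integral\<^sup>L lebesgue (s n) = 0" for n
    using weak[OF e(1)[of n] e(2)[of n]] unfolding s_def set_lebesgue_integral_def by simp
  ultimately have "(\<lambda>n. 0) \<longlonglongrightarrow> integral\<^sup>L lebesgue f" by simp
  then have "integral\<^sup>L lebesgue f = 0" by (simp add: LIMSEQ_const_iff)
  then show ?thesis unfolding f_def set_lebesgue_integral_def .
qed

section \<open>The two Euler-Lagrange equations\<close>

definition right_abel :: "real \<Rightarrow> real \<Rightarrow> (real \<Rightarrow> real) \<Rightarrow> real \<Rightarrow> real" where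
  "right_abel \<alpha> E g x = (LINT \<theta>:{x<..<E}|lebesgue. (\<theta> - x) powr (-\<alpha>) * g \<theta>)"

lemma right_abel_integrable:
  assumes \<alpha>: "\<alpha> < 1" and ab: "a < b" and G: "G \<in> AC a b" and x: "x \<in> {a..b}"
  shows "set_integrable lebesgue {x<..<b} (\<lambda>\<theta>. (\<theta> - x) powr (-\<alpha>) * G \<theta>)"
proof -
  obtain g where "has_density a b G (G a) g" using AC_has_density[OF G ab] by blast
  from abel_integrand_right_integrable[OF \<alpha> ab this x] show ?thesis
    by (rule set_integral_lebesgue_eq_lborel(1))
qed

lemma right_kernel_mult_integrable:
  assumes \<alpha>: "\<alpha> < 1" and AB: "a \<le> A" "A < B" "B \<le> b" and G: "G \<in> AC a b" and x: "x \<in> {a..b}"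
  shows "set_integrable lebesgue {A<..<B} (\<lambda>t. right_kernel \<alpha> x t * G t)"
proof -
  have ab: "a < b" using AB by simp
  have "set_integrable lebesgue ({A<..<B} \<inter> {x<..<b}) (\<lambda>\<theta>. (\<theta> - x) powr (-\<alpha>) * G \<theta>)"
    by (rule set_integrable_subset[OF right_abel_integrable[OF \<alpha> ab G x]]) auto
  also have "?this \<longleftrightarrow> set_integrable lebesgue {A<..<B} (\<lambda>t. right_kernel \<alpha> x t * G t)"
    unfolding set_integrable_def
    by (intro arg_cong2[of _ _ _ _ integrable] refl ext)
       (use AB in \<open>auto simp: right_kernel_def split: split_indicator\<close>)
  finally show ?thesis .
qed

lemma right_abel_diff:
  assumes \<alpha>: "\<alpha> < 1" and AB: "a \<le> A" "A < B" "B \<le> b" and G: "G \<in> AC a b" and x: "x \<in> {a<..<A}"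
  shows "right_abel \<alpha> B G x = right_abel \<alpha> A G x + (LINT t:{A<..<B}|lebesgue. right_kernel \<alpha> x t * G t)"
proof -
  have ab: "a < b" and xab: "x \<in> {a..b}" using AB x by auto
  let ?f = "\<lambda>\<theta>. (\<theta> - x) powr (-\<alpha>) * G \<theta>"
  note I = set_integrable_subset[OF right_abel_integrable[OF \<alpha> ab G xab]]
  have 1: "set_integrable lebesgue {x<..<A} ?f" "set_integrable lebesgue {A..<B} ?f"
    by (rule I; use AB x in auto)+
  have U: "{x<..<B} = {x<..<A} \<union> {A..<B}" "{x<..<A} \<inter> {A..<B} = {}" using AB x by auto
  have "right_abel \<alpha> B G x = right_abel \<alpha> A G x + (LINT \<theta>:{A..<B}|lebesgue. ?f \<theta>)"
    unfolding right_abel_def U(1) by (rule set_integral_Un[OF U(2) 1])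
  also have "(LINT \<theta>:{A..<B}|lebesgue. ?f \<theta>) = (LINT \<theta>:{A<..<B}|lebesgue. ?f \<theta>)"
  proof -
    have "{A..<B} = {A} \<union> {A<..<B}" using AB by auto
    moreover have "(LINT \<theta>:{A} \<union> {A<..<B}|lebesgue. ?f \<theta>) = (LINT \<theta>:{A}|lebesgue. ?f \<theta>) + (LINT \<theta>:{A<..<B}|lebesgue. ?f \<theta>)"
    proof (rule set_integral_Un)
      show "set_integrable lebesgue {A} ?f" "set_integrable lebesgue {A<..<B} ?f"
        by (rule set_integrable_subset[OF 1(2)]; use AB in auto)+
    qed auto
    moreover have "(LINT \<theta>:{A}|lebesgue. ?f \<theta>) = 0"
    proof -
      have "AE \<theta> in lebesgue. indicator {A} \<theta> *\<^sub>R ?f \<theta> = 0"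
        using AE_completion[OF AE_lborel_singleton[of A]] by eventually_elim simp
      then show ?thesis unfolding set_lebesgue_integral_def by (rule integral_eq_zero_AE)
    qed
    ultimately show ?thesis by simp
  qed
  also have "(LINT \<theta>:{A<..<B}|lebesgue. ?f \<theta>) = (LINT t:{A<..<B}|lebesgue. right_kernel \<alpha> x t * G t)"
    unfolding set_lebesgue_integral_def
    by (intro Bochner_Integration.integral_cong refl) (use x in \<open>auto simp: right_kernel_def split: split_indicator\<close>)
  finally show ?thesis .
qed

text \<open>
  Two functions that differ by a constant near \<open>t\<close> have the same candidates for a derivative there. If
  there is none, \<open>deriv\<close> chooses from the same empty set and so returns the same value, which makes the
  equality hold at every point.
\<close>

lemma deriv_cong_add_const:
  fixes f g :: "real \<Rightarrow> real"
  assumes S: "open S" "t \<in> S" and eq: "\<And>x. x \<in> S \<Longrightarrow> f x = g x + k"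
  shows "deriv f t = deriv g t"
proof -
  have "(f has_field_derivative D) (at t) \<longleftrightarrow> (g has_field_derivative D) (at t)" for D
  proof
    assume "(f has_field_derivative D) (at t)"
    then have "((\<lambda>x. f x - k) has_field_derivative D - 0) (at t)" by (intro DERIV_diff) auto
    then have "((\<lambda>x. f x - k) has_field_derivative D) (at t)" by simp
    then show "(g has_field_derivative D) (at t)"
      by (rule has_field_derivative_transform_within_open[OF _ S]) (simp add: eq)
  next
    assume "(g has_field_derivative D) (at t)"
    then have "((\<lambda>x. g x + k) has_field_derivative D + 0) (at t)" by (intro DERIV_add) auto
    then have "((\<lambda>x. g x + k) has_field_derivative D) (at t)" by simp
    then show "(f has_field_derivative D) (at t)"
      by (rule has_field_derivative_transform_within_open[OF _ S]) (simp add: eq)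
  qed
  then show ?thesis by (simp add: deriv_def)
qed

text \<open>
  On \<open>(a,A)\<close> the right Abel integrals of \<open>G\<close> up to \<open>B\<close> and up to \<open>A\<close> differ by the integral over \<open>(A,B)\<close>,
  so that the two fractional derivatives agree at every point once this integral is constant.
\<close>

lemma right_RL_diff_eq_0:
  assumes \<alpha>: "\<alpha> < 1" and AB: "a \<le> A" "A < B" "B \<le> b" and G: "G \<in> AC a b"
    and const: "\<And>x y. \<lbrakk>a < x; x < y; y < A\<rbrakk> \<Longrightarrow>
      (LINT t:{A<..<B}|lebesgue. right_kernel \<alpha> x t * G t) = (LINT t:{A<..<B}|lebesgue. right_kernel \<alpha> y t * G t)"
    and t: "t \<in> {a<..<A}"
  shows "right_RL \<alpha> B G t - right_RL \<alpha> A G t = 0"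
proof -
  let ?K = "\<lambda>x. LINT t:{A<..<B}|lebesgue. right_kernel \<alpha> x t * G t"
  have K: "?K x = ?K t" if "x \<in> {a<..<A}" for x
    using const[of x t] const[of t x] t that by (cases x t rule: linorder_cases) auto
  have "deriv (right_abel \<alpha> B G) t = deriv (right_abel \<alpha> A G) t"
  proof (rule deriv_cong_add_const)
    show "open {a<..<A}" "t \<in> {a<..<A}" using t by simp_all
    show "right_abel \<alpha> B G x = right_abel \<alpha> A G x + ?K t" if x: "x \<in> {a<..<A}" for x
      using right_abel_diff[OF \<alpha> AB G x] unfolding K[OF x] .
  qed
  moreover have "right_RL \<alpha> E G t = 1 / Gamma (1 - \<alpha>) * (- deriv (right_abel \<alpha> E G) t)" for E
    by (simp add: right_RL_def right_abel_def[abs_def])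
  ultimately show ?thesis by simp
qed

text \<open>
  The primitive from any point of \<open>(A,B)\<close> is the zero function, and its derivative is \<open>f\<close> almost
  everywhere. The interval is exhausted by compact ones because \<open>f\<close> need not be integrable up to \<open>A\<close> and \<open>B\<close>.
\<close>

lemma AE_eq_0_if_integrals_eq_0:
  fixes f :: "real \<Rightarrow> real"
  assumes f: "\<And>x y. \<lbrakk>A < x; x < y; y < B\<rbrakk> \<Longrightarrow> set_integrable lborel {x..y} f"
    and z: "\<And>x y. \<lbrakk>A < x; x < y; y < B\<rbrakk> \<Longrightarrow> (LINT t:{x..y}|lborel. f t) = 0"
    and AB: "A < B"
  shows "AE t\<in>{A<..<B} in lebesgue. f t = 0"
proof -
  define c where "c = (\<lambda>n. A + (B - A) / (real n + 3))"
  define d where "d = (\<lambda>n. B - (B - A) / (real n + 3))"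
  have cd: "A < c n" "c n < d n" "d n < B" for n
  proof -
    define q where "q = (B - A) / (real n + 3)"
    have "q \<le> (B - A) / 3" unfolding q_def using AB by (intro divide_left_mono) auto
    moreover have "q > 0" using AB by (simp add: q_def)
    moreover have "c n = A + q" "d n = B - q" by (simp_all add: c_def d_def q_def)
    ultimately show "A < c n" "c n < d n" "d n < B" using AB by auto
  qed
  have "AE t in lebesgue. \<forall>n. t \<in> {c n<..<d n} \<longrightarrow> f t = 0"
    unfolding AE_all_countable
  proof
    fix n
    show "AE t\<in>{c n<..<d n} in lebesgue. f t = 0"
      using AE_derivative_indefinite_integral[OF f[OF cd(1)[of n] cd(2)[of n] cd(3)[of n]]]
    proof eventually_elim
      case (elim t)
      show ?case
      proof
        assume t: "t \<in> {c n<..<d n}"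
        have "((\<lambda>x. 0) has_real_derivative f t) (at t)"
        proof (rule has_field_derivative_transform_within_open)
          show "((\<lambda>x. LINT s:{c n..x}|lborel. f s) has_real_derivative f t) (at t)" using elim t by blast
          show "(LINT s:{c n..x}|lborel. f s) = 0" if "x \<in> {c n<..<d n}" for x
            using that cd[of n] by (intro z) auto
        qed (use t in auto)
        then show "f t = 0" using DERIV_unique DERIV_const by blast
      qed
    qed
  qed
  then show ?thesis
  proof eventually_elim
    case (elim t)
    show ?case
    proof
      assume t: "t \<in> {A<..<B}"
      define r where "r = min (t - A) (B - t)"
      have r: "r > 0" using t by (auto simp: r_def)
      obtain n :: nat where n: "(B - A) / r < real n" using reals_Archimedean2 by blast
      then have "B - A < real n * r" using r by (simp add: field_simps)
      also have "\<dots> \<le> (real n + 3) * r" using r by (intro mult_right_mono) auto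
      finally have "(B - A) / (real n + 3) < r" by (simp add: field_simps)
      then have "t \<in> {c n<..<d n}" by (auto simp: c_def d_def r_def)
      then show "f t = 0" using elim by blast
    qed
  qed
qed

lemma right_Caputo_eq_density:
  assumes d: "has_density A B G c g" and t: "A \<le> t"
  shows "right_Caputo \<alpha> B G t
    = - (1 / Gamma (1 - \<alpha>)) * (LINT \<theta>:{t<..<B}|lborel. (\<theta> - t) powr (-\<alpha>) * g \<theta>)"
proof -
  have "integrable lborel g" using d by (simp add: has_density_def)
  then have [measurable]: "g \<in> borel_measurable borel" by (auto dest: borel_measurable_integrable)
  let ?f = "\<lambda>\<theta>. indicator {t<..<B} \<theta> *\<^sub>R ((\<theta> - t) powr (-\<alpha>) * g \<theta>)"
  let ?h = "\<lambda>\<theta>. indicator {t<..<B} \<theta> *\<^sub>R ((\<theta> - t) powr (-\<alpha>) * deriv G \<theta>)"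
  have fb: "?f \<in> borel_measurable borel" by measurable
  then have f: "?f \<in> borel_measurable lebesgue" by (intro measurable_completion) simp
  have ae: "AE \<theta> in lebesgue. ?f \<theta> = ?h \<theta>"
    using AE_deriv_has_density[OF d] by eventually_elim (use t in \<open>auto split: split_indicator\<close>)
  have "integral\<^sup>L lebesgue ?h = integral\<^sup>L lebesgue ?f"
    by (rule integral_cong_AE[OF f borel_measurable_lebesgue_AE_cong[OF f ae] ae, symmetric])
  also have "\<dots> = integral\<^sup>L lborel ?f"
    by (rule integral_completion) (use fb in simp)
  finally show ?thesis by (simp add: right_Caputo_def set_lebesgue_integral_def)
qed

theorem theorem3p3:
  fixes \<alpha> a b A B a0 :: real
    and L :: "real \<times> real \<times> real \<Rightarrow> real"
    and u G :: "real \<Rightarrow> real"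
  assumes "0 \<le> \<alpha>" "\<alpha> < 1"
    and "a \<le> A" "A < B" "B \<le> b"
    and "C1_on L ({a<..<b} \<times> UNIV \<times> UNIV)"
    and "\<forall>v\<in>AC a b. \<exists>H. AC_version a b (\<lambda>t. partial3 L (jet \<alpha> a v t)) H"
    and "extremal (action \<alpha> a A B L) (admissible \<alpha> a b A B L a0) u"
    and "AC_version a b (\<lambda>t. partial3 L (jet \<alpha> a u t)) G"
  shows "(AE t\<in>{A<..<B} in lebesgue.
            partial2 L (jet \<alpha> a u t) + right_Caputo \<alpha> B G t
              + G B * (1 / Gamma (1 - \<alpha>)) * (1 / (B - t) powr \<alpha>) = 0) \<and>
         (\<forall>t\<in>{a<..<A}. right_RL \<alpha> B G t - right_RL \<alpha> A G t = 0)"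
proof -
  note \<alpha> = assms(1,2) and AB = assms(3-5) and C1 = assms(6) and reg = assms(7) and ext = assms(8) and Gv = assms(9)
  have ab: "a < b" using AB by simp
  have uAC: "u \<in> AC a b"
    using ext by (auto simp: extremal_def is_arg_min_def is_arg_max_def admissible_def)
  have G: "G \<in> AC a b" using Gv by (simp add: AC_version_def)
  have Gc: "continuous_on {A..B} G"
    by (rule continuous_on_subset[OF AC_imp_continuous_on[OF G]]) (use AB in auto)
  define \<Gamma> where "\<Gamma> = Gamma (1 - \<alpha>)"
  have \<Gamma>: "\<Gamma> > 0" unfolding \<Gamma>_def using \<alpha> by (simp add: Gamma_real_pos)
  define P where "P = (\<lambda>t. partial2 L (jet \<alpha> a u t))"
  define K where "K = (\<lambda>x. LINT t:{A<..<B}|lebesgue. right_kernel \<alpha> x t * G t)"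
  have Pm: "(\<lambda>t. indicator {A<..<B} t * P t) \<in> borel_measurable lebesgue"
    unfolding P_def by (rule borel_measurable_jet[OF \<alpha>(2) continuous_on_partial2[OF C1] uAC AB])
  have weak: "(LINT t:{A<..<B}|lebesgue. P t * trapezoid 0 x y h t + G t * (trapezoid \<alpha> x y h t / \<Gamma>)) = 0"
    "set_integrable lebesgue {A<..<B} (\<lambda>t. P t * trapezoid 0 x y h t + G t * (trapezoid \<alpha> x y h t / \<Gamma>))"
    if xy: "a < x" "x < y" "0 < h" "y + h < b" for x y h
  proof -
    have d: "has_density a b (trapezoid 0 x y h) 0 (trapezoid_slope x y h)"
      by (rule has_density_trapezoid) (use xy in auto)
    have s: "trapezoid 0 x y h t = 0" if "t \<in> {a..b}" "t \<notin> {x..y + h}" for t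
      by (rule trapezoid_0_support) (use that xy in auto)
    have w: "trapezoid \<alpha> x y h t / \<Gamma> = abel_density \<alpha> a 0 (trapezoid_slope x y h) t / Gamma (1 - \<alpha>)" for t
      using abel_density_trapezoid[OF \<alpha>(2), of a x y h t] xy by (simp add: \<Gamma>_def)
    have wc: "continuous_on {a..b} (\<lambda>t. trapezoid \<alpha> x y h t / \<Gamma>)"
      using \<Gamma> by (intro continuous_on_divide continuous_on_trapezoid[OF \<alpha>(2)] continuous_on_const) auto
    show "(LINT t:{A<..<B}|lebesgue. P t * trapezoid 0 x y h t + G t * (trapezoid \<alpha> x y h t / \<Gamma>)) = 0"
      "set_integrable lebesgue {A<..<B} (\<lambda>t. P t * trapezoid 0 x y h t + G t * (trapezoid \<alpha> x y h t / \<Gamma>))"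
      unfolding P_def by (rule weak_euler_lagrange[OF \<alpha> AB C1 reg ext Gv d xy(1) xy(4) s w wc]; assumption)+
  qed
  have Pint: "set_integrable lebesgue {x..y} P" if xy: "A < x" "x \<le> y" "y < B" for x y
  proof -
    \<comment> \<open>a trapezoid equal to \<open>1\<close> on \<open>[x,y]\<close> with ramps inside \<open>(A,B)\<close> exhibits \<open>P\<close> as integrable there\<close>
    define \<rho> where "\<rho> = min (x - A) (B - y) / 2"
    have \<rho>: "\<rho> > 0" "A < x - \<rho>" "y + \<rho> < B" using xy by (auto simp: \<rho>_def min_def field_simps)
    have 1: "set_integrable lebesgue {A<..<B} (\<lambda>t. P t * trapezoid 0 (x - \<rho>) y \<rho> t + G t * (trapezoid \<alpha> (x - \<rho>) y \<rho> t / \<Gamma>))"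
      by (rule weak(2)) (use \<rho> xy AB in auto)
    have "continuous_on {A..B} (\<lambda>t. G t * (trapezoid \<alpha> (x - \<rho>) y \<rho> t / \<Gamma>))"
      using \<Gamma> by (intro continuous_on_mult Gc continuous_on_divide continuous_on_trapezoid[OF \<alpha>(2)] continuous_on_const) auto
    then have "set_integrable lborel {A..B} (\<lambda>t. G t * (trapezoid \<alpha> (x - \<rho>) y \<rho> t / \<Gamma>))"
      by (rule borel_integrable_atLeastAtMost')
    then have 2: "set_integrable lebesgue {A..B} (\<lambda>t. G t * (trapezoid \<alpha> (x - \<rho>) y \<rho> t / \<Gamma>))"
      by (rule set_integral_lebesgue_eq_lborel)
    have sub: "{x..y} \<subseteq> {A<..<B}" "{x..y} \<subseteq> {A..B}" using xy by auto
    have "set_integrable lebesgue {x..y} (\<lambda>t. (P t * trapezoid 0 (x - \<rho>) y \<rho> t + G t * (trapezoid \<alpha> (x - \<rho>) y \<rho> t / \<Gamma>))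
        - G t * (trapezoid \<alpha> (x - \<rho>) y \<rho> t / \<Gamma>))"
      by (rule set_integral_diff(1)[OF set_integrable_subset[OF 1 _ sub(1)] set_integrable_subset[OF 2 _ sub(2)]]) auto
    then have "set_integrable lebesgue {x..y} (\<lambda>t. P t * trapezoid 0 (x - \<rho>) y \<rho> t)" by simp
    moreover have "trapezoid 0 (x - \<rho>) y \<rho> t = 1" if "t \<in> {x..y}" for t
      by (rule trapezoid_0_plateau) (use that \<rho> xy in auto)
    ultimately show ?thesis
      by (subst set_integrable_cong[of lebesgue lebesgue "{x..y}" "{x..y}" P "\<lambda>t. P t * trapezoid 0 (x - \<rho>) y \<rho> t"]) auto
  qed
  \<comment> \<open>the weak equation in the limit of steep ramps, with the local and the nonlocal term separated\<close>
  have key: "(LINT t:{A<..<B}|lebesgue. P t * indicator {x<..y} t) + (K x - K y) / \<Gamma> = 0"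
    if xy: "a < x" "x < y" "0 < \<delta>" "y + \<delta> < b" and P: "set_integrable lebesgue ({A<..<B} \<inter> {x..y + \<delta>}) P" for x y \<delta>
  proof -
    have rk: "set_integrable lebesgue {A<..<B} (\<lambda>t. right_kernel \<alpha> z t * G t)" if "z \<in> {a..b}" for z
      by (rule right_kernel_mult_integrable[OF \<alpha>(2) AB G that])
    have z: "x \<in> {a..b}" "y \<in> {a..b}" using xy by auto
    have factor: "G t * ((right_kernel \<alpha> x t - right_kernel \<alpha> y t) / \<Gamma>)
        = (1 / \<Gamma>) * (right_kernel \<alpha> x t * G t - right_kernel \<alpha> y t * G t)" for t
      by (simp add: diff_divide_distrib algebra_simps)
    have int2: "set_integrable lebesgue {A<..<B} (\<lambda>t. (1 / \<Gamma>) * (right_kernel \<alpha> x t * G t - right_kernel \<alpha> y t * G t))"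
      by (intro set_integrable_mult_right set_integral_diff(1) rk z)
    have val2: "(LINT t:{A<..<B}|lebesgue. (1 / \<Gamma>) * (right_kernel \<alpha> x t * G t - right_kernel \<alpha> y t * G t)) = (K x - K y) / \<Gamma>"
      unfolding K_def set_integral_mult_right set_integral_diff(2)[OF rk[OF z(1)] rk[OF z(2)]] by simp
    have int1: "set_integrable lebesgue {A<..<B} (\<lambda>t. P t * indicator {x<..y} t)"
    proof -
      have "set_integrable lebesgue ({A<..<B} \<inter> {x<..y}) P"
        by (rule set_integrable_subset[OF P]) (use xy in auto)
      then show ?thesis
        unfolding set_integrable_def by (simp add: indicator_inter_arith mult.assoc mult.left_commute mult.commute)
    qed
    have "(LINT t:{A<..<B}|lebesgue. P t * indicator {x<..y} t
            + G t * ((right_kernel \<alpha> x t - right_kernel \<alpha> y t) / \<Gamma>)) = 0"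
      by (rule du_bois_reymond_trapezoid_limit[OF \<alpha> xy(2,3) \<Gamma> P Pm Gc]) (rule weak(1); use xy in auto)
    then show ?thesis
      unfolding factor set_integral_add(2)[OF int1 int2] val2 .
  qed
  have second: "right_RL \<alpha> B G t - right_RL \<alpha> A G t = 0" if t: "t \<in> {a<..<A}" for t
  proof (rule right_RL_diff_eq_0[OF \<alpha>(2) AB G _ t])
    fix x y assume xy: "a < x" "x < y" "y < A"
    define \<delta> where "\<delta> = (A - y) / 2"
    have \<delta>: "0 < \<delta>" "y + \<delta> < A" using xy by (auto simp: \<delta>_def field_simps)
    have "{A<..<B} \<inter> {x..y + \<delta>} = {}" using \<delta> by auto
    then have "set_integrable lebesgue ({A<..<B} \<inter> {x..y + \<delta>}) P" by (simp add: set_integrable_def)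
    then have "(LINT t:{A<..<B}|lebesgue. P t * indicator {x<..y} t) + (K x - K y) / \<Gamma> = 0"
      using key[of x y \<delta>] xy \<delta> AB by auto
    moreover have "(LINT t:{A<..<B}|lebesgue. P t * indicator {x<..y} t) = integral\<^sup>L lebesgue (\<lambda>t::real. 0::real)"
      unfolding set_lebesgue_integral_def
      by (intro Bochner_Integration.integral_cong refl) (use xy in \<open>auto split: split_indicator\<close>)
    ultimately have "K x = K y" using \<Gamma> by simp
    then show "(LINT t:{A<..<B}|lebesgue. right_kernel \<alpha> x t * G t) = (LINT t:{A<..<B}|lebesgue. right_kernel \<alpha> y t * G t)"
      by (simp add: K_def)
  qed
  have GAB: "G \<in> AC A B" by (rule AC_subinterval[OF G AB(1) AB(3)])
  then obtain g where g: "has_density A B G (G A) g" using AC_has_density[OF _ AB(2)] by blast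
  \<comment> \<open>up to the factor \<open>\<Gamma>\<close>, the boundary term plus the Caputo derivative\<close>
  define \<Psi> where "\<Psi> = abel_density_right \<alpha> B (G B) g"
  have \<Psi>int: "set_integrable lborel {A..B} \<Psi>"
    unfolding \<Psi>_def by (rule abel_density_right_integrable[OF \<alpha>(2) AB(2) g])
  have K\<Psi>: "K x = (LINT s:{x..B}|lborel. \<Psi> s)" if x: "x \<in> {A..B}" for x
  proof -
    have "K x = (LINT \<theta>:{x<..<B}|lebesgue. (\<theta> - x) powr (-\<alpha>) * G \<theta>)"
      unfolding K_def set_lebesgue_integral_def
      by (intro Bochner_Integration.integral_cong refl) (use x in \<open>auto simp: right_kernel_def split: split_indicator\<close>)
    also have "\<dots> = (LINT \<theta>:{x<..<B}|lborel. (\<theta> - x) powr (-\<alpha>) * G \<theta>)"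
      by (rule set_integral_lebesgue_eq_lborel(2)[OF abel_integrand_right_integrable[OF \<alpha>(2) AB(2) g x]])
    also have "\<dots> = (LINT s:{x..B}|lborel. \<Psi> s)"
      unfolding \<Psi>_def by (rule abel_integral_right_primitive[OF \<alpha>(2) AB(2) g x])
    finally show ?thesis .
  qed
  \<comment> \<open>a Borel version of \<open>P\<close>, to be able to differentiate its integral in \<open>lborel\<close>\<close>
  obtain Pb where Pb: "Pb \<in> borel_measurable lborel" and PbAE: "AE t in lborel. indicator {A<..<B} t * P t = Pb t"
    using completion_ex_borel_measurable_real[OF Pm] by blast
  have PbAE': "AE t in lebesgue. indicator {A<..<B} t * P t = Pb t" by (rule AE_completion[OF PbAE])
  have Pbint: "set_integrable lborel {x..y} Pb" "(LINT t:{x..y}|lborel. Pb t) = (LINT t:{A<..<B}|lebesgue. P t * indicator {x<..y} t)"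
    if xy: "A < x" "x < y" "y < B" for x y
  proof -
    have bm: "(\<lambda>t. indicator {x..y} t *\<^sub>R Pb t) \<in> borel_measurable lborel"
      using Pb by (intro borel_measurable_scaleR borel_measurable_indicator) auto
    have bm': "(\<lambda>t. indicator {x..y} t *\<^sub>R Pb t) \<in> borel_measurable lebesgue" by (rule measurable_completion[OF bm])
    have i: "integrable lebesgue (\<lambda>t. indicator {x..y} t *\<^sub>R P t)"
      using Pint[of x y] xy by (simp add: set_integrable_def)
    have ae: "AE t in lebesgue. indicator {x..y} t *\<^sub>R P t = indicator {x..y} t *\<^sub>R Pb t"
      using PbAE' by eventually_elim (use xy in \<open>auto split: split_indicator_asm split_indicator\<close>)
    have "integrable lebesgue (\<lambda>t. indicator {x..y} t *\<^sub>R Pb t)"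
      by (rule integrable_cong_AE_imp[OF i bm']) (use ae in eventually_elim, simp)
    then show "set_integrable lborel {x..y} Pb"
      unfolding set_integrable_def using integrable_completion[OF bm] by blast
    have "(LINT t:{x..y}|lborel. Pb t) = integral\<^sup>L lebesgue (\<lambda>t. indicator {x..y} t *\<^sub>R Pb t)"
      unfolding set_lebesgue_integral_def by (rule integral_completion[OF bm, symmetric])
    also have "\<dots> = integral\<^sup>L lebesgue (\<lambda>t. indicator {A<..<B} t *\<^sub>R (P t * indicator {x<..y} t))"
    proof (rule integral_cong_AE[OF bm'])
      have "(\<lambda>t. (indicator {A<..<B} t * P t) * indicator {x<..y} t) \<in> borel_measurable lebesgue"
        by (intro borel_measurable_times Pm borel_measurable_indicator) auto
      then show "(\<lambda>t. indicator {A<..<B} t *\<^sub>R (P t * indicator {x<..y} t)) \<in> borel_measurable lebesgue"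
        by (simp add: mult.assoc)
      show "AE t in lebesgue. indicator {x..y} t *\<^sub>R Pb t = indicator {A<..<B} t *\<^sub>R (P t * indicator {x<..y} t)"
        using ae AE_completion[OF AE_lborel_singleton[of x]]
        by eventually_elim (use xy in \<open>auto split: split_indicator_asm split_indicator\<close>)
    qed
    finally show "(LINT t:{x..y}|lborel. Pb t) = (LINT t:{A<..<B}|lebesgue. P t * indicator {x<..y} t)"
      by (simp add: set_lebesgue_integral_def)
  qed
  have "AE t\<in>{A<..<B} in lebesgue. \<Gamma> * Pb t + \<Psi> t = 0"
  proof (rule AE_eq_0_if_integrals_eq_0[OF _ _ AB(2)])
    fix x y assume xy: "A < x" "x < y" "y < B"
    have P1: "set_integrable lborel {x..y} (\<lambda>t. \<Gamma> * Pb t)" using Pbint(1)[OF xy] by simp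
    have P2: "set_integrable lborel {x..y} \<Psi>"
      by (rule set_integrable_subset[OF \<Psi>int]) (use xy in auto)
    show "set_integrable lborel {x..y} (\<lambda>t. \<Gamma> * Pb t + \<Psi> t)" by (rule set_integral_add(1)[OF P1 P2])
    define \<delta> where "\<delta> = (B - y) / 2"
    have \<delta>: "0 < \<delta>" "y + \<delta> < B" using xy by (auto simp: \<delta>_def field_simps)
    have "{A<..<B} \<inter> {x..y + \<delta>} = {x..y + \<delta>}" using xy \<delta> by auto
    then have "set_integrable lebesgue ({A<..<B} \<inter> {x..y + \<delta>}) P" using Pint[of x "y + \<delta>"] xy \<delta> by simp
    then have k: "(LINT t:{A<..<B}|lebesgue. P t * indicator {x<..y} t) + (K x - K y) / \<Gamma> = 0"
      using key[of x y \<delta>] xy \<delta> AB by auto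
    have "(LINT s:{x..B}|lborel. \<Psi> s) = (LINT s:{x..y}|lborel. \<Psi> s) + (LINT s:{y..B}|lborel. \<Psi> s)"
      by (rule lborel_set_integral_split) (use xy in \<open>auto intro: set_integrable_subset[OF \<Psi>int]\<close>)
    then have "(LINT s:{x..y}|lborel. \<Psi> s) = K x - K y"
      using K\<Psi>[of x] K\<Psi>[of y] xy by simp
    then show "(LINT t:{x..y}|lborel. \<Gamma> * Pb t + \<Psi> t) = 0"
      using k \<Gamma> unfolding set_integral_add(2)[OF P1 P2] set_integral_mult_right Pbint(2)[OF xy]
      by (simp add: field_simps)
  qed
  then have "AE t\<in>{A<..<B} in lebesgue. partial2 L (jet \<alpha> a u t) + right_Caputo \<alpha> B G t
              + G B * (1 / Gamma (1 - \<alpha>)) * (1 / (B - t) powr \<alpha>) = 0"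
    using PbAE'
  proof eventually_elim
    case (elim t)
    show ?case
    proof
      assume t: "t \<in> {A<..<B}"
      let ?c = "LINT \<theta>:{t<..<B}|lborel. (\<theta> - t) powr (-\<alpha>) * g \<theta>"
      have "\<Gamma> * P t + (G B * (B - t) powr (-\<alpha>) - ?c) = 0"
        using elim t by (simp add: \<Psi>_def abel_density_right_def)
      then have "P t = (?c - G B * (B - t) powr (-\<alpha>)) / \<Gamma>"
        using \<Gamma> by (simp add: field_simps)
      moreover have "right_Caputo \<alpha> B G t = - (1 / \<Gamma>) * ?c"
        unfolding \<Gamma>_def by (rule right_Caputo_eq_density[OF g]) (use t in simp)
      moreover have "1 / (B - t) powr \<alpha> = (B - t) powr (-\<alpha>)" by (simp add: powr_minus_divide)
      ultimately show "partial2 L (jet \<alpha> a u t) + right_Caputo \<alpha> B G t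
              + G B * (1 / Gamma (1 - \<alpha>)) * (1 / (B - t) powr \<alpha>) = 0"
        unfolding P_def \<Gamma>_def[symmetric] by (simp add: diff_divide_distrib)
    qed
  qed
  with second show ?thesis by blast
qed

end
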